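(* Let $(A,\mathfrak m)$ be a one-dimensional Cohen-Macaulay local ring with infinite residue field and reduction number $r$, and let $xA$ be a minimal reduction of $\mathfrak m$. Let $\alpha_{i,j}$ be the torsion invariants of the tangent cone with respect to $x$, $\beta_i$ the micro-invariants of $A$, and $\gamma_i$ the Apery invariants of $A$ with respect to $x$. Put $$\nu_i=\lambda\left(\frac{\mathfrak m^{i}\cap xA+\mathfrak m^{i+1}}{x\mathfrak m^{i-1}+\mathfrak m^{i+1}}\right)\ (1\le i\le r),\qquad g_i=\lambda\left(\frac{(\mathfrak m^r:x^{r-i})}{\mathfrak m^{i}+(\mathfrak m^r:x^{r-i-1})}\right)\ (0\le i\le r).$$ Then for $1\le i\le r$, $$\beta_i+\sum_{j=1}^{r-i-1}\alpha_{i,j}=\gamma_i+\nu_i+g_i-g_{i-1}.$$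
   Context: $\lambda$ denotes length of $A$-modules and $\mathfrak m^0=A$. $K=A/\mathfrak m$. Empty sums are $0$. For an ideal $I$ and $y\in A$, $(I:y)=\{a\in A: ya\in I\}$; for $i=r$ the symbol $(\mathfrak m^r:x^{-1})$ is read as $\mathfrak m^{r+1}$. The tangent cone is $G(\mathfrak m)=\bigoplus_{n\ge 0}\mathfrak m^n/\mathfrak m^{n+1}$. An ideal $xA$ with $x\in\mathfrak m$ is a minimal reduction of $\mathfrak m$ if $\mathfrak m^{n+1}=x\mathfrak m^n$ for some $n$; the reduction number $r$ is the least integer $r\ge 0$ with $\mathfrak m^{r+1}=x\mathfrak m^r$ (independent of the choice of $x$). Invariants of the tangent cone: let $F(x)=\bigoplus_{n\ge 0}x^nA/x^n\mathfrak m\hookrightarrow G(\mathfrak m)$, a polynomial ring $K[x^*]$ in the initial form $x^*\in\mathfrak m/\mathfrak m^2$. As a graded $F(x)$-module, $$G(\mathfrak m)\cong\bigoplus_{i=0}^{r}\left(F(x)(-i)\right)^{\alpha_i}\oplus\bigoplus_{i=1}^{r-1}\bigoplus_{j=1}^{r-i}\left(\frac{F(x)}{(x^* )^jF(x)}(-i)\right)^{\alpha_{i,j}}$$ for uniquely determined non-negative integers $\alpha_i,\alpha_{i,j}$ (with $\alpha_0=1$). Micro-invariants: let $A'=A[\mathfrak m/x]$ be the first neighborhood ring of $A$, i.e. the subring of the total ring of fractions of $A$ generated over $A$ by the elements $b/x$, $b\in\mathfrak m$. Then $\beta_0=1$ and, for $1\le i\le r$, $$\beta_i=\lambda\left(\frac{A+\mathfrak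 m^{i-1}A'}{A+\mathfrak m^iA'}\right)-\lambda\left(\frac{A+\mathfrak m^{i}A'}{A+\mathfrak m^{i+1}A'}\right).$$ Apery invariants with respect to $x$: $\gamma_i=\lambda\left(\dfrac{\mathfrak m^i+xA}{\mathfrak m^{i+1}+xA}\right)$. *)

theory Defs
  imports "HOL-Library.Extended_Nat" "HOL-Algebra.Ring_Divisibility" "HOL-Algebra.Ideal_Product" "HOL-Algebra.Generated_Rings"
    "HOL-Algebra.QuotRing" "HOL-Algebra.Module"
begin

section \<open>One-dimensional Cohen--Macaulay local rings\<close>

definition noetherian_local_ring :: "('a, 'c) ring_scheme \<Rightarrow> 'a set \<Rightarrow> bool" where
  "noetherian_local_ring A \<mm> \<longleftrightarrow>
     cring A \<and> noetherian_ring A \<and> maximalideal \<mm> A \<and> (\<forall>\<nn>. maximalideal \<nn> A \<longrightarrow> \<nn> = \<mm>)"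

definition krull_dim :: "('a, 'c) ring_scheme \<Rightarrow> enat" where
  "krull_dim A = Sup {enat n | n. \<exists>P :: nat \<Rightarrow> 'a set.
     (\<forall>k\<le>n. primeideal (P k) A) \<and> (\<forall>k<n. P k \<subset> P (Suc k))}"

text \<open>For a local ring, a sequence in the maximal ideal \<open>\<mm>\<close> generates a proper ideal, so the
  condition \<open>(x\<^sub>1,\<dots>,x\<^sub>n) \<noteq> A\<close> on regular sequences is automatic.\<close>

definition regular_sequence :: "('a, 'c) ring_scheme \<Rightarrow> 'a set \<Rightarrow> 'a list \<Rightarrow> bool" where
  "regular_sequence A \<mm> xs \<longleftrightarrow> set xs \<subseteq> \<mm> \<and>
     (\<forall>k<length xs. \<forall>a\<in>carrier A.
        (xs ! k) \<otimes>\<^bsub>A\<^esub> a \<in> Idl\<^bsub>A\<^esub> (set (take k xs)) \<longrightarrow> a \<in> Idl\<^bsub>A\<^esub> (set (take k xs)))"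

definition local_depth :: "('a, 'c) ring_scheme \<Rightarrow> 'a set \<Rightarrow> enat" where
  "local_depth A \<mm> = Sup {enat (length xs) | xs. regular_sequence A \<mm> xs}"

definition cohen_macaulay_local_ring :: "('a, 'c) ring_scheme \<Rightarrow> 'a set \<Rightarrow> bool" where
  "cohen_macaulay_local_ring A \<mm> \<longleftrightarrow>
     noetherian_local_ring A \<mm> \<and> local_depth A \<mm> = krull_dim A"


section \<open>Quotient modules and length\<close>

text \<open>Module records contain the fields of a ring; the predicate \<^const>\<open>module\<close> ignores the
  fields \<open>mult\<close> and \<open>one\<close> of the module, so they are irrelevant here.\<close>

definition quot_module :: "('r, 'a, 'm) module_scheme \<Rightarrow> 'a set \<Rightarrow> ('r, 'a set) module" where
  "quot_module M N = \<lparr> carrier = a_rcosets\<^bsub>M\<^esub> N, monoid.mult = undefined, one = undefined,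
     zero = N, add = set_add M,
     smult = (\<lambda>a C. \<Union>v\<in>C. N +>\<^bsub>M\<^esub> (a \<odot>\<^bsub>M\<^esub> v)) \<rparr>"

definition self_module :: "('a, 'c) ring_scheme \<Rightarrow> ('a, 'a) module" where
  "self_module A = \<lparr> carrier = carrier A, monoid.mult = monoid.mult A, one = one A, zero = zero A,
     add = add A, smult = monoid.mult A \<rparr>"

definition module_length :: "('r, 'c) ring_scheme \<Rightarrow> ('r, 'a, 'm) module_scheme \<Rightarrow> enat" where
  "module_length A M = Sup {enat n | n. \<exists>N :: nat \<Rightarrow> 'a set.
     (\<forall>k\<le>n. submodule (N k) A M) \<and> (\<forall>k<n. N k \<subset> N (Suc k))}"

text \<open>The length of \<open>U/V\<close> for submodules \<open>V \<subseteq> U\<close> of \<open>M\<close>, as a natural number; meaningful only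
  if the length is finite.\<close>

definition quot_length ::
    "('r, 'c) ring_scheme \<Rightarrow> ('r, 'a, 'm) module_scheme \<Rightarrow> 'a set \<Rightarrow> 'a set \<Rightarrow> nat" where
  "quot_length A M U V = the_enat (module_length A (quot_module (M\<lparr>carrier := U\<rparr>) V))"


section \<open>Ideals and reductions\<close>

fun ideal_pow :: "('a, 'c) ring_scheme \<Rightarrow> 'a set \<Rightarrow> nat \<Rightarrow> 'a set" where
  "ideal_pow A I 0 = carrier A"
| "ideal_pow A I (Suc n) = I \<cdot>\<^bsub>A\<^esub> ideal_pow A I n"

definition colon :: "('a, 'c) ring_scheme \<Rightarrow> 'a set \<Rightarrow> 'a \<Rightarrow> 'a set" where
  "colon A I y = {a \<in> carrier A. y \<otimes>\<^bsub>A\<^esub> a \<in> I}"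

text \<open>The product \<open>x I\<close> is the library's \<open>x <#\<^bsub>A\<^esub> I\<close>.\<close>

definition minimal_reduction :: "('a, 'c) ring_scheme \<Rightarrow> 'a set \<Rightarrow> 'a \<Rightarrow> bool" where
  "minimal_reduction A \<mm> x \<longleftrightarrow>
     x \<in> \<mm> \<and> (\<exists>n. ideal_pow A \<mm> (n + 1) = x <#\<^bsub>A\<^esub> ideal_pow A \<mm> n)"

definition reduction_number :: "('a, 'c) ring_scheme \<Rightarrow> 'a set \<Rightarrow> 'a \<Rightarrow> nat" where
  "reduction_number A \<mm> x = (LEAST n. ideal_pow A \<mm> (n + 1) = x <#\<^bsub>A\<^esub> ideal_pow A \<mm> n)"


section \<open>The total ring of fractions and the first neighborhood ring\<close>

definition regular_elements :: "('a, 'c) ring_scheme \<Rightarrow> 'a set" where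
  "regular_elements A =
     {s \<in> carrier A. \<forall>a\<in>carrier A. s \<otimes>\<^bsub>A\<^esub> a = \<zero>\<^bsub>A\<^esub> \<longrightarrow> a = \<zero>\<^bsub>A\<^esub>}"

text \<open>The fraction \<open>a/s\<close> as an equivalence class of pairs. Since all denominators are regular,
  \<open>a/s = b/t\<close> simply means \<open>a t = b s\<close>.\<close>

definition frac :: "('a, 'c) ring_scheme \<Rightarrow> 'a \<Rightarrow> 'a \<Rightarrow> ('a \<times> 'a) set" where
  "frac A a s = {(b, t). b \<in> carrier A \<and> t \<in> regular_elements A \<and> a \<otimes>\<^bsub>A\<^esub> t = b \<otimes>\<^bsub>A\<^esub> s}"

definition total_frac_ring :: "('a, 'c) ring_scheme \<Rightarrow> ('a \<times> 'a) set ring" where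
  "total_frac_ring A =
     \<lparr> carrier = {frac A a s | a s. a \<in> carrier A \<and> s \<in> regular_elements A},
       monoid.mult = (\<lambda>p q. \<Union>(a, s)\<in>p. \<Union>(b, t)\<in>q. frac A (a \<otimes>\<^bsub>A\<^esub> b) (s \<otimes>\<^bsub>A\<^esub> t)),
       one = frac A \<one>\<^bsub>A\<^esub> \<one>\<^bsub>A\<^esub>,
       zero = frac A \<zero>\<^bsub>A\<^esub> \<one>\<^bsub>A\<^esub>,
       add = (\<lambda>p q. \<Union>(a, s)\<in>p. \<Union>(b, t)\<in>q.
                frac A (a \<otimes>\<^bsub>A\<^esub> t \<oplus>\<^bsub>A\<^esub> b \<otimes>\<^bsub>A\<^esub> s) (s \<otimes>\<^bsub>A\<^esub> t)) \<rparr>"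

definition to_frac :: "('a, 'c) ring_scheme \<Rightarrow> 'a \<Rightarrow> ('a \<times> 'a) set" where
  "to_frac A a = frac A a \<one>\<^bsub>A\<^esub>"

definition total_frac_module :: "('a, 'c) ring_scheme \<Rightarrow> ('a, ('a \<times> 'a) set) module" where
  "total_frac_module A =
     \<lparr> carrier = carrier (total_frac_ring A), monoid.mult = monoid.mult (total_frac_ring A),
       one = one (total_frac_ring A), zero = zero (total_frac_ring A),
       add = add (total_frac_ring A),
       smult = (\<lambda>a q. to_frac A a \<otimes>\<^bsub>total_frac_ring A\<^esub> q) \<rparr>"

definition first_neighborhood :: "('a, 'c) ring_scheme \<Rightarrow> 'a set \<Rightarrow> 'a \<Rightarrow> ('a \<times> 'a) set set" where
  "first_neighborhood A \<mm> x =
     generate_ring (total_frac_ring A) (to_frac A ` carrier A \<union> {frac A b x | b. b \<in> \<mm>})"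

text \<open>\<open>A + \<mm>\<^sup>i A'\<close>, where \<open>\<mm>\<^sup>i A'\<close> is the ideal of \<open>A'\<close> generated by the image of \<open>\<mm>\<^sup>i\<close>.\<close>

definition neighborhood_filtration ::
    "('a, 'c) ring_scheme \<Rightarrow> 'a set \<Rightarrow> 'a \<Rightarrow> nat \<Rightarrow> ('a \<times> 'a) set set" where
  "neighborhood_filtration A \<mm> x i =
     to_frac A ` carrier A <+>\<^bsub>total_frac_ring A\<^esub>
       (Idl\<^bsub>(total_frac_ring A)\<lparr>carrier := first_neighborhood A \<mm> x\<rparr>\<^esub>
          (to_frac A ` ideal_pow A \<mm> i))"

definition micro_invariant :: "('a, 'c) ring_scheme \<Rightarrow> 'a set \<Rightarrow> 'a \<Rightarrow> nat \<Rightarrow> int" where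
  "micro_invariant A \<mm> x i =
     (if i = 0 then 1
      else int (quot_length A (total_frac_module A)
                  (neighborhood_filtration A \<mm> x (i - 1)) (neighborhood_filtration A \<mm> x i))
         - int (quot_length A (total_frac_module A)
                  (neighborhood_filtration A \<mm> x i) (neighborhood_filtration A \<mm> x (i + 1))))"


section \<open>Graded modules\<close>

record ('r, 'a) graded_module = "('r, 'a) module" +
  component :: "nat \<Rightarrow> 'a set"

definition graded_iso :: "('r, 'c) ring_scheme \<Rightarrow>
    ('r, 'a, 'm) graded_module_scheme \<Rightarrow> ('r, 'b, 'n) graded_module_scheme \<Rightarrow>
    ('a \<Rightarrow> 'b) \<Rightarrow> bool" where
  "graded_iso R M N \<phi> \<longleftrightarrow>
     bij_betw \<phi> (carrier M) (carrier N) \<and>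
     (\<forall>u\<in>carrier M. \<forall>v\<in>carrier M. \<phi> (u \<oplus>\<^bsub>M\<^esub> v) = \<phi> u \<oplus>\<^bsub>N\<^esub> \<phi> v) \<and>
     (\<forall>c\<in>carrier R. \<forall>u\<in>carrier M. \<phi> (c \<odot>\<^bsub>M\<^esub> u) = c \<odot>\<^bsub>N\<^esub> \<phi> u) \<and>
     (\<forall>n. \<phi> ` component M n = component N n)"

text \<open>The shift \<open>M(-i)\<close>, with \<open>M(-i)\<^sub>n = M\<^sub>n\<^sub>-\<^sub>i\<close>.\<close>

definition graded_shift :: "('r, 'a) graded_module \<Rightarrow> nat \<Rightarrow> ('r, 'a) graded_module" where
  "graded_shift M i =
     M\<lparr>component := (\<lambda>n. if n < i then {\<zero>\<^bsub>M\<^esub>} else component M (n - i))\<rparr>"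

definition graded_quot ::
    "('r, 'a) graded_module \<Rightarrow> 'a set \<Rightarrow> ('r, 'a set) graded_module" where
  "graded_quot M N = module.extend (quot_module M N)
     (graded_module.fields (\<lambda>n. (\<lambda>u. N +>\<^bsub>M\<^esub> u) ` component M n))"

text \<open>Direct sum over a finite index set \<open>I\<close>.\<close>

definition graded_dsum ::
    "'i set \<Rightarrow> ('i \<Rightarrow> ('r, 'a) graded_module) \<Rightarrow> ('r, 'i \<Rightarrow> 'a) graded_module" where
  "graded_dsum I M =
     \<lparr> carrier = (\<Pi>\<^sub>E i\<in>I. carrier (M i)), monoid.mult = undefined, one = undefined,
       zero = (\<lambda>i\<in>I. \<zero>\<^bsub>M i\<^esub>),
       add = (\<lambda>u v. \<lambda>i\<in>I. u i \<oplus>\<^bsub>M i\<^esub> v i),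
       smult = (\<lambda>c u. \<lambda>i\<in>I. c \<odot>\<^bsub>M i\<^esub> u i),
       component = (\<lambda>n. \<Pi>\<^sub>E i\<in>I. component (M i) n) \<rparr>"

definition graded_sum2 ::
    "('r, 'a) graded_module \<Rightarrow> ('r, 'b) graded_module \<Rightarrow> ('r, 'a \<times> 'b) graded_module" where
  "graded_sum2 M N =
     \<lparr> carrier = carrier M \<times> carrier N, monoid.mult = undefined, one = undefined,
       zero = (\<zero>\<^bsub>M\<^esub>, \<zero>\<^bsub>N\<^esub>),
       add = (\<lambda>(u, u') (v, v'). (u \<oplus>\<^bsub>M\<^esub> v, u' \<oplus>\<^bsub>N\<^esub> v')),
       smult = (\<lambda>c (u, u'). (c \<odot>\<^bsub>M\<^esub> u, c \<odot>\<^bsub>N\<^esub> u')),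
       component = (\<lambda>n. component M n \<times> component N n) \<rparr>"


section \<open>The tangent cone as a graded module over \<open>F(x)\<close>\<close>

text \<open>
  For filtrations \<open>I\<close>, \<open>J\<close> by ideals with \<open>J n \<subseteq> I n\<close>, the elements of \<open>\<Oplus>\<^sub>n I n / J n\<close> are
  represented by finitely supported functions \<open>f\<close> with \<open>f n\<close> a coset of \<open>J n\<close> in \<open>I n\<close>.
  The product in degree \<open>n\<close> is the coset modulo \<open>J n\<close> of \<open>\<Sum>k\<le>n. c k * d (n - k)\<close> for any
  representatives \<open>c k \<in> f k\<close> and \<open>d k \<in> g k\<close>. The same formula yields the product of \<open>F(x)\<close>, with
  \<open>J n = x\<^sup>n \<mm>\<close>, the product of \<open>G(\<mm>)\<close>, with \<open>J n = \<mm>\<^sup>n\<^sup>+\<^sup>1\<close>, and also the action of \<open>F(x)\<close>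
  on \<open>G(\<mm>)\<close> through \<open>F(x) \<hookrightarrow> G(\<mm>)\<close>, with \<open>J n = \<mm>\<^sup>n\<^sup>+\<^sup>1\<close> and \<open>f \<in> F(x)\<close>: a representative of
  \<open>f k\<close> modulo \<open>x\<^sup>k \<mm>\<close> is also one of its image in \<open>\<mm>\<^sup>k/\<mm>\<^sup>k\<^sup>+\<^sup>1\<close>.
\<close>

definition assoc_mult :: "('a, 'c) ring_scheme \<Rightarrow> (nat \<Rightarrow> 'a set) \<Rightarrow>
    (nat \<Rightarrow> 'a set) \<Rightarrow> (nat \<Rightarrow> 'a set) \<Rightarrow> nat \<Rightarrow> 'a set" where
  "assoc_mult A J f g n =
     (\<Union>c\<in>{c. \<forall>k. c k \<in> f k}. \<Union>d\<in>{d. \<forall>k. d k \<in> g k}.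
        J n +>\<^bsub>A\<^esub> (\<Oplus>\<^bsub>A\<^esub>k\<in>{..n}. c k \<otimes>\<^bsub>A\<^esub> d (n - k)))"

definition assoc_carrier :: "('a, 'c) ring_scheme \<Rightarrow> (nat \<Rightarrow> 'a set) \<Rightarrow> (nat \<Rightarrow> 'a set) \<Rightarrow>
    (nat \<Rightarrow> 'a set) set" where
  "assoc_carrier A I J =
     {f. (\<forall>n. f n \<in> a_rcosets\<^bsub>A\<lparr>carrier := I n\<rparr>\<^esub> (J n)) \<and> finite {n. f n \<noteq> J n}}"

definition assoc_graded :: "('a, 'c) ring_scheme \<Rightarrow> (nat \<Rightarrow> 'a set) \<Rightarrow> (nat \<Rightarrow> 'a set) \<Rightarrow>
    (nat \<Rightarrow> 'a set, nat \<Rightarrow> 'a set) graded_module" where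
  "assoc_graded A I J =
     \<lparr> carrier = assoc_carrier A I J,
       monoid.mult = assoc_mult A J,
       one = (\<lambda>n. if n = 0 then J 0 +>\<^bsub>A\<^esub> \<one>\<^bsub>A\<^esub> else J n),
       zero = J,
       add = (\<lambda>f g n. f n <+>\<^bsub>A\<^esub> g n),
       smult = assoc_mult A J,
       component = (\<lambda>n. {f \<in> assoc_carrier A I J. \<forall>k. k \<noteq> n \<longrightarrow> f k = J k}) \<rparr>"

definition tangent_cone :: "('a, 'c) ring_scheme \<Rightarrow> 'a set \<Rightarrow>
    (nat \<Rightarrow> 'a set, nat \<Rightarrow> 'a set) graded_module" where
  "tangent_cone A \<mm> = assoc_graded A (ideal_pow A \<mm>) (\<lambda>n. ideal_pow A \<mm> (n + 1))"

definition fiber_cone :: "('a, 'c) ring_scheme \<Rightarrow> 'a set \<Rightarrow> 'a \<Rightarrow>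
    (nat \<Rightarrow> 'a set, nat \<Rightarrow> 'a set) graded_module" where
  "fiber_cone A \<mm> x =
     assoc_graded A (\<lambda>n. (x [^]\<^bsub>A\<^esub> n) <#\<^bsub>A\<^esub> carrier A) (\<lambda>n. (x [^]\<^bsub>A\<^esub> n) <#\<^bsub>A\<^esub> \<mm>)"

text \<open>The initial form \<open>x\<^sup>*\<close>, as an element of \<open>F(x)\<close>.\<close>

definition initial_form :: "('a, 'c) ring_scheme \<Rightarrow> 'a set \<Rightarrow> 'a \<Rightarrow> nat \<Rightarrow> 'a set" where
  "initial_form A \<mm> x n =
     (if n = 1 then (x <#\<^bsub>A\<^esub> \<mm>) +>\<^bsub>A\<^esub> x else (x [^]\<^bsub>A\<^esub> n) <#\<^bsub>A\<^esub> \<mm>)"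

text \<open>
  \<open>\<alpha> i\<close> counts the summands \<open>F(x)(-i)\<close> of \<open>G(\<mm>)\<close> and \<open>\<tau> i j\<close> (written \<open>\<alpha>\<^sub>i\<^sub>,\<^sub>j\<close> in the
  literature) the summands \<open>(F(x)/(x\<^sup>*)\<^sup>j F(x))(-i)\<close>. Such numbers exist and are unique in the ranges
  \<open>0 \<le> i \<le> r\<close> resp. \<open>1 \<le> i \<le> r - 1\<close>, \<open>1 \<le> j \<le> r - i\<close>; the values of \<open>\<alpha>\<close> and \<open>\<tau>\<close> outside these ranges
  are irrelevant.
\<close>

definition tangent_cone_invariants ::
    "('a, 'c) ring_scheme \<Rightarrow> 'a set \<Rightarrow> 'a \<Rightarrow> (nat \<Rightarrow> nat) \<Rightarrow> (nat \<Rightarrow> nat \<Rightarrow> nat) \<Rightarrow> bool" where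
  "tangent_cone_invariants A \<mm> x \<alpha> \<tau> \<longleftrightarrow>
     (let r = reduction_number A \<mm> x; F = fiber_cone A \<mm> x in
      \<exists>\<phi>. graded_iso F (tangent_cone A \<mm>)
        (graded_sum2
          (graded_dsum {(i, k). i \<le> r \<and> k < \<alpha> i} (\<lambda>(i, k). graded_shift F i))
          (graded_dsum {(i, j, k). i \<in> {1..r - 1} \<and> j \<in> {1..r - i} \<and> k < \<tau> i j}
             (\<lambda>(i, j, k). graded_shift
                (graded_quot F (PIdl\<^bsub>F\<^esub> (initial_form A \<mm> x [^]\<^bsub>F\<^esub> j))) i)))
        \<phi>)"


section \<open>Apery invariants and the correction terms\<close>

definition apery_invariant :: "('a, 'c) ring_scheme \<Rightarrow> 'a set \<Rightarrow> 'a \<Rightarrow> nat \<Rightarrow> nat" where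
  "apery_invariant A \<mm> x i = quot_length A (self_module A)
     (ideal_pow A \<mm> i <+>\<^bsub>A\<^esub> (x <#\<^bsub>A\<^esub> carrier A))
     (ideal_pow A \<mm> (i + 1) <+>\<^bsub>A\<^esub> (x <#\<^bsub>A\<^esub> carrier A))"

definition nu_invariant :: "('a, 'c) ring_scheme \<Rightarrow> 'a set \<Rightarrow> 'a \<Rightarrow> nat \<Rightarrow> nat" where
  "nu_invariant A \<mm> x i = quot_length A (self_module A)
     ((ideal_pow A \<mm> i \<inter> (x <#\<^bsub>A\<^esub> carrier A)) <+>\<^bsub>A\<^esub> ideal_pow A \<mm> (i + 1))
     ((x <#\<^bsub>A\<^esub> ideal_pow A \<mm> (i - 1)) <+>\<^bsub>A\<^esub> ideal_pow A \<mm> (i + 1))"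

text \<open>For \<open>i = r\<close> the ideal \<open>(\<mm>\<^sup>r : x\<^sup>-\<^sup>1)\<close> is read as \<open>\<mm>\<^sup>r\<^sup>+\<^sup>1\<close>.\<close>

definition g_invariant :: "('a, 'c) ring_scheme \<Rightarrow> 'a set \<Rightarrow> 'a \<Rightarrow> nat \<Rightarrow> nat" where
  "g_invariant A \<mm> x i =
     (let r = reduction_number A \<mm> x in
      quot_length A (self_module A)
        (colon A (ideal_pow A \<mm> r) (x [^]\<^bsub>A\<^esub> (r - i)))
        (ideal_pow A \<mm> i <+>\<^bsub>A\<^esub>
           (if i = r then ideal_pow A \<mm> (r + 1)
            else colon A (ideal_pow A \<mm> r) (x [^]\<^bsub>A\<^esub> (r - i - 1)))))"

end

theory Submission
  imports Defs
begin

text \<open>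
Write \<open>D\<^sub>i\<close> for the ideal of all \<open>a\<close> with \<open>x\<^sup>r a \<in> \<mm>\<^sup>r\<^sup>+\<^sup>i\<close>. Since \<open>x\<close> is regular
(\<open>reduction_regular\<close>) and \<open>\<mm>\<^sup>n\<^sup>+\<^sup>1 = x \<mm>\<^sup>n\<close> for \<open>n \<ge> r\<close>, one has \<open>D\<^sub>i = (\<mm>\<^sup>r : x\<^sup>r\<^sup>-\<^sup>i)\<close> for \<open>i \<le> r\<close>,
\<open>D\<^sub>r\<^sub>+\<^sub>1 = \<mm>\<^sup>r\<^sup>+\<^sup>1\<close>, and \<open>(D\<^sub>i\<^sub>+\<^sub>1 : x) = D\<^sub>i\<close>. So \<open>g\<^sub>i\<close> is the length of \<open>D\<^sub>i/(\<mm>\<^sup>i + D\<^sub>i\<^sub>+\<^sub>1)\<close>, and the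
other terms of the identity can be compared with the filtration \<open>D\<close> as well.

The first neighborhood ring is \<open>A' = {a/x\<^sup>r | a \<in> \<mm>\<^sup>r}\<close>, and \<open>x\<^sup>r (A + \<mm>\<^sup>i A') = x\<^sup>r A + \<mm>\<^sup>r\<^sup>+\<^sup>i\<close>. As
\<open>\<mm>\<^sup>r\<^sup>+\<^sup>i \<inter> x\<^sup>r A = x\<^sup>r D\<^sub>i\<close>, the isomorphism theorems show that a step of the filtration \<open>A + \<mm>\<^sup>i A'\<close> and the
corresponding step of \<open>D\<close> have lengths that add up to the length of \<open>\<mm>\<^sup>r/\<mm>\<^sup>r\<^sup>+\<^sup>1\<close>
(\<open>filtration_step_length\<close>). Hence \<open>\<beta>\<^sub>i = \<lambda>(D\<^sub>i/D\<^sub>i\<^sub>+\<^sub>1) - \<lambda>(D\<^sub>i\<^sub>-\<^sub>1/D\<^sub>i)\<close>.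

Put \<open>E\<^sub>i = \<mm>\<^sup>i \<inter> D\<^sub>i\<^sub>+\<^sub>1\<close>. Then \<open>\<lambda>(D\<^sub>i/D\<^sub>i\<^sub>+\<^sub>1) = g\<^sub>i + \<lambda>(\<mm>\<^sup>i/E\<^sub>i)\<close>, multiplication by \<open>x\<close> embeds
\<open>\<mm>\<^sup>i\<^sup>-\<^sup>1/E\<^sub>i\<^sub>-\<^sub>1\<close> into \<open>\<mm>\<^sup>i/E\<^sub>i\<close>, and \<open>\<gamma>\<^sub>i + \<nu>\<^sub>i = \<lambda>(\<mm>\<^sup>i/(x \<mm>\<^sup>i\<^sup>-\<^sup>1 + \<mm>\<^sup>i\<^sup>+\<^sup>1))\<close>. Combining these facts
(\<open>micro_apery_balance\<close>), the identity holds as soon as the length of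
\<open>(x \<mm>\<^sup>i\<^sup>-\<^sup>1 + E\<^sub>i)/(x \<mm>\<^sup>i\<^sup>-\<^sup>1 + \<mm>\<^sup>i\<^sup>+\<^sup>1)\<close> is the sum of the \<open>\<alpha>\<^sub>i\<^sub>,\<^sub>j\<close> with \<open>1 \<le> j \<le> r - i - 1\<close>.

For this, look at the tangent cone \<open>G\<close>. For \<open>i < r\<close>, the image of \<open>E\<^sub>i\<close> in \<open>G\<^sub>i\<close> is the kernel of
\<open>(x\<^sup>*)\<^sup>r\<^sup>-\<^sup>1\<^sup>-\<^sup>i\<close>, so the length in question is the dimension of this kernel modulo multiples of \<open>x\<^sup>*\<close>. In degree
\<open>i\<close>, only the generators of the summands generated in degree \<open>i\<close> are not multiples of \<open>x\<^sup>*\<close>, and the generator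
of \<open>F(x)/(x\<^sup>*)\<^sup>j F(x)\<close> is in the kernel if and only if \<open>j \<le> r - 1 - i\<close>. So the dimension is the number of
summands of this kind (\<open>generator_gap_eq\<close>). For \<open>i = r\<close>, the length and the sum are both zero.

Lengths are counted by chains in the modular lattice of ideals. They are additive
(\<open>ideal_length_add\<close>), and they are computed from coordinate functions by \<open>ideal_length_Inter_dual\<close>.
\<close>

no_notation Sum_Type.Plus (infixr \<open><+>\<close> 65)

section \<open>Lengths of chains\<close>

definition has_chain :: "'b set set \<Rightarrow> nat \<Rightarrow> bool" where
  "has_chain S n \<longleftrightarrow> (\<exists>N. (\<forall>k\<le>n. N k \<in> S) \<and> (\<forall>k<n. N k \<subset> N (Suc k)))"

definition chain_length :: "'b set set \<Rightarrow> enat" where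
  "chain_length S = Sup {enat n | n. has_chain S n}"

lemma has_chain_le: "has_chain S n \<Longrightarrow> m \<le> n \<Longrightarrow> has_chain S m"
  unfolding has_chain_def by (meson order.trans less_le_trans)

lemma enat_le_chain_length:
  assumes "S \<noteq> {}"
  shows "enat n \<le> chain_length S \<longleftrightarrow> has_chain S n"
proof
  assume le: "enat n \<le> chain_length S"
  show "has_chain S n"
  proof (rule ccontr)
    assume no: "\<not> has_chain S n"
    have "has_chain S 0"
      using assms unfolding has_chain_def by (auto intro: exI[of _ "\<lambda>_. SOME X. X \<in> S"] simp: some_in_eq)
    hence "n > 0" using no by (cases n) auto
    have "chain_length S \<le> enat (n - 1)"
      unfolding chain_length_def
    proof (rule Sup_least)
      fix y assume "y \<in> {enat n |n. has_chain S n}"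
      then obtain k where k: "y = enat k" "has_chain S k" by blast
      hence "k < n" using no has_chain_le by (meson not_le)
      thus "y \<le> enat (n - 1)" using k by simp
    qed
    hence "enat n \<le> enat (n - 1)" using le order.trans by blast
    thus False using \<open>n > 0\<close> by simp
  qed
next
  assume "has_chain S n"
  thus "enat n \<le> chain_length S" unfolding chain_length_def by (auto intro: Sup_upper)
qed

lemma has_chain_map:
  assumes "has_chain S n" "\<And>X. X \<in> S \<Longrightarrow> f X \<in> T"
    and "\<And>X Y. X \<in> S \<Longrightarrow> Y \<in> S \<Longrightarrow> X \<subset> Y \<Longrightarrow> f X \<subset> f Y"
  shows "has_chain T n"
proof -
  obtain N where "\<forall>k\<le>n. N k \<in> S" "\<forall>k<n. N k \<subset> N (Suc k)"
    using assms(1) unfolding has_chain_def by blast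
  hence "(\<forall>k\<le>n. f (N k) \<in> T) \<and> (\<forall>k<n. f (N k) \<subset> f (N (Suc k)))"
    using assms(2,3) by (simp add: Suc_leI)
  thus ?thesis unfolding has_chain_def by (intro exI[of _ "\<lambda>k. f (N k)"])
qed

lemma has_chain_append:
  assumes "has_chain S m" "has_chain T n" "S \<subseteq> R" "T \<subseteq> R"
    and le: "\<And>X Y. X \<in> S \<Longrightarrow> Y \<in> T \<Longrightarrow> X \<subseteq> Y"
  shows "has_chain R (m + n)"
proof -
  obtain N where N: "\<forall>k\<le>m. N k \<in> S" "\<forall>k<m. N k \<subset> N (Suc k)"
    using assms(1) unfolding has_chain_def by blast
  obtain N' where N': "\<forall>k\<le>n. N' k \<in> T" "\<forall>k<n. N' k \<subset> N' (Suc k)"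
    using assms(2) unfolding has_chain_def by blast
  define P where "P k = (if k \<le> m then N k else N' (k - m))" for k
  have "\<forall>k\<le>m + n. P k \<in> R"
    using N N' assms(3,4) unfolding P_def by auto
  moreover have "P k \<subset> P (Suc k)" if k: "k < m + n" for k
  proof -
    consider "k < m" | "k = m" | "k > m" by linarith
    thus ?thesis
    proof cases
      case 1 thus ?thesis using N unfolding P_def by simp
    next
      case 2
      have "N m \<subseteq> N' 0" using le N N' by simp
      moreover have "N' 0 \<subset> N' (Suc 0)" using N' k 2 by simp
      ultimately show ?thesis unfolding P_def using 2 by auto
    next
      case 3
      hence "Suc k - m = Suc (k - m)" "k - m < n" using k by auto
      thus ?thesis unfolding P_def using 3 N' by simp
    qed
  qed
  ultimately show ?thesis unfolding has_chain_def by blast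
qed

text \<open>Only the strict steps of a weakly increasing sequence survive. This is how a chain is pushed
forward along maps such as \<open>N \<mapsto> N \<inter> W\<close>, which need not be injective.\<close>

lemma has_chain_of_weak_chain:
  fixes N :: "nat \<Rightarrow> 'b set"
  assumes "\<forall>k\<le>n. N k \<in> S" "\<forall>k<n. N k \<subseteq> N (Suc k)"
  shows "has_chain S (card {k. k < n \<and> N k \<noteq> N (Suc k)})"
proof -
  have "\<exists>C. (\<forall>k\<le>card {k. k < n \<and> N k \<noteq> N (Suc k)}. C k \<in> S)
      \<and> (\<forall>k<card {k. k < n \<and> N k \<noteq> N (Suc k)}. C k \<subset> C (Suc k))
      \<and> C (card {k. k < n \<and> N k \<noteq> N (Suc k)}) = N n"
    using assms
  proof (induction n)
    case 0
    thus ?case by (auto intro: exI[of _ N])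
  next
    case (Suc n)
    define c where "c = card {k. k < n \<and> N k \<noteq> N (Suc k)}"
    obtain C where C: "\<forall>k\<le>c. C k \<in> S" "\<forall>k<c. C k \<subset> C (Suc k)" "C c = N n"
      using Suc unfolding c_def by auto
    show ?case
    proof (cases "N n = N (Suc n)")
      case True
      hence "{k. k < Suc n \<and> N k \<noteq> N (Suc k)} = {k. k < n \<and> N k \<noteq> N (Suc k)}"
        using less_Suc_eq by auto
      thus ?thesis using C True c_def by auto
    next
      case False
      hence "{k. k < Suc n \<and> N k \<noteq> N (Suc k)} = insert n {k. k < n \<and> N k \<noteq> N (Suc k)}"
        using less_Suc_eq by auto
      hence card: "card {k. k < Suc n \<and> N k \<noteq> N (Suc k)} = Suc c" by (simp add: c_def)
      have "N n \<subset> N (Suc n)" using Suc.prems(2) False by auto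
      hence "(\<forall>k\<le>Suc c. (C(Suc c := N (Suc n))) k \<in> S)
          \<and> (\<forall>k<Suc c. (C(Suc c := N (Suc n))) k \<subset> (C(Suc c := N (Suc n))) (Suc k))
          \<and> (C(Suc c := N (Suc n))) (Suc c) = N (Suc n)"
        using C Suc.prems by (auto simp: less_Suc_eq le_Suc_eq)
      thus ?thesis unfolding card by blast
    qed
  qed
  thus ?thesis unfolding has_chain_def by blast
qed

lemma enat_leI: "(\<And>n. enat n \<le> a \<Longrightarrow> enat n \<le> b) \<Longrightarrow> a \<le> b"
  by (cases a; cases b) (auto, metis Suc_n_not_le_n)

text \<open>Together with \<open>enat_leI\<close>, this reduces an equation between possibly infinite suprema to a
statement about individual finite chains.\<close>

lemma enat_le_addD:
  assumes "enat n \<le> a + b" shows "\<exists>p q. n = p + q \<and> enat p \<le> a \<and> enat q \<le> b"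
proof (cases a)
  case (enat a')
  show ?thesis
  proof (cases "n \<le> a'")
    case True thus ?thesis using enat by (intro exI[of _ n] exI[of _ 0]) (auto simp: zero_enat_def[symmetric])
  next
    case False
    have "enat (n - a') \<le> b" using assms enat by (cases b) auto
    thus ?thesis using False enat by (intro exI[of _ a'] exI[of _ "n - a'"]) auto
  qed
next
  case infinity
  thus ?thesis by (intro exI[of _ n] exI[of _ 0]) (auto simp: zero_enat_def[symmetric])
qed

section \<open>Lengths of intervals of ideals\<close>

text \<open>The submodules of \<open>U/V\<close> correspond to the ideals between \<open>V\<close> and \<open>U\<close>. Counting chains of such
ideals avoids cosets altogether, and the isomorphism theorems become statements about the
modular lattice of ideals.\<close>

definition ideals_between :: "('a, 'c) ring_scheme \<Rightarrow> 'a set \<Rightarrow> 'a set \<Rightarrow> 'a set set" where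
  "ideals_between A V U = {N. ideal N A \<and> V \<subseteq> N \<and> N \<subseteq> U}"

definition ideal_length :: "('a, 'c) ring_scheme \<Rightarrow> 'a set \<Rightarrow> 'a set \<Rightarrow> enat" where
  "ideal_length A U V = chain_length (ideals_between A V U)"

lemma ideals_between_nonempty: "ideal V A \<Longrightarrow> V \<subseteq> U \<Longrightarrow> ideals_between A V U \<noteq> {}"
  unfolding ideals_between_def by blast

lemma (in ring) ideal_add_subset:
  assumes "ideal I R" "ideal J R" "ideal K R" "I \<subseteq> K" "J \<subseteq> K"
  shows "I <+> J \<subseteq> K"
  using assms by (auto simp: set_add_def' intro!: additive_subgroup.a_closed ideal.axioms(1))

lemma (in ring) ideal_add_upper:
  assumes "ideal I R" "ideal J R"
  shows "I \<subseteq> I <+> J" "J \<subseteq> I <+> J"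
proof -
  interpret I: ideal I R by fact
  interpret J: ideal J R by fact
  have "i = i \<oplus> \<zero>" if "i \<in> I" for i using that I.Icarr by simp
  thus "I \<subseteq> I <+> J" unfolding set_add_def' using J.zero_closed by blast
  have "i = \<zero> \<oplus> i" if "i \<in> J" for i using that J.Icarr by simp
  thus "J \<subseteq> I <+> J" unfolding set_add_def' using I.zero_closed by blast
qed

text \<open>In a modular lattice, an element of an interval \<open>P \<subseteq> Q\<close> cannot be lost both by intersecting with
\<open>W\<close> and by adding \<open>W\<close>: if \<open>q = p + w\<close>, then \<open>w = q - p\<close> lies in \<open>Q \<inter> W = P \<inter> W\<close>.\<close>

lemma (in ring) ideal_modular_cancel:
  assumes "ideal P R" "ideal Q R" "ideal W R" "P \<subseteq> Q" "P \<inter> W = Q \<inter> W" "P <+> W = Q <+> W"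
  shows "P = Q"
proof
  interpret P: ideal P R by fact
  interpret Q: ideal Q R by fact
  interpret W: ideal W R by fact
  show "Q \<subseteq> P"
  proof
    fix q assume q: "q \<in> Q"
    hence "q \<in> P <+> W" using ideal_add_upper[of Q W] assms by auto
    then obtain p w where pw: "p \<in> P" "w \<in> W" "q = p \<oplus> w" unfolding set_add_def' by auto
    have c: "p \<in> carrier R" "w \<in> carrier R" using pw by auto
    have "w = \<ominus> p \<oplus> q" using c pw(3) by (simp add: a_assoc[symmetric] l_neg)
    hence "w \<in> Q" using q pw(1) assms(4) by auto
    hence "w \<in> P" using pw(2) assms(5) by auto
    thus "q \<in> P" using pw by simp
  qed
qed fact

text \<open>Chains below and above \<open>W\<close> can be concatenated. Conversely, each strict step of a chain between
\<open>V\<close> and \<open>U\<close> remains strict after intersecting with \<open>W\<close> or after adding \<open>W\<close>, by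
\<open>ideal_modular_cancel\<close>, so the chain is no longer than its two shadows together.\<close>

lemma (in ring) ideal_length_add:
  assumes V: "ideal V R" and W: "ideal W R" and U: "ideal U R" and "V \<subseteq> W" "W \<subseteq> U"
  shows "ideal_length R U V = ideal_length R U W + ideal_length R W V"
proof (rule antisym; rule enat_leI)
  note ne = enat_le_chain_length[OF ideals_between_nonempty]
  fix n
  {
    assume "enat n \<le> ideal_length R U V"
    then obtain N where N: "\<forall>k\<le>n. N k \<in> ideals_between R V U" "\<forall>k<n. N k \<subset> N (Suc k)"
      unfolding ideal_length_def using ne V assms has_chain_def by (metis order.trans)
    have id: "ideal (N k) R" if "k \<le> n" for k using N that unfolding ideals_between_def by blast
    \<comment> \<open>The numbers of strict steps of the two shadows of the chain.\<close>
    let ?p = "card {k. k < n \<and> N k \<inter> W \<noteq> N (Suc k) \<inter> W}"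
    let ?q = "card {k. k < n \<and> N k <+> W \<noteq> N (Suc k) <+> W}"
    have "has_chain (ideals_between R V W) ?p"
      using N(1) assms i_intersect[OF _ W] N(2)
      by (intro has_chain_of_weak_chain) (auto simp: ideals_between_def)
    hence p: "enat ?p \<le> ideal_length R W V"
      unfolding ideal_length_def using ne V assms by blast
    have "has_chain (ideals_between R W U) ?q"
    proof (intro has_chain_of_weak_chain allI impI)
      fix k assume k: "k \<le> n"
      have "N k <+> W \<subseteq> U" using N(1) k U W assms id
        by (intro ideal_add_subset) (auto simp: ideals_between_def)
      thus "N k <+> W \<in> ideals_between R W U"
        using add_ideals[OF id[OF k] W] ideal_add_upper[OF id[OF k] W] by (auto simp: ideals_between_def)
    next
      fix k assume k: "k < n"
      show "N k <+> W \<subseteq> N (Suc k) <+> W" using N(2) k by (force simp: set_add_def')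
    qed
    hence q: "enat ?q \<le> ideal_length R U W"
      unfolding ideal_length_def using ne W assms by blast
    have "N k \<inter> W \<noteq> N (Suc k) \<inter> W \<or> N k <+> W \<noteq> N (Suc k) <+> W" if k: "k < n" for k
      using ideal_modular_cancel[of "N k" "N (Suc k)" W] id[of k] id[of "Suc k"] W N(2) k by fastforce
    hence "{..<n} \<subseteq> {k. k < n \<and> N k \<inter> W \<noteq> N (Suc k) \<inter> W} \<union> {k. k < n \<and> N k <+> W \<noteq> N (Suc k) <+> W}"
      by auto
    hence "card {..<n} \<le> card ({k. k < n \<and> N k \<inter> W \<noteq> N (Suc k) \<inter> W} \<union> {k. k < n \<and> N k <+> W \<noteq> N (Suc k) <+> W})"
      by (intro card_mono) auto
    also have "\<dots> \<le> ?p + ?q" by (rule card_Un_le)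
    finally have "enat n \<le> enat ?q + enat ?p" by simp
    also have "\<dots> \<le> ideal_length R U W + ideal_length R W V" using p q by (rule add_mono[rotated])
    finally show "enat n \<le> ideal_length R U W + ideal_length R W V" .
  next
    assume "enat n \<le> ideal_length R U W + ideal_length R W V"
    then obtain q p where n: "n = q + p" "enat q \<le> ideal_length R U W" "enat p \<le> ideal_length R W V"
      using enat_le_addD by blast
    have "has_chain (ideals_between R V W) p" "has_chain (ideals_between R W U) q"
      using n ne V W assms unfolding ideal_length_def by blast+
    hence "has_chain (ideals_between R V U) (p + q)"
      by (rule has_chain_append) (use assms in \<open>auto simp: ideals_between_def\<close>)
    thus "enat n \<le> ideal_length R U V"
      unfolding ideal_length_def using ne V assms n(1) by (metis add.commute order.trans)
  }
qed

lemma ideal_carrier_subset: "ideal I R \<Longrightarrow> I \<subseteq> carrier R"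
  using additive_subgroup.a_subset ideal.axioms(1) by blast

lemma chain_length_eqI:
  assumes "S \<noteq> {}" "T \<noteq> {}"
    and "\<And>X. X \<in> S \<Longrightarrow> f X \<in> T" "\<And>X Y. X \<in> S \<Longrightarrow> Y \<in> S \<Longrightarrow> X \<subset> Y \<Longrightarrow> f X \<subset> f Y"
    and "\<And>X. X \<in> T \<Longrightarrow> g X \<in> S" "\<And>X Y. X \<in> T \<Longrightarrow> Y \<in> T \<Longrightarrow> X \<subset> Y \<Longrightarrow> g X \<subset> g Y"
  shows "chain_length S = chain_length T"
  by (rule antisym; rule enat_leI)
     (use assms has_chain_map[of S _ f T] has_chain_map[of T _ g S] in \<open>auto simp: enat_le_chain_length\<close>)

text \<open>The maps \<open>P \<mapsto> P \<inter> U\<close> and \<open>N \<mapsto> N + W\<close> between the two intervals are strictly monotone by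
\<open>ideal_modular_cancel\<close>; this suffices for equal lengths.\<close>

lemma (in ring) ideal_length_second_iso:
  assumes U: "ideal U R" and W: "ideal W R"
  shows "ideal_length R (U <+> W) W = ideal_length R U (U \<inter> W)"
  unfolding ideal_length_def
proof (rule chain_length_eqI[where f = "\<lambda>P. P \<inter> U" and g = "\<lambda>N. N <+> W"])
  note up = ideal_add_upper[OF U W]
  show "ideals_between R W (U <+> W) \<noteq> {}"
    using ideals_between_nonempty[OF W] up by blast
  show "ideals_between R (U \<inter> W) U \<noteq> {}"
    using ideals_between_nonempty[OF i_intersect[OF U W]] by blast
  fix P assume P: "P \<in> ideals_between R W (U <+> W)"
  show "P \<inter> U \<in> ideals_between R (U \<inter> W) U"
    using P i_intersect[OF _ U] by (auto simp: ideals_between_def)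
  fix P' assume P': "P' \<in> ideals_between R W (U <+> W)" and less: "P \<subset> P'"
  have sum: "X <+> U = U <+> W" if "X \<in> ideals_between R W (U <+> W)" for X
  proof
    have X: "ideal X R" "W \<subseteq> X" "X \<subseteq> U <+> W" using that by (auto simp: ideals_between_def)
    show "X <+> U \<subseteq> U <+> W" using X up by (intro ideal_add_subset add_ideals U W)
    show "U <+> W \<subseteq> X <+> U" using X ideal_add_upper[OF X(1) U]
      by (intro ideal_add_subset add_ideals U W) auto
  qed
  show "P \<inter> U \<subset> P' \<inter> U"
    using ideal_modular_cancel[of P P' U] P P' less sum[OF P] sum[OF P'] U
    by (auto simp: ideals_between_def)
next
  fix N assume N: "N \<in> ideals_between R (U \<inter> W) U"
  hence idN: "ideal N R" by (simp add: ideals_between_def)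
  have "N <+> W \<subseteq> U <+> W" using N by (force simp: ideals_between_def set_add_def')
  thus "N <+> W \<in> ideals_between R W (U <+> W)"
    using add_ideals[OF idN W] ideal_add_upper[OF idN W] by (auto simp: ideals_between_def)
  fix N' assume N': "N' \<in> ideals_between R (U \<inter> W) U" and less: "N \<subset> N'"
  have "N <+> W \<subseteq> N' <+> W" using less by (force simp: set_add_def')
  moreover have "N \<inter> W = N' \<inter> W" using N N' by (auto simp: ideals_between_def)
  ultimately show "N <+> W \<subset> N' <+> W"
    using ideal_modular_cancel[of N N' W] N N' less W by (auto simp: ideals_between_def)
qed

text \<open>The set \<open>x N\<close> is an ideal because it is the product of the principal ideal of \<open>x\<close> with \<open>N\<close>.\<close>

lemma (in cring) ideal_lcoset:
  assumes x: "x \<in> carrier R" and N: "ideal N R"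
  shows "ideal (x <# N) R"
proof -
  interpret N: ideal N R by fact
  have "(PIdl x) \<cdot> N = x <# N"
  proof
    show "(PIdl x) \<cdot> N \<subseteq> x <# N"
    proof
      fix s assume "s \<in> (PIdl x) \<cdot> N"
      thus "s \<in> x <# N"
      proof induction
        case (prod i j)
        then obtain a where "i = a \<otimes> x" "a \<in> carrier R" by (auto simp: cgenideal_def)
        hence "i \<otimes> j = x \<otimes> (a \<otimes> j)" using prod x by (simp add: m_ac)
        thus ?case using prod \<open>a \<in> carrier R\<close> by (auto simp: l_coset_def N.I_l_closed)
      next
        case (sum s1 s2)
        then obtain a b where "s1 = x \<otimes> a" "a \<in> N" "s2 = x \<otimes> b" "b \<in> N" by (auto simp: l_coset_def)
        hence "s1 \<oplus> s2 = x \<otimes> (a \<oplus> b)" "a \<oplus> b \<in> N" using x by (simp_all add: r_distr)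
        thus ?case by (auto simp: l_coset_def)
      qed
    qed
    show "x <# N \<subseteq> (PIdl x) \<cdot> N"
      using cgenideal_self[OF x] by (auto simp: l_coset_def intro: ideal_prod.prod)
  qed
  thus ?thesis using ideal_prod_is_ideal[OF cgenideal_ideal[OF x] N] by simp
qed

lemma (in cring) ideal_colon:
  assumes "y \<in> carrier R" "ideal I R"
  shows "ideal (colon R I y) R"
  unfolding colon_def using ideal.helper_max_prime[OF assms(2) is_cring assms(1)] .

lemma (in cring) regular_cancel:
  assumes "x \<in> regular_elements R" "a \<in> carrier R" "b \<in> carrier R" "x \<otimes> a = x \<otimes> b"
  shows "a = b"
proof -
  have x: "x \<in> carrier R" using assms(1) by (simp add: regular_elements_def)
  have "x \<otimes> (a \<ominus> b) = \<zero>" using assms x by (simp add: minus_eq r_distr r_minus r_neg)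
  hence "a \<ominus> b = \<zero>" using assms by (simp add: regular_elements_def)
  thus ?thesis using assms by simp
qed

lemma lcoset_mono: "N \<subseteq> N' \<Longrightarrow> x <#\<^bsub>R\<^esub> N \<subseteq> x <#\<^bsub>R\<^esub> N'"
  by (auto simp: l_coset_def)

lemma (in cring) mem_lcoset_regular:
  assumes x: "x \<in> regular_elements R" and "a \<in> carrier R" "N \<subseteq> carrier R"
  shows "x \<otimes> a \<in> x <# N \<longleftrightarrow> a \<in> N"
proof
  assume "x \<otimes> a \<in> x <# N"
  then obtain b where "b \<in> N" "x \<otimes> a = x \<otimes> b" by (auto simp: l_coset_def)
  thus "a \<in> N" using regular_cancel[OF x, of a b] assms by auto
qed (auto simp: l_coset_def)

lemma (in cring) colon_lcoset:
  assumes x: "x \<in> regular_elements R" and "N \<subseteq> carrier R"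
  shows "colon R (x <# N) x = N"
  using mem_lcoset_regular[OF x] assms by (auto simp: colon_def)

lemma lcoset_colon:
  assumes "P \<subseteq> x <#\<^bsub>R\<^esub> U" "U \<subseteq> carrier R"
  shows "x <#\<^bsub>R\<^esub> colon R P x = P"
  using assms by (auto simp: l_coset_def colon_def)

lemma colon_mono: "P \<subseteq> P' \<Longrightarrow> colon R P x \<subseteq> colon R P' x"
  by (auto simp: colon_def)

lemma (in cring) ideal_length_mult:
  assumes x: "x \<in> regular_elements R" and U: "ideal U R" and V: "ideal V R" and le: "V \<subseteq> U"
  shows "ideal_length R (x <# U) (x <# V) = ideal_length R U V"
  unfolding ideal_length_def
proof (rule chain_length_eqI[where f = "\<lambda>P. colon R P x" and g = "\<lambda>N. x <# N"])
  have xc: "x \<in> carrier R" using x by (simp add: regular_elements_def)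
  have sub: "U \<subseteq> carrier R" "V \<subseteq> carrier R" using ideal_carrier_subset U V by auto
  show "ideals_between R (x <# V) (x <# U) \<noteq> {}"
    using ideals_between_nonempty[OF ideal_lcoset[OF xc V] lcoset_mono[OF le]] .
  show "ideals_between R V U \<noteq> {}"
    using ideals_between_nonempty[OF V le] .
  fix P assume P: "P \<in> ideals_between R (x <# V) (x <# U)"
  hence "V \<subseteq> colon R P x" "colon R P x \<subseteq> U"
    using colon_mono[of "x <# V" P R x] colon_mono[of P "x <# U" R x] colon_lcoset[OF x] sub
    by (auto simp: ideals_between_def)
  thus "colon R P x \<in> ideals_between R V U"
    using P ideal_colon[OF xc] by (auto simp: ideals_between_def)
  fix P' assume P': "P' \<in> ideals_between R (x <# V) (x <# U)" and less: "P \<subset> P'"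
  have "x <# colon R P x = P" "x <# colon R P' x = P'"
    using P P' sub by (auto simp: ideals_between_def intro!: lcoset_colon)
  thus "colon R P x \<subset> colon R P' x" using less colon_mono[of P P' R x] by (metis psubset_eq)
next
  have xc: "x \<in> carrier R" using x by (simp add: regular_elements_def)
  fix N assume N: "N \<in> ideals_between R V U"
  thus "x <# N \<in> ideals_between R (x <# V) (x <# U)"
    by (simp add: ideals_between_def ideal_lcoset xc lcoset_mono)
  fix N' assume N': "N' \<in> ideals_between R V U" and less: "N \<subset> N'"
  have "colon R (x <# N) x = N" "colon R (x <# N') x = N'"
    using N N' by (simp_all add: ideals_between_def colon_lcoset[OF x] ideal_carrier_subset)
  thus "x <# N \<subset> x <# N'" using less lcoset_mono[of N N' R x] by (metis psubset_eq)
qed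

text \<open>The generation hypothesis says that every element of \<open>U\<close> outside \<open>V\<close> generates \<open>U\<close> modulo \<open>V\<close>,
so there is no ideal strictly in between.\<close>

lemma (in ring) ideal_length_simple_le:
  assumes U: "ideal U R" and V: "ideal V R" and le: "V \<subseteq> U"
    and gen: "\<And>y z. y \<in> U \<Longrightarrow> y \<notin> V \<Longrightarrow> z \<in> U \<Longrightarrow> \<exists>a\<in>carrier R. z \<ominus> a \<otimes> y \<in> V"
  shows "ideal_length R U V \<le> 1"
proof (rule enat_leI)
  fix n assume "enat n \<le> ideal_length R U V"
  hence "has_chain (ideals_between R V U) n"
    unfolding ideal_length_def using enat_le_chain_length[OF ideals_between_nonempty[OF V le]] by simp
  have "\<not> has_chain (ideals_between R V U) 2"
  proof
    assume "has_chain (ideals_between R V U) 2"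
    then obtain N where N: "\<forall>k\<le>2. N k \<in> ideals_between R V U" "\<forall>k<2. N k \<subset> N (Suc k)"
      unfolding has_chain_def by blast
    have "N 0 \<subset> N 1" "N 1 \<subset> N 2" "N 0 \<in> ideals_between R V U" "N 1 \<in> ideals_between R V U"
        "N 2 \<in> ideals_between R V U" using N by (auto simp: numeral_2_eq_2)
    then obtain P0 P P2 where P: "P0 \<subset> P" "P \<subset> P2" "V \<subseteq> P0" "ideal P R" "P \<subseteq> U" "P2 \<subseteq> U"
      unfolding ideals_between_def by blast
    then obtain y where y: "y \<in> P" "y \<notin> P0" by blast
    interpret P: ideal P R by fact
    have "P2 \<subseteq> P"
    proof
      fix z assume "z \<in> P2"
      hence z: "z \<in> U" using P by auto
      have yU: "y \<in> U" "y \<notin> V" using y P by auto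
      obtain a where a: "a \<in> carrier R" "z \<ominus> a \<otimes> y \<in> V"
        using gen[OF yU z] by blast
      hence "(z \<ominus> a \<otimes> y) \<oplus> a \<otimes> y \<in> P" using P y by (intro P.a_closed P.I_l_closed) auto
      moreover have "z \<in> carrier R" using z ideal_carrier_subset[OF U] by auto
      hence "(z \<ominus> a \<otimes> y) \<oplus> a \<otimes> y = z" using a(1) P.Icarr[OF y(1)] by algebra
      ultimately show "z \<in> P" by simp
    qed
    thus False using \<open>P \<subset> P2\<close> by blast
  qed
  hence "n < 2" using has_chain_le[OF \<open>has_chain (ideals_between R V U) n\<close>, of 2] by linarith
  thus "enat n \<le> 1" by (simp add: one_enat_def)
qed

lemma (in ring) ideal_length_simple:
  assumes U: "ideal U R" and V: "ideal V R" and le: "V \<subset> U"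
    and gen: "\<And>y z. y \<in> U \<Longrightarrow> y \<notin> V \<Longrightarrow> z \<in> U \<Longrightarrow> \<exists>a\<in>carrier R. z \<ominus> a \<otimes> y \<in> V"
  shows "ideal_length R U V = 1"
proof (rule antisym)
  show "ideal_length R U V \<le> 1" using assms by (intro ideal_length_simple_le) auto
  have "has_chain (ideals_between R V U) 1"
    unfolding has_chain_def
    by (rule exI[of _ "\<lambda>k. if k = 0 then V else U"]) (use assms in \<open>auto simp: ideals_between_def\<close>)
  thus "1 \<le> ideal_length R U V"
    unfolding ideal_length_def one_enat_def
    using enat_le_chain_length[OF ideals_between_nonempty[OF V]] le by blast
qed

lemma (in ring) ideal_length_self:
  assumes U: "ideal U R"
  shows "ideal_length R U U = 0"
proof -
  have 0: "n = 0" if "enat n \<le> ideal_length R U U" for n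
  proof (rule ccontr)
    assume "n \<noteq> 0"
    moreover have "has_chain (ideals_between R U U) n"
      using that enat_le_chain_length[OF ideals_between_nonempty[OF U]] by (simp add: ideal_length_def)
    ultimately have "has_chain (ideals_between R U U) 1" using has_chain_le by (metis One_nat_def Suc_leI neq0_conv)
    then obtain N where "N 0 \<in> ideals_between R U U" "N (Suc 0) \<in> ideals_between R U U" "N 0 \<subset> N (Suc 0)"
      unfolding has_chain_def by auto
    thus False unfolding ideals_between_def by blast
  qed
  have "ideal_length R U U \<le> 0"
    by (rule enat_leI) (drule 0, simp add: zero_enat_def)
  thus ?thesis by simp
qed

text \<open>A form of the dual basis argument. The \<open>W s\<close> play the role of kernels of linear functionals on
\<open>U\<close> with values in the residue field, and the hypothesis \<open>dual\<close> provides a dual family of vectors,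
so that intersecting with the kernels one after the other drops the length by exactly one each time.
Describing the functionals only by their kernels spares a module structure on their values.\<close>

lemma (in ring) ideal_length_Inter_dual:
  assumes S: "finite S" and U: "ideal U R"
    and W: "\<And>s. s \<in> S \<Longrightarrow> ideal (W s) R"
    and gen: "\<And>s y z. s \<in> S \<Longrightarrow> y \<in> U \<Longrightarrow> y \<notin> W s \<Longrightarrow> z \<in> U \<Longrightarrow> \<exists>a\<in>carrier R. z \<ominus> a \<otimes> y \<in> W s"
    and dual: "\<And>s. s \<in> S \<Longrightarrow> \<exists>e\<in>U. e \<notin> W s \<and> (\<forall>t\<in>S - {s}. e \<in> W t)"
  shows "ideal {a \<in> U. \<forall>s\<in>S. a \<in> W s} R \<and> ideal_length R U {a \<in> U. \<forall>s\<in>S. a \<in> W s} = enat (card S)"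
  using S W gen dual
proof (induction S)
  case empty
  show ?case by (simp add: U ideal_length_self[OF U] zero_enat_def)
next
  case (insert s S)
  let ?P = "{a \<in> U. \<forall>t\<in>S. a \<in> W t}" and ?Q = "{a \<in> U. \<forall>t\<in>insert s S. a \<in> W t}"
  have IH: "ideal ?P R \<and> ideal_length R U ?P = enat (card S)"
  proof (rule insert.IH[OF insert.prems(1)[OF insertI2] insert.prems(2)[OF insertI2]])
    fix s' assume "s' \<in> S"
    then obtain e where "e \<in> U" "e \<notin> W s'" "\<forall>t\<in>insert s S - {s'}. e \<in> W t"
      using insert.prems(3)[OF insertI2] by blast
    thus "\<exists>e\<in>U. e \<notin> W s' \<and> (\<forall>t\<in>S - {s'}. e \<in> W t)" by blast
  qed
  have eq: "?Q = ?P \<inter> W s" by auto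
  have Q: "ideal ?Q R" unfolding eq using i_intersect[OF _ insert.prems(1)[OF insertI1]] IH by simp
  interpret P: ideal ?P R using IH by simp
  have "ideal_length R ?P ?Q = 1"
  proof (rule ideal_length_simple)
    obtain e where "e \<in> U" "e \<notin> W s" "\<forall>t\<in>insert s S - {s}. e \<in> W t"
      using insert.prems(3)[of s] by blast
    hence "e \<in> ?P" "e \<notin> ?Q" using insert.hyps by auto
    thus "?Q \<subset> ?P" by blast
    fix y z assume yz: "y \<in> ?P" "y \<notin> ?Q" "z \<in> ?P"
    then obtain a where a: "a \<in> carrier R" "z \<ominus> a \<otimes> y \<in> W s"
      using insert.prems(2)[of s y z] by blast
    have "z \<ominus> a \<otimes> y \<in> ?P"
      unfolding minus_eq using P.I_l_closed[OF yz(1) a(1)] yz(3) by (intro P.a_closed P.a_inv_closed)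
    thus "\<exists>a\<in>carrier R. z \<ominus> a \<otimes> y \<in> ?Q" using a unfolding eq by blast
  qed (use Q IH in auto)
  moreover have "ideal_length R U ?Q = ideal_length R U ?P + ideal_length R ?P ?Q"
    using IH Q U by (intro ideal_length_add) auto
  ultimately have "ideal_length R U ?Q = enat (card (insert s S))"
    using IH insert.hyps by (simp add: one_enat_def)
  thus ?case using Q by blast
qed

text \<open>Elements outside a maximal ideal are invertible modulo that ideal.\<close>

lemma (in cring) maximalideal_coprime:
  assumes M: "maximalideal M R" and c: "c \<in> carrier R" "c \<notin> M"
  shows "\<exists>a\<in>carrier R. \<one> \<ominus> a \<otimes> c \<in> M"
proof -
  interpret M: maximalideal M R by fact
  have id: "ideal (M <+> PIdl c) R" using add_ideals[OF M.is_ideal cgenideal_ideal[OF c(1)]] .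
  note up = ideal_add_upper[OF M.is_ideal cgenideal_ideal[OF c(1)]]
  have "M <+> PIdl c = carrier R"
    using M.I_maximal[OF id up(1)] up(2) cgenideal_self[OF c(1)] c(2) ideal.Icarr[OF id] by blast
  hence "\<one> \<in> M <+> PIdl c" by simp
  then obtain m a where ma: "m \<in> M" "a \<in> carrier R" "\<one> = m \<oplus> a \<otimes> c"
    unfolding set_add_def' cgenideal_def by auto
  hence "\<one> \<ominus> a \<otimes> c = m" using c M.Icarr by (simp add: minus_eq a_assoc r_neg)
  thus ?thesis using ma by blast
qed

text \<open>Adding one generator \<open>s\<close> with \<open>M s \<subseteq> V\<close> raises the length by at most one, because \<open>A s + V\<close> is
cyclic over the field \<open>A/M\<close> modulo \<open>V\<close>.\<close>

lemma (in cring) ideal_length_generated_finite: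
  assumes M: "maximalideal M R" and S: "finite S" and "S \<subseteq> carrier R" and "ideal V R"
    and "\<And>m s. m \<in> M \<Longrightarrow> s \<in> S \<Longrightarrow> m \<otimes> s \<in> V"
  shows "ideal_length R (Idl (V \<union> S)) V \<noteq> \<infinity>"
  using S assms(3-)
proof (induction S arbitrary: V)
  case empty
  have "Idl V = V" using empty genideal_minimal[of V V] genideal_self[OF ideal_carrier_subset] by auto
  thus ?case using ideal_length_self empty by simp
next
  case (insert s S)
  have s: "s \<in> carrier R" using insert.prems by simp
  interpret M: maximalideal M R by fact
  interpret V: ideal V R by fact
  let ?V' = "V <+> PIdl s"
  have V': "ideal ?V' R" using add_ideals[OF V.is_ideal cgenideal_ideal[OF s]] .
  note up = ideal_add_upper[OF V.is_ideal cgenideal_ideal[OF s]]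
  have sV': "s \<in> ?V'" using up(2) cgenideal_self[OF s] by blast
  have c1: "?V' \<union> S \<subseteq> carrier R" "V \<union> insert s S \<subseteq> carrier R"
    using ideal.Icarr[OF V'] insert.prems V.Icarr by auto
  have "Idl (?V' \<union> S) = Idl (V \<union> insert s S)"
  proof
    have i: "ideal (Idl (V \<union> insert s S)) R" using genideal_ideal c1 by blast
    have "V \<union> insert s S \<subseteq> Idl (V \<union> insert s S)" using genideal_self[OF c1(2)] .
    hence "?V' \<subseteq> Idl (V \<union> insert s S)"
      by (intro ideal_add_subset cgenideal_minimal cgenideal_ideal i V.is_ideal s) auto
    thus "Idl (?V' \<union> S) \<subseteq> Idl (V \<union> insert s S)"
      using genideal_self[OF c1(2)] by (intro genideal_minimal i) auto
    have i: "ideal (Idl (?V' \<union> S)) R" using genideal_ideal c1 by blast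
    have "?V' \<union> S \<subseteq> Idl (?V' \<union> S)" using genideal_self[OF c1(1)] .
    thus "Idl (V \<union> insert s S) \<subseteq> Idl (?V' \<union> S)"
      using up sV' by (intro genideal_minimal i) auto
  qed
  moreover have "ideal_length R (Idl (?V' \<union> S)) ?V' \<noteq> \<infinity>"
    using insert.prems up V' by (intro insert.IH) auto
  moreover have "ideal_length R ?V' V \<le> 1"
  proof (rule ideal_length_simple_le[OF V' V.is_ideal up(1)])
    fix y z assume y: "y \<in> ?V'" "y \<notin> V" and z: "z \<in> ?V'"
    obtain v c where v: "v \<in> V" "c \<in> carrier R" "y = v \<oplus> c \<otimes> s"
      using y unfolding set_add_def' cgenideal_def by auto
    obtain w d where w: "w \<in> V" "d \<in> carrier R" "z = w \<oplus> d \<otimes> s"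
      using z unfolding set_add_def' cgenideal_def by auto
    have "c \<notin> M" using y v insert.prems(3) by auto
    then obtain a where a: "a \<in> carrier R" "\<one> \<ominus> a \<otimes> c \<in> M" using maximalideal_coprime[OF M v(2)] by blast
    have "v \<in> carrier R" "w \<in> carrier R" using v w V.Icarr by auto
    hence eq: "z \<ominus> (d \<otimes> a) \<otimes> y = (w \<ominus> (d \<otimes> a) \<otimes> v) \<oplus> d \<otimes> ((\<one> \<ominus> a \<otimes> c) \<otimes> s)"
      unfolding v(3) w(3) using v(2) w(2) a(1) s by algebra
    have "d \<otimes> ((\<one> \<ominus> a \<otimes> c) \<otimes> s) \<in> V"
      by (rule V.I_l_closed[OF insert.prems(3)[OF a(2) insertI1] w(2)])
    moreover have "(d \<otimes> a) \<otimes> v \<in> V"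
      by (rule V.I_l_closed[OF v(1) m_closed[OF w(2) a(1)]])
    hence "w \<ominus> (d \<otimes> a) \<otimes> v \<in> V"
      unfolding minus_eq by (rule V.a_closed[OF w(1) V.a_inv_closed])
    ultimately have "z \<ominus> (d \<otimes> a) \<otimes> y \<in> V" unfolding eq by (intro V.a_closed)
    thus "\<exists>a\<in>carrier R. z \<ominus> a \<otimes> y \<in> V" using m_closed[OF w(2) a(1)] by (rule bexI)
  qed
  moreover have "?V' \<subseteq> Idl (?V' \<union> S)" using genideal_self[OF c1(1)] by simp
  hence "ideal_length R (Idl (?V' \<union> S)) V = ideal_length R (Idl (?V' \<union> S)) ?V' + ideal_length R ?V' V"
    by (rule ideal_length_add[OF V.is_ideal V' genideal_ideal[OF c1(1)] up(1)])
  ultimately show ?case by (cases "ideal_length R ?V' V") (auto simp: plus_eq_infty_iff_enat)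
qed

section \<open>Lengths of quotient modules\<close>

text \<open>The correspondence between submodules of \<open>U/V\<close> and ideals, for any module structure \<open>Q\<close> that is
the image of \<open>U\<close> under a linear map \<open>\<kappa>\<close> with kernel \<open>V\<close>. The operations of \<open>Q\<close> are transported along
\<open>\<kappa>\<close>, so that the construction of \<open>Q\<close> by cosets can be forgotten.\<close>

lemma (in cring) module_length_eq_ideal_length:
  fixes Q :: "('a, 'q, 'm) module_scheme" and \<kappa> :: "'a \<Rightarrow> 'q"
  assumes V: "ideal V R" and U: "ideal U R" and VU: "V \<subseteq> U"
    and surj: "\<kappa> ` U = carrier Q"
    and add: "\<And>a b. a \<in> U \<Longrightarrow> b \<in> U \<Longrightarrow> \<kappa> (a \<oplus> b) = \<kappa> a \<oplus>\<^bsub>Q\<^esub> \<kappa> b"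
    and smult: "\<And>c a. c \<in> carrier R \<Longrightarrow> a \<in> U \<Longrightarrow> \<kappa> (c \<otimes> a) = c \<odot>\<^bsub>Q\<^esub> \<kappa> a"
    and zero: "\<kappa> \<zero> = \<zero>\<^bsub>Q\<^esub>"
    and ker: "\<And>a b. a \<in> U \<Longrightarrow> b \<in> U \<Longrightarrow> \<kappa> a = \<kappa> b \<longleftrightarrow> a \<ominus> b \<in> V"
  shows "module_length R Q = ideal_length R U V"
proof -
  interpret V: ideal V R by fact
  interpret U: ideal U R by fact
  have Uc: "a \<in> carrier R" if "a \<in> U" for a using U.Icarr that .
  have inv: "inv\<^bsub>add_monoid Q\<^esub> (\<kappa> a) = \<kappa> (\<ominus> a)" if a: "a \<in> U" for a
    unfolding m_inv_def
  proof (rule the_equality)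
    have "\<kappa> a \<oplus>\<^bsub>Q\<^esub> \<kappa> (\<ominus> a) = \<kappa> (a \<oplus> \<ominus> a)" "\<kappa> (\<ominus> a) \<oplus>\<^bsub>Q\<^esub> \<kappa> a = \<kappa> (\<ominus> a \<oplus> a)"
      using add[of a "\<ominus> a"] add[of "\<ominus> a" a] a U.a_inv_closed by simp_all
    thus "\<kappa> (\<ominus> a) \<in> carrier (add_monoid Q) \<and> \<kappa> a \<otimes>\<^bsub>add_monoid Q\<^esub> \<kappa> (\<ominus> a) = \<one>\<^bsub>add_monoid Q\<^esub>
        \<and> \<kappa> (\<ominus> a) \<otimes>\<^bsub>add_monoid Q\<^esub> \<kappa> a = \<one>\<^bsub>add_monoid Q\<^esub>"
      using a Uc[OF a] U.a_inv_closed[OF a] surj zero by (auto simp: r_neg l_neg)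
    fix y assume y: "y \<in> carrier (add_monoid Q) \<and> \<kappa> a \<otimes>\<^bsub>add_monoid Q\<^esub> y = \<one>\<^bsub>add_monoid Q\<^esub>
        \<and> y \<otimes>\<^bsub>add_monoid Q\<^esub> \<kappa> a = \<one>\<^bsub>add_monoid Q\<^esub>"
    then obtain b where b: "b \<in> U" "y = \<kappa> b" using surj by auto
    have "\<kappa> (a \<oplus> b) = \<kappa> \<zero>" using y b a add zero by simp
    hence "(a \<oplus> b) \<ominus> \<zero> \<in> V" using ker[of "a \<oplus> b" \<zero>] a b by simp
    moreover have "(a \<oplus> b) \<ominus> \<zero> = b \<ominus> (\<ominus> a)" using Uc[OF a] Uc[OF b(1)] by algebra
    ultimately have "b \<ominus> (\<ominus> a) \<in> V" by simp
    thus "y = \<kappa> (\<ominus> a)" using ker[OF b(1) U.a_inv_closed[OF a]] b(2) by simp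
  qed
  let ?S = "{P. submodule P R Q}" and ?T = "ideals_between R V U"
  let ?g = "\<lambda>P. {a \<in> U. \<kappa> a \<in> P}"
  have sub: "submodule (\<kappa> ` N) R Q" if N: "N \<in> ?T" for N
  proof -
    have idN: "ideal N R" and NU: "N \<subseteq> U" using N by (auto simp: ideals_between_def)
    interpret N: ideal N R by fact
    have NU': "a \<in> U" if "a \<in> N" for a using NU that by blast
    show ?thesis
      unfolding submodule_def subgroup_def submodule_axioms_def
    proof (intro conjI allI impI subsetI)
      fix q assume "q \<in> \<kappa> ` N" thus "q \<in> carrier (add_monoid Q)" using NU surj by auto
    next
      fix q q' assume "q \<in> \<kappa> ` N" "q' \<in> \<kappa> ` N"
      then obtain a b where ab: "a \<in> N" "b \<in> N" "q = \<kappa> a" "q' = \<kappa> b" by auto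
      have "\<kappa> (a \<oplus> b) \<in> \<kappa> ` N" using ab N.a_closed by blast
      thus "q \<otimes>\<^bsub>add_monoid Q\<^esub> q' \<in> \<kappa> ` N" using ab by (simp add: add NU')
    next
      show "\<one>\<^bsub>add_monoid Q\<^esub> \<in> \<kappa> ` N" using imageI[OF N.zero_closed, of \<kappa>] zero by simp
    next
      fix q assume "q \<in> \<kappa> ` N"
      then obtain a where a: "a \<in> N" "q = \<kappa> a" by auto
      thus "inv\<^bsub>add_monoid Q\<^esub> q \<in> \<kappa> ` N" using inv[OF NU'[OF a(1)]] N.a_inv_closed by simp
    next
      fix c q assume c: "c \<in> carrier R" and "q \<in> \<kappa> ` N"
      then obtain a where a: "a \<in> N" "q = \<kappa> a" by auto
      thus "c \<odot>\<^bsub>Q\<^esub> q \<in> \<kappa> ` N"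
        using smult[OF c NU'[OF a(1)]] imageI[OF N.I_l_closed[OF a(1) c], of \<kappa>] by simp
    qed
  qed
  have between: "?g P \<in> ?T" if P: "submodule P R Q" for P
  proof -
    interpret P: submodule P R Q by fact
    have Pc: "P \<subseteq> carrier Q" using P.subset by simp
    have PV: "\<kappa> v \<in> P" if "v \<in> V" for v
      using ker[of v \<zero>] that VU zero P.one_closed Uc by (auto simp: minus_eq)
    have "ideal (?g P) R"
    proof (rule idealI)
      show "ring R" by (rule ring_axioms)
      show "subgroup (?g P) (add_monoid R)"
      proof (unfold subgroup_def, intro conjI allI impI subsetI)
        fix a assume a: "a \<in> ?g P"
        thus "a \<in> carrier (add_monoid R)" using Uc by simp
        have "inv\<^bsub>add_monoid Q\<^esub> (\<kappa> a) \<in> P" using a by (intro P.m_inv_closed) simp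
        hence "\<kappa> (\<ominus> a) \<in> P" using a by (simp add: inv)
        thus "inv\<^bsub>add_monoid R\<^esub> a \<in> ?g P" using a by (simp flip: a_inv_def)
        fix b assume "b \<in> ?g P"
        thus "a \<otimes>\<^bsub>add_monoid R\<^esub> b \<in> ?g P" using a P.m_closed[of "\<kappa> a" "\<kappa> b"] add[of a b] by simp
      qed (use zero P.one_closed in simp)
      fix a c assume a: "a \<in> ?g P" and c: "c \<in> carrier R"
      thus "c \<otimes> a \<in> ?g P" using smult P.smult_closed U.I_l_closed by simp
      thus "a \<otimes> c \<in> ?g P" using m_comm[of a c] a c Uc by simp
    qed
    thus ?thesis using PV VU by (auto simp: ideals_between_def)
  qed
  have gk: "?g (\<kappa> ` N) = N" if N: "N \<in> ?T" for N
  proof -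
    have idN: "ideal N R" and NU: "N \<subseteq> U" and VN: "V \<subseteq> N" using N by (auto simp: ideals_between_def)
    interpret N: ideal N R by fact
    have "a \<in> N" if a: "a \<in> U" "\<kappa> a \<in> \<kappa> ` N" for a
    proof -
      obtain b where b: "b \<in> N" "\<kappa> a = \<kappa> b" using a by auto
      hence "a \<ominus> b \<in> N" using ker[of a b] a NU VN by auto
      hence "(a \<ominus> b) \<oplus> b \<in> N" using b N.a_closed by blast
      moreover have "(a \<ominus> b) \<oplus> b = a" using Uc[OF a(1)] N.Icarr[OF b(1)] by algebra
      ultimately show ?thesis by simp
    qed
    thus ?thesis using NU by auto
  qed
  have kg: "\<kappa> ` ?g P = P" if P: "submodule P R Q" for P
  proof -
    interpret P: submodule P R Q by fact
    have "P \<subseteq> \<kappa> ` U" using P.subset surj by simp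
    thus ?thesis by auto
  qed
  have "chain_length ?S = chain_length ?T"
  proof (rule chain_length_eqI[where f = ?g and g = "\<lambda>N. \<kappa> ` N"])
    show "?T \<noteq> {}" using ideals_between_nonempty[OF V VU] .
    thus "?S \<noteq> {}" using sub by auto
    fix P P' assume PP: "P \<in> ?S" "P' \<in> ?S" and less: "P \<subset> P'"
    have "P = P'" if "?g P = ?g P'"
      using arg_cong[OF that, of "(`) \<kappa>"] unfolding kg[OF PP(1)[simplified]] kg[OF PP(2)[simplified]] .
    hence "?g P \<noteq> ?g P'" using less by blast
    thus "?g P \<subset> ?g P'" using less by blast
  next
    fix N N' assume "N \<in> ?T" "N' \<in> ?T" and less: "N \<subset> N'"
    have "N = N'" if "\<kappa> ` N = \<kappa> ` N'"
      using arg_cong[OF that, of ?g] unfolding gk[OF \<open>N \<in> ?T\<close>] gk[OF \<open>N' \<in> ?T\<close>] .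
    hence "\<kappa> ` N \<noteq> \<kappa> ` N'" using less by blast
    thus "\<kappa> ` N \<subset> \<kappa> ` N'" using less by blast
  qed (use sub between in auto)
  thus ?thesis
    unfolding module_length_def ideal_length_def chain_length_def has_chain_def by simp
qed

text \<open>A linear embedding \<open>\<iota>\<close> of \<open>U\<close> into another structure \<open>M\<close> does not change lengths. With the identity
it computes lengths in the ring itself, and with \<open>a \<mapsto> a/x\<^sup>r\<close> lengths of fractional ideals.\<close>

lemma (in cring) quot_length_embedding:
  fixes M :: "('a, 'q, 'm) module_scheme" and \<iota> :: "'a \<Rightarrow> 'q"
  assumes V: "ideal V R" and U: "ideal U R" and VU: "V \<subseteq> U"
    and inj: "inj_on \<iota> U"
    and add: "\<And>a b. a \<in> U \<Longrightarrow> b \<in> U \<Longrightarrow> \<iota> (a \<oplus> b) = \<iota> a \<oplus>\<^bsub>M\<^esub> \<iota> b"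
    and smult: "\<And>c a. c \<in> carrier R \<Longrightarrow> a \<in> U \<Longrightarrow> \<iota> (c \<otimes> a) = c \<odot>\<^bsub>M\<^esub> \<iota> a"
  shows "quot_length R M (\<iota> ` U) (\<iota> ` V) = the_enat (ideal_length R U V)"
proof -
  let ?M = "M\<lparr>carrier := \<iota> ` U\<rparr>"
  let ?Q = "quot_module ?M (\<iota> ` V)"
  interpret V: ideal V R by fact
  interpret U: ideal U R by fact
  have VU': "v \<in> U" if "v \<in> V" for v using VU that by blast
  define \<kappa> where "\<kappa> a = \<iota> ` (V +> a)" for a
  have coset: "\<iota> ` V +>\<^bsub>?M\<^esub> \<iota> a = \<kappa> a" if a: "a \<in> U" for a
    using add[OF VU' a] by (auto simp: \<kappa>_def a_r_coset_def' intro!: image_eqI)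
  have cosetU: "V +> a \<subseteq> U" if "a \<in> U" for a
    using that VU' by (auto simp: a_r_coset_def')
  have ker: "\<kappa> a = \<kappa> b \<longleftrightarrow> a \<ominus> b \<in> V" if "a \<in> U" "b \<in> U" for a b
    unfolding \<kappa>_def inj_on_image_eq_iff[OF inj cosetU[OF that(1)] cosetU[OF that(2)]]
    using quotient_eq_iff_same_a_r_cos[OF V U.Icarr[OF that(1)] U.Icarr[OF that(2)]] by blast
  have k0: "\<kappa> a = \<iota> ` V" if "a \<in> V" for a
    unfolding \<kappa>_def using a_rcos_zero[OF V that] by simp
  have "module_length R ?Q = ideal_length R U V"
  proof (rule module_length_eq_ideal_length[OF V U VU, where \<kappa> = \<kappa>])
    show "\<kappa> ` U = carrier ?Q"
      by (auto simp: quot_module_def A_RCOSETS_def' coset)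
    show "\<kappa> \<zero> = \<zero>\<^bsub>?Q\<^esub>" using k0 by (simp add: quot_module_def)
    fix a assume a: "a \<in> U"
    have mem: "q \<in> \<kappa> a \<longleftrightarrow> (\<exists>v\<in>V. q = \<iota> (v \<oplus> a))" for q
      by (auto simp: \<kappa>_def a_r_coset_def')
    fix b assume b: "b \<in> U"
    have "\<kappa> a \<oplus>\<^bsub>?Q\<^esub> \<kappa> b = \<iota> ` ((V +> a) <+> (V +> b))"
    proof -
      have "\<iota> y \<oplus>\<^bsub>M\<^esub> \<iota> z = \<iota> (y \<oplus> z)" if "y \<in> V +> a" "z \<in> V +> b" for y z
        using add cosetU[OF a] cosetU[OF b] that by (metis subsetD)
      thus ?thesis
        unfolding \<kappa>_def quot_module_def by (force simp: set_add_def')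
    qed
    thus "\<kappa> (a \<oplus> b) = \<kappa> a \<oplus>\<^bsub>?Q\<^esub> \<kappa> b"
      using V.a_rcos_sum[OF U.Icarr[OF a] U.Icarr[OF b]] by (simp add: \<kappa>_def)
  next
    fix c a assume c: "c \<in> carrier R" and a: "a \<in> U"
    have step: "\<iota> ` V +>\<^bsub>?M\<^esub> (c \<odot>\<^bsub>M\<^esub> \<iota> (v \<oplus> a)) = \<kappa> (c \<otimes> a)" if v: "v \<in> V" for v
    proof -
      have vaU: "v \<oplus> a \<in> U" "c \<otimes> (v \<oplus> a) \<in> U" "c \<otimes> a \<in> U"
        using a v VU' U.I_l_closed c by auto
      have "\<iota> ` V +>\<^bsub>?M\<^esub> (c \<odot>\<^bsub>M\<^esub> \<iota> (v \<oplus> a)) = \<kappa> (c \<otimes> (v \<oplus> a))"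
        using smult[OF c vaU(1)] coset[OF vaU(2)] by simp
      also have "\<dots> = \<kappa> (c \<otimes> a)"
      proof -
        have "c \<otimes> (v \<oplus> a) \<ominus> c \<otimes> a = c \<otimes> v" using c V.Icarr[OF v] U.Icarr[OF a] by algebra
        thus ?thesis using ker[OF vaU(2,3)] V.I_l_closed[OF v c] by simp
      qed
      finally show ?thesis .
    qed
    have "c \<odot>\<^bsub>?Q\<^esub> \<kappa> a = (\<Union>v\<in>V. \<iota> ` V +>\<^bsub>?M\<^esub> (c \<odot>\<^bsub>M\<^esub> \<iota> (v \<oplus> a)))"
      by (auto simp: quot_module_def \<kappa>_def a_r_coset_def')
    also have "\<dots> = (\<Union>v\<in>V. \<kappa> (c \<otimes> a))" using step by simp
    also have "\<dots> = \<kappa> (c \<otimes> a)" by (rule UN_constant_eq[OF V.zero_closed]) simp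
    finally show "\<kappa> (c \<otimes> a) = c \<odot>\<^bsub>?Q\<^esub> \<kappa> a" by simp
  qed (use ker in auto)
  thus ?thesis unfolding quot_length_def by simp
qed

lemma (in cring) quot_length_self_module:
  assumes "ideal V R" "ideal U R" "V \<subseteq> U"
  shows "quot_length R (self_module R) U V = the_enat (ideal_length R U V)"
  using quot_length_embedding[OF assms, of "\<lambda>a. a" "self_module R"] by (simp add: self_module_def)

section \<open>The total ring of fractions\<close>

context cring
begin

lemma regular_carrier: "s \<in> regular_elements R \<Longrightarrow> s \<in> carrier R"
  by (simp add: regular_elements_def)

lemma regular_one: "\<one> \<in> regular_elements R"
  by (simp add: regular_elements_def)

lemma regular_mult:
  assumes "s \<in> regular_elements R" "t \<in> regular_elements R"
  shows "s \<otimes> t \<in> regular_elements R"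
proof -
  note car = regular_carrier[OF assms(1)] regular_carrier[OF assms(2)]
  have "a = \<zero>" if a: "a \<in> carrier R" "(s \<otimes> t) \<otimes> a = \<zero>" for a
  proof -
    have "s \<otimes> (t \<otimes> a) = \<zero>" using a car by (simp add: m_assoc)
    hence "t \<otimes> a = \<zero>" using assms(1) m_closed[OF car(2) a(1)] unfolding regular_elements_def by blast
    thus ?thesis using assms(2) a(1) unfolding regular_elements_def by blast
  qed
  thus ?thesis unfolding regular_elements_def using car by blast
qed

lemma regular_pow: "s \<in> regular_elements R \<Longrightarrow> s [^] (n::nat) \<in> regular_elements R"
  by (induction n) (auto simp: regular_one regular_mult)

lemma frac_refl: "a \<in> carrier R \<Longrightarrow> s \<in> regular_elements R \<Longrightarrow> (a, s) \<in> frac R a s"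
  by (simp add: frac_def)

lemma frac_eq_iff:
  assumes "a \<in> carrier R" "s \<in> regular_elements R" "b \<in> carrier R" "t \<in> regular_elements R"
  shows "frac R a s = frac R b t \<longleftrightarrow> a \<otimes> t = b \<otimes> s"
proof
  assume "frac R a s = frac R b t"
  thus "a \<otimes> t = b \<otimes> s" using frac_refl[OF assms(3,4)] by (auto simp: frac_def)
next
  have trans: "frac R a s \<subseteq> frac R b t"
    if "a \<in> carrier R" "s \<in> regular_elements R" "b \<in> carrier R" "t \<in> regular_elements R"
      and eq: "a \<otimes> t = b \<otimes> s" for a b s t
  proof
    fix p assume "p \<in> frac R a s"
    then obtain c u where p: "p = (c, u)" "c \<in> carrier R" "u \<in> regular_elements R" "a \<otimes> u = c \<otimes> s"
      by (auto simp: frac_def)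
    note car = that(1,3) p(2) regular_carrier[OF that(2)] regular_carrier[OF that(4)] regular_carrier[OF p(3)]
    have "s \<otimes> (b \<otimes> u) = (b \<otimes> s) \<otimes> u" using car by algebra
    also have "\<dots> = (a \<otimes> u) \<otimes> t" unfolding eq[symmetric] using car by algebra
    also have "\<dots> = s \<otimes> (c \<otimes> t)" unfolding p(4) using car by algebra
    finally have "b \<otimes> u = c \<otimes> t" using regular_cancel[OF that(2)] car by simp
    thus "p \<in> frac R b t" using p by (simp add: frac_def)
  qed
  assume "a \<otimes> t = b \<otimes> s"
  thus "frac R a s = frac R b t" using trans[OF assms] trans[OF assms(3,4,1,2)] by auto
qed

lemma frac_mult:
  assumes "a \<in> carrier R" "s \<in> regular_elements R" "b \<in> carrier R" "t \<in> regular_elements R"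
  shows "frac R a s \<otimes>\<^bsub>total_frac_ring R\<^esub> frac R b t = frac R (a \<otimes> b) (s \<otimes> t)"
proof -
  have eq: "frac R (a' \<otimes> b') (s' \<otimes> t') = frac R (a \<otimes> b) (s \<otimes> t)"
    if 1: "(a', s') \<in> frac R a s" and 2: "(b', t') \<in> frac R b t" for a' s' b' t'
  proof -
    have car: "a' \<in> carrier R" "s' \<in> regular_elements R" "b' \<in> carrier R" "t' \<in> regular_elements R"
      and e: "a \<otimes> s' = a' \<otimes> s" "b \<otimes> t' = b' \<otimes> t" using that by (auto simp: frac_def)
    note rc = car(1,3) assms(1,3) car(2,4)[THEN regular_carrier] assms(2,4)[THEN regular_carrier]
    have "(a' \<otimes> b') \<otimes> (s \<otimes> t) = (a' \<otimes> s) \<otimes> (b' \<otimes> t)" using rc by algebra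
    also have "\<dots> = (a \<otimes> b) \<otimes> (s' \<otimes> t')" unfolding e[symmetric] using rc by algebra
    finally show ?thesis using rc car assms by (simp add: frac_eq_iff regular_mult)
  qed
  have "frac R a s \<otimes>\<^bsub>total_frac_ring R\<^esub> frac R b t
      = (\<Union>p\<in>frac R a s. \<Union>q\<in>frac R b t. frac R (a \<otimes> b) (s \<otimes> t))"
    unfolding total_frac_ring_def using eq by (auto 4 3)
  thus ?thesis using frac_refl assms by auto
qed

lemma frac_add:
  assumes "a \<in> carrier R" "s \<in> regular_elements R" "b \<in> carrier R" "t \<in> regular_elements R"
  shows "frac R a s \<oplus>\<^bsub>total_frac_ring R\<^esub> frac R b t = frac R (a \<otimes> t \<oplus> b \<otimes> s) (s \<otimes> t)"
proof -
  have eq: "frac R (a' \<otimes> t' \<oplus> b' \<otimes> s') (s' \<otimes> t') = frac R (a \<otimes> t \<oplus> b \<otimes> s) (s \<otimes> t)"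
    if 1: "(a', s') \<in> frac R a s" and 2: "(b', t') \<in> frac R b t" for a' s' b' t'
  proof -
    have car: "a' \<in> carrier R" "s' \<in> regular_elements R" "b' \<in> carrier R" "t' \<in> regular_elements R"
      and e: "a \<otimes> s' = a' \<otimes> s" "b \<otimes> t' = b' \<otimes> t" using that by (auto simp: frac_def)
    note rc = car(1,3) assms(1,3) car(2,4)[THEN regular_carrier] assms(2,4)[THEN regular_carrier]
    have "(a' \<otimes> t' \<oplus> b' \<otimes> s') \<otimes> (s \<otimes> t) = (a' \<otimes> s) \<otimes> (t \<otimes> t') \<oplus> (b' \<otimes> t) \<otimes> (s \<otimes> s')"
      using rc by algebra
    also have "\<dots> = (a \<otimes> t \<oplus> b \<otimes> s) \<otimes> (s' \<otimes> t')" unfolding e[symmetric] using rc by algebra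
    finally show ?thesis using rc car assms by (simp add: frac_eq_iff regular_mult)
  qed
  have "frac R a s \<oplus>\<^bsub>total_frac_ring R\<^esub> frac R b t
      = (\<Union>p\<in>frac R a s. \<Union>q\<in>frac R b t. frac R (a \<otimes> t \<oplus> b \<otimes> s) (s \<otimes> t))"
    unfolding total_frac_ring_def using eq by (auto 4 3)
  thus ?thesis using frac_refl assms by auto
qed

lemma frac_cases:
  assumes "p \<in> carrier (total_frac_ring R)"
  obtains a s where "p = frac R a s" "a \<in> carrier R" "s \<in> regular_elements R"
  using assms by (auto simp: total_frac_ring_def)

lemma frac_closed:
  "a \<in> carrier R \<Longrightarrow> s \<in> regular_elements R \<Longrightarrow> frac R a s \<in> carrier (total_frac_ring R)"
  by (auto simp: total_frac_ring_def)

lemma frac_zero: "\<zero>\<^bsub>total_frac_ring R\<^esub> = frac R \<zero> \<one>"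
  by (simp add: total_frac_ring_def)

lemma frac_one: "\<one>\<^bsub>total_frac_ring R\<^esub> = frac R \<one> \<one>"
  by (simp add: total_frac_ring_def)

text \<open>The ideal generated by a set is an intersection over a family of ideals that is empty unless the
ring axioms hold. So extended ideals in the first neighborhood ring can only be computed
once the fractions are known to form a ring.\<close>

lemma total_frac_cring: "cring (total_frac_ring R)"
proof (rule cringI)
  let ?K = "total_frac_ring R"
  note s = frac_mult frac_add frac_eq_iff regular_mult regular_carrier regular_one frac_zero frac_one
  show "abelian_group ?K"
  proof (rule abelian_groupI)
    fix p q assume "p \<in> carrier ?K" "q \<in> carrier ?K"
    then obtain a s b t where f: "p = frac R a s" "a \<in> carrier R" "s \<in> regular_elements R"
      "q = frac R b t" "b \<in> carrier R" "t \<in> regular_elements R" by (metis frac_cases)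
    note rc = f(2,5) f(3,6)[THEN regular_carrier]
    show "p \<oplus>\<^bsub>?K\<^esub> q \<in> carrier ?K" using f rc by (simp add: frac_add frac_closed regular_mult)
    have "(a \<otimes> t \<oplus> b \<otimes> s) \<otimes> (t \<otimes> s) = (b \<otimes> s \<oplus> a \<otimes> t) \<otimes> (s \<otimes> t)" using rc by algebra
    thus "p \<oplus>\<^bsub>?K\<^esub> q = q \<oplus>\<^bsub>?K\<^esub> p" using f rc by (simp add: s)
    fix q' assume "q' \<in> carrier ?K"
    then obtain c u where g: "q' = frac R c u" "c \<in> carrier R" "u \<in> regular_elements R" by (metis frac_cases)
    note rc = rc g(2) g(3)[THEN regular_carrier]
    have "((a \<otimes> t \<oplus> b \<otimes> s) \<otimes> u \<oplus> c \<otimes> (s \<otimes> t)) \<otimes> (s \<otimes> (t \<otimes> u))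
        = (a \<otimes> (t \<otimes> u) \<oplus> (b \<otimes> u \<oplus> c \<otimes> t) \<otimes> s) \<otimes> ((s \<otimes> t) \<otimes> u)" using rc by algebra
    thus "p \<oplus>\<^bsub>?K\<^esub> q \<oplus>\<^bsub>?K\<^esub> q' = p \<oplus>\<^bsub>?K\<^esub> (q \<oplus>\<^bsub>?K\<^esub> q')" using f g rc by (simp add: s)
  next
    show "\<zero>\<^bsub>?K\<^esub> \<in> carrier ?K" by (simp add: frac_closed s)
    fix p assume "p \<in> carrier ?K"
    then obtain a s where f: "p = frac R a s" "a \<in> carrier R" "s \<in> regular_elements R" by (metis frac_cases)
    note rc = f(2) f(3)[THEN regular_carrier]
    show "\<zero>\<^bsub>?K\<^esub> \<oplus>\<^bsub>?K\<^esub> p = p" using f rc by (simp add: s)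
    have "\<ominus> a \<otimes> s \<oplus> a \<otimes> s = \<zero>" using rc by algebra
    hence "frac R (\<ominus> a) s \<oplus>\<^bsub>?K\<^esub> p = \<zero>\<^bsub>?K\<^esub>" using f rc by (simp add: s)
    thus "\<exists>y\<in>carrier ?K. y \<oplus>\<^bsub>?K\<^esub> p = \<zero>\<^bsub>?K\<^esub>" using f frac_closed by (meson a_inv_closed)
  qed
  show "Group.comm_monoid ?K"
  proof (rule comm_monoidI)
    fix p q assume "p \<in> carrier ?K" "q \<in> carrier ?K"
    then obtain a s b t where f: "p = frac R a s" "a \<in> carrier R" "s \<in> regular_elements R"
      "q = frac R b t" "b \<in> carrier R" "t \<in> regular_elements R" by (metis frac_cases)
    note rc = f(2,5) f(3,6)[THEN regular_carrier]
    show "p \<otimes>\<^bsub>?K\<^esub> q \<in> carrier ?K" using f rc by (simp add: frac_mult frac_closed regular_mult)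
    have "(a \<otimes> b) \<otimes> (t \<otimes> s) = (b \<otimes> a) \<otimes> (s \<otimes> t)" using rc by algebra
    thus "p \<otimes>\<^bsub>?K\<^esub> q = q \<otimes>\<^bsub>?K\<^esub> p" using f rc by (simp add: s)
    fix q' assume "q' \<in> carrier ?K"
    then obtain c u where g: "q' = frac R c u" "c \<in> carrier R" "u \<in> regular_elements R" by (metis frac_cases)
    note rc = rc g(2) g(3)[THEN regular_carrier]
    show "p \<otimes>\<^bsub>?K\<^esub> q \<otimes>\<^bsub>?K\<^esub> q' = p \<otimes>\<^bsub>?K\<^esub> (q \<otimes>\<^bsub>?K\<^esub> q')" using f g rc by (simp add: s m_assoc)
  next
    show "\<one>\<^bsub>?K\<^esub> \<in> carrier ?K" by (simp add: frac_closed s)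
    fix p assume "p \<in> carrier ?K"
    then obtain a s where f: "p = frac R a s" "a \<in> carrier R" "s \<in> regular_elements R" by (metis frac_cases)
    thus "\<one>\<^bsub>?K\<^esub> \<otimes>\<^bsub>?K\<^esub> p = p" by (simp add: s)
  qed
  fix p q q' assume "p \<in> carrier ?K" "q \<in> carrier ?K" "q' \<in> carrier ?K"
  then obtain a s b t c u where f: "p = frac R a s" "a \<in> carrier R" "s \<in> regular_elements R"
      "q = frac R b t" "b \<in> carrier R" "t \<in> regular_elements R"
      "q' = frac R c u" "c \<in> carrier R" "u \<in> regular_elements R" by (metis frac_cases)
  note rc = f(2,5,8) f(3,6,9)[THEN regular_carrier]
  have "((a \<otimes> t \<oplus> b \<otimes> s) \<otimes> c) \<otimes> ((s \<otimes> u) \<otimes> (t \<otimes> u))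
      = ((a \<otimes> c) \<otimes> (t \<otimes> u) \<oplus> (b \<otimes> c) \<otimes> (s \<otimes> u)) \<otimes> ((s \<otimes> t) \<otimes> u)" using rc by algebra
  thus "(p \<oplus>\<^bsub>?K\<^esub> q) \<otimes>\<^bsub>?K\<^esub> q' = p \<otimes>\<^bsub>?K\<^esub> q' \<oplus>\<^bsub>?K\<^esub> q \<otimes>\<^bsub>?K\<^esub> q'" using f rc by (simp add: s)
qed

lemma frac_add_same:
  assumes "a \<in> carrier R" "b \<in> carrier R" "s \<in> regular_elements R"
  shows "frac R a s \<oplus>\<^bsub>total_frac_ring R\<^esub> frac R b s = frac R (a \<oplus> b) s"
proof -
  note rc = assms(1,2) assms(3)[THEN regular_carrier]
  have "(a \<otimes> s \<oplus> b \<otimes> s) \<otimes> s = (a \<oplus> b) \<otimes> (s \<otimes> s)" using rc by algebra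
  thus ?thesis using assms rc by (simp add: frac_add frac_eq_iff regular_mult)
qed

lemma frac_minus:
  assumes "a \<in> carrier R" "s \<in> regular_elements R"
  shows "\<ominus>\<^bsub>total_frac_ring R\<^esub> frac R a s = frac R (\<ominus> a) s"
proof -
  interpret K: cring "total_frac_ring R" by (rule total_frac_cring)
  have "frac R (\<ominus> a) s \<oplus>\<^bsub>total_frac_ring R\<^esub> frac R a s = \<zero>\<^bsub>total_frac_ring R\<^esub>"
    using assms by (simp add: frac_add_same l_neg frac_zero frac_eq_iff regular_one regular_carrier)
  thus ?thesis using assms by (intro K.minus_equality frac_closed) auto
qed

end

section \<open>Powers of the maximal ideal and the reduction\<close>

text \<open>Used to multiply the equation \<open>\<mm>\<^sup>r\<^sup>+\<^sup>1 = x \<mm>\<^sup>r\<close> by \<open>\<mm>\<close>.\<close>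

lemma (in cring) ideal_prod_lcoset:
  assumes x: "x \<in> carrier R" and I: "ideal I R" and J: "ideal J R"
  shows "I \<cdot> (x <# J) = x <# (I \<cdot> J)"
proof
  interpret I: ideal I R by fact
  interpret J: ideal J R by fact
  have IJ: "I \<cdot> J \<subseteq> carrier R" using ideal_prod_in_carrier[OF I J] .
  show "I \<cdot> (x <# J) \<subseteq> x <# (I \<cdot> J)"
  proof
    fix s assume "s \<in> I \<cdot> (x <# J)"
    thus "s \<in> x <# (I \<cdot> J)"
    proof induction
      case (prod i j')
      then obtain j where j: "j \<in> J" "j' = x \<otimes> j" by (auto simp: l_coset_def)
      have "i \<otimes> j' = x \<otimes> (i \<otimes> j)" using j(2) I.Icarr[OF prod(1)] J.Icarr[OF j(1)] x by (simp add: m_lcomm)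
      moreover have "i \<otimes> j \<in> I \<cdot> J" using prod(1) j(1) by (rule ideal_prod.prod)
      ultimately show ?case unfolding l_coset_def by blast
    next
      case (sum s1 s2)
      then obtain a b where ab: "a \<in> I \<cdot> J" "b \<in> I \<cdot> J" "s1 = x \<otimes> a" "s2 = x \<otimes> b"
        by (auto simp: l_coset_def)
      hence "s1 \<oplus> s2 = x \<otimes> (a \<oplus> b)" using IJ x by (simp add: r_distr subset_iff)
      thus ?case using ideal_prod.sum[OF ab(1,2)] unfolding l_coset_def by blast
    qed
  qed
  show "x <# (I \<cdot> J) \<subseteq> I \<cdot> (x <# J)"
  proof
    fix t assume "t \<in> x <# (I \<cdot> J)"
    then obtain s where s: "s \<in> I \<cdot> J" "t = x \<otimes> s" by (auto simp: l_coset_def)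
    have "x \<otimes> s \<in> I \<cdot> (x <# J)" using s(1)
    proof induction
      case (prod i j)
      have "x \<otimes> (i \<otimes> j) = i \<otimes> (x \<otimes> j)" using I.Icarr[OF prod(1)] J.Icarr[OF prod(2)] x by (simp add: m_lcomm)
      thus ?case using prod by (auto simp: l_coset_def intro!: ideal_prod.prod)
    next
      case (sum s1 s2)
      have "x \<otimes> (s1 \<oplus> s2) = x \<otimes> s1 \<oplus> x \<otimes> s2" using sum IJ x by (simp add: r_distr subset_iff)
      thus ?case using ideal_prod.sum[OF sum.IH] by simp
    qed
    thus "t \<in> I \<cdot> (x <# J)" using s by simp
  qed
qed

lemma (in cring) pow_mem_ideal_pow:
  assumes "ideal I R" "y \<in> I"
  shows "y [^] n \<in> ideal_pow R I n"
proof (induction n)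
  case (Suc n)
  have y: "y \<in> carrier R" using ideal.Icarr[OF assms] .
  have "y \<otimes> y [^] n \<in> ideal_pow R I (Suc n)" using ideal_prod.prod[OF assms(2) Suc] by simp
  thus ?case using y by (simp add: m_comm)
qed simp

lemma (in cring) exists_regular_of_depth:
  assumes "local_depth R I \<noteq> 0" and I: "I \<subseteq> carrier R"
  obtains y where "y \<in> I" "y \<in> regular_elements R"
proof -
  have "\<exists>ys. regular_sequence R I ys \<and> ys \<noteq> []"
  proof (rule ccontr)
    assume "\<not> ?thesis"
    hence "local_depth R I \<le> 0"
      unfolding local_depth_def by (intro Sup_least) (auto simp: zero_enat_def)
    thus False using assms(1) by simp
  qed
  then obtain ys where ys: "regular_sequence R I ys" "ys \<noteq> []" by blast
  have empty: "Idl {} = {\<zero>}"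
    using genideal_minimal[OF zeroideal, of "{}"] additive_subgroup.zero_closed[OF ideal.axioms(1)[OF genideal_ideal[of "{}"]]]
    by auto
  have "ys ! 0 \<otimes> a \<in> Idl (set (take 0 ys)) \<longrightarrow> a \<in> Idl (set (take 0 ys))" if "a \<in> carrier R" for a
    using ys that unfolding regular_sequence_def by blast
  hence "a = \<zero>" if "a \<in> carrier R" "ys ! 0 \<otimes> a = \<zero>" for a
    using that by (simp add: empty)
  moreover have "ys ! 0 \<in> I" using ys unfolding regular_sequence_def by (auto intro: nth_mem)
  ultimately show ?thesis using that[of "ys ! 0"] I by (auto simp: regular_elements_def)
qed

text \<open>A power of the regular element \<open>y\<close> lies in \<open>\<mm>\<^sup>n\<^sup>+\<^sup>1 = x \<mm>\<^sup>n\<close> (for \<open>I = \<mm>\<close>), so it is a multiple of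
\<open>x\<close>; anything killed by \<open>x\<close> is therefore killed by a regular element.\<close>

lemma (in cring) reduction_regular:
  assumes I: "ideal I R" and x: "x \<in> I" and red: "ideal_pow R I (Suc n) = x <# ideal_pow R I n"
    and y: "y \<in> I" "y \<in> regular_elements R"
  shows "x \<in> regular_elements R"
proof -
  have xc: "x \<in> carrier R" using ideal.Icarr[OF I x] .
  have "y [^] Suc n \<in> x <# ideal_pow R I n" using pow_mem_ideal_pow[OF I y(1), of "Suc n"] red by simp
  then obtain c where c: "c \<in> ideal_pow R I n" "y [^] Suc n = x \<otimes> c" unfolding l_coset_def by blast
  have idn: "ideal (ideal_pow R I n) R" by (induction n) (simp_all add: oneideal ideal_prod_is_ideal I)
  have cc: "c \<in> carrier R" using ideal.Icarr[OF idn c(1)] .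
  have reg: "y [^] Suc n \<in> regular_elements R" by (rule regular_pow[OF y(2)])
  have "a = \<zero>" if a: "a \<in> carrier R" "x \<otimes> a = \<zero>" for a
  proof -
    have "y [^] Suc n \<otimes> a = c \<otimes> (x \<otimes> a)" unfolding c(2) using xc cc a(1) by algebra
    hence "y [^] Suc n \<otimes> a = \<zero>" using a(2) cc by simp
    thus ?thesis using reg a(1) unfolding regular_elements_def by blast
  qed
  thus ?thesis using xc unfolding regular_elements_def by blast
qed

locale principal_reduction = cring R for R (structure) +
  fixes \<mm> :: "'a set" and x :: 'a and r :: nat
  assumes max: "maximalideal \<mm> R" and x_in: "x \<in> \<mm>" and x_regular: "x \<in> regular_elements R"
    and reduction: "ideal_pow R \<mm> (Suc r) = x <# ideal_pow R \<mm> r"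
begin

abbreviation "M \<equiv> ideal_pow R \<mm>"

lemma m_ideal: "ideal \<mm> R"
  using max maximalideal.axioms(1) by blast

lemma x_carrier [simp]: "x \<in> carrier R"
  using x_regular regular_carrier by blast

lemma xpow_carrier: "x [^] (n::nat) \<in> carrier R"
  by simp

lemma pow_ideal: "ideal (M n) R"
  by (induction n) (simp_all add: oneideal ideal_prod_is_ideal m_ideal)

lemma pow_carrier: "a \<in> M n \<Longrightarrow> a \<in> carrier R"
  using ideal_carrier_subset[OF pow_ideal] by blast

lemma pow_add: "M (i + j) = M i \<cdot> M j"
proof (induction i)
  case 0
  have "carrier R \<cdot> M j = M j"
  proof
    show "carrier R \<cdot> M j \<subseteq> M j"
      using ideal_prod_inter[OF oneideal pow_ideal] by blast
    have "\<one> \<otimes> a \<in> carrier R \<cdot> M j" if "a \<in> M j" for a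
      using that by (intro ideal_prod.prod) auto
    thus "M j \<subseteq> carrier R \<cdot> M j" using pow_carrier by fastforce
  qed
  thus ?case by simp
next
  case (Suc i)
  thus ?case using ideal_prod_assoc[OF m_ideal pow_ideal pow_ideal] by simp
qed

lemma pow_mult:
  "a \<in> M i \<Longrightarrow> b \<in> M j \<Longrightarrow> a \<otimes> b \<in> M (i + j)"
  unfolding pow_add by (rule ideal_prod.prod)

lemma pow_1: "a \<in> \<mm> \<Longrightarrow> a \<in> M 1"
  using ideal_prod.prod[of a \<mm> \<one> "carrier R" R] ideal_carrier_subset[OF m_ideal] by auto

lemma pow_Suc_mult: "a \<in> \<mm> \<Longrightarrow> b \<in> M j \<Longrightarrow> a \<otimes> b \<in> M (Suc j)"
  by (simp add: ideal_prod.prod)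

lemma pow_antimono: "i \<le> j \<Longrightarrow> M j \<subseteq> M i"
proof (induction rule: inc_induct)
  case (step n)
  thus ?case using ideal_prod_inter[OF m_ideal pow_ideal, of n] by auto
qed simp

lemma xpow_mem: "x [^] n \<in> M n"
  by (rule pow_mem_ideal_pow[OF m_ideal x_in])

lemma xpow_mult_mem: "a \<in> M n \<Longrightarrow> x [^] i \<otimes> a \<in> M (i + n)"
  using pow_mult[OF xpow_mem] .

lemma lcoset_lcoset:
  "a \<in> carrier R \<Longrightarrow> b \<in> carrier R \<Longrightarrow> N \<subseteq> carrier R \<Longrightarrow> a <# (b <# N) = (a \<otimes> b) <# N"
  by (force simp: l_coset_def m_assoc)

lemma pow_reduction: "M (Suc (r + n)) = x <# M (r + n)"
proof (induction n)
  case 0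
  thus ?case using reduction by simp
next
  case (Suc n)
  have "M (Suc (r + Suc n)) = \<mm> \<cdot> M (Suc (r + n))" by simp
  also have "\<dots> = \<mm> \<cdot> (x <# M (r + n))" unfolding Suc ..
  also have "\<dots> = x <# (\<mm> \<cdot> M (r + n))"
    by (rule ideal_prod_lcoset[OF x_carrier m_ideal pow_ideal])
  finally show ?case by simp
qed

lemma pow_reduction_iter:
  assumes "r \<le> n"
  shows "M (i + n) = (x [^] i) <# M n"
proof (induction i)
  case 0
  have "\<one> <# M n = M n"
    using ideal_carrier_subset[OF pow_ideal, of n] by (auto simp: l_coset_def subset_iff)
  thus ?case by simp
next
  case (Suc i)
  have "M (Suc i + n) = x <# M (i + n)"
    using pow_reduction[of "i + n - r"] assms by simp
  also have "\<dots> = (x \<otimes> x [^] i) <# M n"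
    unfolding Suc by (rule lcoset_lcoset) (auto simp: ideal_carrier_subset[OF pow_ideal])
  finally show ?case by (simp add: m_comm)
qed

section \<open>The first neighborhood ring\<close>

text \<open>The embedding \<open>a \<mapsto> a/x\<^sup>r\<close>. All elements of the first neighborhood ring can be written with this
denominator; see \<open>first_neighborhood_eq\<close>.\<close>

definition high_frac :: "'a \<Rightarrow> ('a \<times> 'a) set" where
  "high_frac a = frac R a (x [^] r)"

lemma xpow_regular: "x [^] (n::nat) \<in> regular_elements R"
  by (rule regular_pow[OF x_regular])

text \<open>Every \<open>a/x\<^sup>n\<close> with \<open>a \<in> \<mm>\<^sup>n\<^sup>+\<^sup>j\<close> can be rewritten over \<open>x\<^sup>r\<close>: the numerator of \<open>x\<^sup>r a / x\<^sup>n\<^sup>+\<^sup>r\<close> lies in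
\<open>\<mm>\<^sup>n\<^sup>+\<^sup>r\<^sup>+\<^sup>j = x\<^sup>n \<mm>\<^sup>r\<^sup>+\<^sup>j\<close>, and \<open>x\<^sup>n\<close> cancels.\<close>

lemma frac_eq_high_frac:
  assumes a: "a \<in> M (n + j)"
  obtains c where "c \<in> M (r + j)" "frac R a (x [^] n) = high_frac c"
proof -
  have "a \<otimes> x [^] r \<in> M (n + (r + j))"
    using xpow_mult_mem[OF a, of r] pow_carrier[OF a] by (simp add: m_comm ac_simps)
  then obtain c where c: "c \<in> M (r + j)" "a \<otimes> x [^] r = x [^] n \<otimes> c"
    using pow_reduction_iter[of "r + j" n] by (auto simp: l_coset_def)
  have "frac R a (x [^] n) = high_frac c"
    unfolding high_frac_def using c(2) pow_carrier[OF a] pow_carrier[OF c(1)]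
    by (simp add: frac_eq_iff xpow_regular m_comm)
  thus ?thesis using c(1) that by blast
qed

abbreviation frac_ring ("K") where "K \<equiv> total_frac_ring R"

lemma high_frac_add:
  "a \<in> carrier R \<Longrightarrow> b \<in> carrier R \<Longrightarrow> high_frac a \<oplus>\<^bsub>K\<^esub> high_frac b = high_frac (a \<oplus> b)"
  unfolding high_frac_def by (simp add: frac_add_same xpow_regular)

lemma high_frac_minus: "a \<in> carrier R \<Longrightarrow> \<ominus>\<^bsub>K\<^esub> high_frac a = high_frac (\<ominus> a)"
  unfolding high_frac_def by (simp add: frac_minus xpow_regular)

lemma to_frac_eq_high_frac: "a \<in> carrier R \<Longrightarrow> to_frac R a = high_frac (x [^] r \<otimes> a)"
  unfolding high_frac_def to_frac_def by (simp add: frac_eq_iff xpow_regular regular_one m_comm)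

lemma to_frac_mult_high_frac:
  "a \<in> carrier R \<Longrightarrow> b \<in> carrier R \<Longrightarrow> to_frac R a \<otimes>\<^bsub>K\<^esub> high_frac b = high_frac (a \<otimes> b)"
  unfolding high_frac_def to_frac_def by (simp add: frac_mult xpow_regular regular_one)

lemma high_frac_inj: "inj_on high_frac (carrier R)"
  unfolding high_frac_def inj_on_def
  by (auto simp: frac_eq_iff xpow_regular m_comm[of _ "x [^] r"] dest: regular_cancel[OF xpow_regular])

lemma high_frac_closed: "a \<in> carrier R \<Longrightarrow> high_frac a \<in> carrier K"
  unfolding high_frac_def by (simp add: frac_closed xpow_regular)

lemma first_neighborhood_generators:
  "to_frac R ` carrier R \<union> {frac R b x | b. b \<in> \<mm>} \<subseteq> carrier K"
  using x_regular ideal_carrier_subset[OF m_ideal] by (auto simp: to_frac_def frac_closed regular_one)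

lemma high_frac_mult:
  assumes "a \<in> M r" "b \<in> M (r + j)"
  shows "high_frac a \<otimes>\<^bsub>K\<^esub> high_frac b \<in> high_frac ` M (r + j)"
proof -
  have ab: "a \<otimes> b \<in> M ((r + r) + j)"
    using pow_mult[OF assms] by (simp add: ac_simps)
  have "high_frac a \<otimes>\<^bsub>K\<^esub> high_frac b = frac R (a \<otimes> b) (x [^] (r + r))"
    unfolding high_frac_def using assms pow_carrier by (simp add: frac_mult xpow_regular nat_pow_mult)
  thus ?thesis using frac_eq_high_frac[OF ab] by (metis imageI)
qed

text \<open>The fractions \<open>a/x\<^sup>r\<close> with \<open>a \<in> \<mm>\<^sup>r\<close> contain all \<open>a/x\<^sup>n\<close> with \<open>a \<in> \<mm>\<^sup>n\<close>, by \<open>frac_eq_high_frac\<close>. Hence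
they form a ring that contains the generators. Conversely \<open>a/x\<^sup>n\<close> with \<open>a \<in> \<mm>\<^sup>n\<close> is a sum of products
of \<open>n\<close> generators \<open>b/x\<close>.\<close>

lemma first_neighborhood_eq: "first_neighborhood R \<mm> x = high_frac ` M r"
proof
  interpret K: cring K by (rule total_frac_cring)
  show "first_neighborhood R \<mm> x \<subseteq> high_frac ` M r"
  proof
    fix q assume "q \<in> first_neighborhood R \<mm> x"
    thus "q \<in> high_frac ` M r"
      unfolding first_neighborhood_def
    proof induction
      case one
      have "\<one>\<^bsub>K\<^esub> = high_frac (x [^] r)"
        using to_frac_eq_high_frac[of \<one>] by (simp add: frac_one to_frac_def)
      thus ?case using xpow_mem by blast
    next
      case (incl h)
      then consider a where "a \<in> carrier R" "h = frac R a (x [^] (0::nat))" | b where "b \<in> \<mm>" "h = frac R b (x [^] (1::nat))"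
        by (auto simp: to_frac_def)
      thus ?case
      proof cases
        case (1 a) thus ?thesis using frac_eq_high_frac[of a 0 0] by auto
      next
        case (2 b) thus ?thesis using frac_eq_high_frac[of b 1 0] pow_1 by (metis add.right_neutral imageI)
      qed
    next
      case (a_inv h)
      then obtain a where a: "a \<in> M r" "h = high_frac a" by blast
      have "\<ominus> a \<in> M r"
        using additive_subgroup.a_inv_closed[OF ideal.axioms(1)[OF pow_ideal] a(1)] .
      thus ?case using a high_frac_minus[OF pow_carrier[OF a(1)]] by auto
    next
      case (eng_add h1 h2)
      then obtain a b where a: "a \<in> M r" "h1 = high_frac a" "b \<in> M r" "h2 = high_frac b" by blast
      have "a \<oplus> b \<in> M r"
        using additive_subgroup.a_closed[OF ideal.axioms(1)[OF pow_ideal] a(1,3)] .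
      thus ?case using a high_frac_add[OF pow_carrier[OF a(1)] pow_carrier[OF a(3)]] by auto
    next
      case (eng_mult h1 h2)
      thus ?case using high_frac_mult[of _ _ 0] by auto
    qed
  qed
  have "frac R a (x [^] n) \<in> first_neighborhood R \<mm> x" if "a \<in> M n" for a n
    using that
  proof (induction n arbitrary: a)
    case 0
    thus ?case unfolding first_neighborhood_def by (intro generate_ring.incl) (auto simp: to_frac_def)
  next
    case (Suc n)
    hence "a \<in> \<mm> \<cdot> M n" by simp
    thus ?case
    proof induction
      case (prod i j)
      have ij: "i \<in> carrier R" "j \<in> carrier R" using prod pow_carrier ideal_carrier_subset[OF m_ideal] by auto
      have "frac R i x \<in> first_neighborhood R \<mm> x"
        unfolding first_neighborhood_def using prod(1) by (intro generate_ring.incl) auto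
      hence "frac R i x \<otimes>\<^bsub>K\<^esub> frac R j (x [^] n) \<in> first_neighborhood R \<mm> x"
        using Suc.IH[OF prod(2)] unfolding first_neighborhood_def by (rule generate_ring.eng_mult)
      thus ?case using ij by (simp add: frac_mult x_regular xpow_regular m_comm)
    next
      case (sum s1 s2)
      have "s1 \<in> carrier R" "s2 \<in> carrier R" using sum ideal_prod_in_carrier[OF m_ideal pow_ideal] by auto
      hence eq: "frac R (s1 \<oplus> s2) (x [^] Suc n) = frac R s1 (x [^] Suc n) \<oplus>\<^bsub>K\<^esub> frac R s2 (x [^] Suc n)"
        by (rule frac_add_same[OF _ _ xpow_regular, symmetric])
      show ?case using sum.IH unfolding eq first_neighborhood_def by (rule generate_ring.eng_add)
    qed
  qed
  thus "high_frac ` M r \<subseteq> first_neighborhood R \<mm> x" unfolding high_frac_def by blast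
qed

text \<open>In the first neighborhood ring \<open>A'\<close> the ideal \<open>\<mm>\<^sup>i A'\<close> consists of the \<open>a/x\<^sup>r\<close> with
\<open>a \<in> \<mm>\<^sup>i \<mm>\<^sup>r = \<mm>\<^sup>r\<^sup>+\<^sup>i\<close>.\<close>

lemma extended_power_eq:
  "Idl\<^bsub>K\<lparr>carrier := first_neighborhood R \<mm> x\<rparr>\<^esub> (to_frac R ` M i)
    = high_frac ` M (r + i)"
proof -
  let ?N = "K\<lparr>carrier := first_neighborhood R \<mm> x\<rparr>"
  let ?I = "high_frac ` M (r + i)"
  interpret K: cring K by (rule total_frac_cring)
  interpret N: ring ?N
    using K.generate_ring_is_ring[OF first_neighborhood_generators] by (simp add: first_neighborhood_def)
  have Isub: "?I \<subseteq> carrier ?N"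
    using pow_antimono[of r "r + i"] by (auto simp: first_neighborhood_eq)
  have Ncar: "carrier ?N \<subseteq> carrier K" using K.generate_ring_incl[OF first_neighborhood_generators]
    by (simp add: first_neighborhood_def)
  have comm: "p \<otimes>\<^bsub>K\<^esub> q = q \<otimes>\<^bsub>K\<^esub> p" if "p \<in> carrier ?N" "q \<in> carrier ?N" for p q
    using that Ncar by (intro K.m_comm) auto
  have absorb: "c \<otimes>\<^bsub>K\<^esub> p \<in> ?I" if "p \<in> ?I" "c \<in> carrier ?N" for p c
    using that high_frac_mult by (auto simp: first_neighborhood_eq)
  have I: "ideal ?I ?N"
  proof (rule idealI)
    show "ring ?N" by (rule N.ring_axioms)
    show "subgroup ?I (add_monoid ?N)"
    proof (rule N.add.subgroupI)
      show "?I \<subseteq> carrier ?N" by (rule Isub)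
      show "?I \<noteq> {}" using additive_subgroup.zero_closed[OF ideal.axioms(1)[OF pow_ideal]] by blast
      fix p assume p: "p \<in> ?I"
      then obtain a where a: "a \<in> M (r + i)" "p = high_frac a" by blast
      have ma: "\<ominus> a \<in> M (r + i)"
        using additive_subgroup.a_inv_closed[OF ideal.axioms(1)[OF pow_ideal] a(1)] .
      have "high_frac (\<ominus> a) \<oplus>\<^bsub>K\<^esub> high_frac a = \<zero>\<^bsub>K\<^esub>"
        using K.l_neg[OF high_frac_closed] high_frac_minus pow_carrier[OF a(1)] by simp
      hence "\<ominus>\<^bsub>?N\<^esub> p = high_frac (\<ominus> a)"
        using Isub ma p a by (intro N.minus_equality) auto
      thus "\<ominus>\<^bsub>?N\<^esub> p \<in> ?I" using ma by simp
      fix q assume "q \<in> ?I"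
      then obtain b where b: "b \<in> M (r + i)" "q = high_frac b" by blast
      have "a \<oplus> b \<in> M (r + i)"
        using additive_subgroup.a_closed[OF ideal.axioms(1)[OF pow_ideal] a(1) b(1)] .
      thus "p \<oplus>\<^bsub>?N\<^esub> q \<in> ?I" using a b high_frac_add[OF pow_carrier[OF a(1)] pow_carrier[OF b(1)]] by auto
    qed
    fix p c assume p: "p \<in> ?I" "c \<in> carrier ?N"
    show "c \<otimes>\<^bsub>?N\<^esub> p \<in> ?I" using absorb[OF p] by simp
    thus "p \<otimes>\<^bsub>?N\<^esub> c \<in> ?I" using comm[of p c] p Isub by auto
  qed
  have gen: "to_frac R ` M i \<subseteq> ?I"
    using xpow_mult_mem[of _ i r] to_frac_eq_high_frac[OF pow_carrier] by auto
  show ?thesis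
  proof
    show "Idl\<^bsub>?N\<^esub> (to_frac R ` M i) \<subseteq> ?I" by (rule N.genideal_minimal[OF I gen])
    have gen': "to_frac R ` M i \<subseteq> carrier ?N" using gen Isub by blast
    interpret G: ideal "Idl\<^bsub>?N\<^esub> (to_frac R ` M i)" ?N by (rule N.genideal_ideal[OF gen'])
    show "?I \<subseteq> Idl\<^bsub>?N\<^esub> (to_frac R ` M i)"
    proof (rule image_subsetI)
      fix a assume "a \<in> M (r + i)"
      hence "a \<in> M i \<cdot> M r" using pow_add[of i r] by (simp add: add.commute)
      thus "high_frac a \<in> Idl\<^bsub>?N\<^esub> (to_frac R ` M i)"
      proof induction
        case (prod b c)
        have "to_frac R b \<in> Idl\<^bsub>?N\<^esub> (to_frac R ` M i)"
          using N.genideal_self[OF gen'] prod(1) by blast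
        moreover have "high_frac c \<in> carrier ?N" using prod(2) by (simp add: first_neighborhood_eq)
        ultimately have "to_frac R b \<otimes>\<^bsub>?N\<^esub> high_frac c \<in> Idl\<^bsub>?N\<^esub> (to_frac R ` M i)"
          by (rule G.I_r_closed)
        thus ?case using to_frac_mult_high_frac[OF pow_carrier[OF prod(1)] pow_carrier[OF prod(2)]] by simp
      next
        case (sum s1 s2)
        have "s1 \<in> carrier R" "s2 \<in> carrier R" using sum ideal_prod_in_carrier[OF pow_ideal pow_ideal] by auto
        thus ?case using G.a_closed[OF sum.IH] high_frac_add by simp
      qed
    qed
  qed
qed

lemma neighborhood_filtration_eq:
  "neighborhood_filtration R \<mm> x i
    = high_frac ` (((x [^] r) <# carrier R) <+> M (r + i))"
proof -
  have "to_frac R a \<oplus>\<^bsub>K\<^esub> high_frac b = high_frac (x [^] r \<otimes> a \<oplus> b)"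
    if "a \<in> carrier R" "b \<in> M (r + i)" for a b
    using that(1) pow_carrier[OF that(2)] by (simp add: to_frac_eq_high_frac high_frac_add)
  thus ?thesis
    unfolding neighborhood_filtration_def extended_power_eq set_add_def' l_coset_def
    by (simp add: image_UN cong: SUP_cong)
qed

end

section \<open>Micro-invariants, Apery invariants and colon ideals\<close>

lemma (in ring) ideal_modular_law:
  assumes "ideal M R" "ideal N R" "ideal X R" "N \<subseteq> M"
  shows "M \<inter> (N <+> X) = (M \<inter> X) <+> N"
proof
  interpret M: ideal M R by fact
  interpret N: ideal N R by fact
  interpret X: ideal X R by fact
  note idMX = i_intersect[OF assms(1,3)]
  show "(M \<inter> X) <+> N \<subseteq> M \<inter> (N <+> X)"
    using ideal_add_upper[OF assms(2,3)] assms
    by (intro Int_greatest ideal_add_subset idMX add_ideals) auto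
  show "M \<inter> (N <+> X) \<subseteq> (M \<inter> X) <+> N"
  proof
    fix y assume y: "y \<in> M \<inter> (N <+> X)"
    then obtain n z where nz: "n \<in> N" "z \<in> X" "y = n \<oplus> z" by (auto simp: set_add_def')
    have c: "n \<in> carrier R" "z \<in> carrier R" using nz N.Icarr X.Icarr by auto
    have "z = \<ominus> n \<oplus> y" unfolding nz(3) using c by algebra
    moreover have "\<ominus> n \<oplus> y \<in> M" using y nz(1) assms(4) by (intro M.a_closed M.a_inv_closed) auto
    ultimately have "z \<in> M \<inter> X" using nz(2) by simp
    moreover have "y = z \<oplus> n" unfolding nz(3) using c by algebra
    ultimately show "y \<in> (M \<inter> X) <+> N" using nz(1) unfolding set_add_def' by blast
  qed
qed

locale noetherian_reduction = principal_reduction + noetherian_ring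
begin

declare ideal_pow.simps(2) [simp del]

abbreviation "xR \<equiv> x <# carrier R"

definition ell :: "'a set \<Rightarrow> 'a set \<Rightarrow> nat" where
  "ell U V = the_enat (ideal_length R U V)"

text \<open>Open in the \<open>\<mm>\<close>-adic topology. Quotients by such ideals have finite length, so that lengths
can be counted by natural numbers.\<close>

definition open_ideal :: "'a set \<Rightarrow> bool" where
  "open_ideal V \<longleftrightarrow> ideal V R \<and> (\<exists>n. M n \<subseteq> V)"

lemma open_idealI: "ideal V R \<Longrightarrow> M n \<subseteq> V \<Longrightarrow> open_ideal V"
  unfolding open_ideal_def by blast

lemma open_ideal_mono: "open_ideal V \<Longrightarrow> ideal W R \<Longrightarrow> V \<subseteq> W \<Longrightarrow> open_ideal W"
  unfolding open_ideal_def by blast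

text \<open>Each \<open>\<mm>\<^sup>n/\<mm>\<^sup>n\<^sup>+\<^sup>1\<close> is generated by finitely many elements and killed by \<open>\<mm>\<close>.\<close>

lemma pow_length_finite: "ideal_length R (carrier R) (M n) \<noteq> \<infinity>"
proof (induction n)
  case 0
  thus ?case by (simp add: ideal_length_self[OF oneideal])
next
  case (Suc n)
  obtain S where S: "S \<subseteq> carrier R" "finite S" "M n = Idl S"
    using finetely_gen[OF pow_ideal] by blast
  have SM: "S \<subseteq> M n" using genideal_self[OF S(1)] S(3) by simp
  have le: "M (Suc n) \<subseteq> M n" by (rule pow_antimono) simp
  have "Idl (M (Suc n) \<union> S) = M n"
  proof
    show "Idl (M (Suc n) \<union> S) \<subseteq> M n" using SM le by (intro genideal_minimal pow_ideal) auto
    show "M n \<subseteq> Idl (M (Suc n) \<union> S)"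
      unfolding S(3) using S(1) ideal_carrier_subset[OF pow_ideal[of "Suc n"]]
      by (intro subset_Idl_subset) auto
  qed
  moreover have "ideal_length R (Idl (M (Suc n) \<union> S)) (M (Suc n)) \<noteq> \<infinity>"
    using SM pow_Suc_mult by (intro ideal_length_generated_finite[OF max S(2,1) pow_ideal]) auto
  ultimately have "ideal_length R (M n) (M (Suc n)) \<noteq> \<infinity>" by simp
  moreover have "ideal_length R (carrier R) (M (Suc n)) = ideal_length R (carrier R) (M n) + ideal_length R (M n) (M (Suc n))"
    using le ideal_carrier_subset[OF pow_ideal] by (intro ideal_length_add pow_ideal oneideal)
  ultimately show ?case using Suc by (simp add: plus_eq_infty_iff_enat)
qed

lemma length_finite:
  assumes V: "open_ideal V" and U: "ideal U R" "V \<subseteq> U"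
  shows "ideal_length R U V \<noteq> \<infinity>"
proof -
  obtain n where V': "ideal V R" "M n \<subseteq> V" using V unfolding open_ideal_def by blast
  have "ideal_length R (carrier R) (M n) = ideal_length R (carrier R) U + ideal_length R U (M n)"
    using V' U ideal_carrier_subset[OF U(1)] by (intro ideal_length_add pow_ideal oneideal) auto
  moreover have "ideal_length R U (M n) = ideal_length R U V + ideal_length R V (M n)"
    using V' U by (intro ideal_length_add pow_ideal) auto
  ultimately show ?thesis using pow_length_finite[of n] by (auto simp: plus_eq_infty_iff_enat)
qed

lemma ell_add:
  assumes "open_ideal V" "ideal W R" "ideal U R" "V \<subseteq> W" "W \<subseteq> U"
  shows "ell U V = ell U W + ell W V"
proof -
  have V: "ideal V R" using assms(1) by (simp add: open_ideal_def)
  have "ideal_length R U V = ideal_length R U W + ideal_length R W V"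
    using ideal_length_add[OF V assms(2,3,4,5)] .
  moreover have "ideal_length R U W \<noteq> \<infinity>" "ideal_length R W V \<noteq> \<infinity>"
    using length_finite assms open_ideal_mono by blast+
  ultimately show ?thesis unfolding ell_def by auto
qed

lemma ell_second_iso: "ideal U R \<Longrightarrow> ideal W R \<Longrightarrow> ell (U <+> W) W = ell U (U \<inter> W)"
  unfolding ell_def by (simp add: ideal_length_second_iso)

lemma ell_mult:
  "y \<in> regular_elements R \<Longrightarrow> ideal U R \<Longrightarrow> ideal V R \<Longrightarrow> V \<subseteq> U \<Longrightarrow> ell (y <# U) (y <# V) = ell U V"
  unfolding ell_def by (simp add: ideal_length_mult)

lemma quot_length_eq_ell:
  "ideal V R \<Longrightarrow> ideal U R \<Longrightarrow> V \<subseteq> U \<Longrightarrow> quot_length R (self_module R) U V = ell U V"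
  unfolding ell_def by (rule quot_length_self_module)

text \<open>This is the filtration \<open>(\<mm>\<^sup>r : x\<^sup>r\<^sup>-\<^sup>i)\<close> from the definition of \<open>g\<^sub>i\<close>, written uniformly in \<open>i\<close> so
that the case \<open>i = r + 1\<close> is included; see \<open>D_eq_colon\<close> and \<open>D_Suc_r\<close>.\<close>

definition D :: "nat \<Rightarrow> 'a set" where
  "D i = colon R (M (r + i)) (x [^] r)"

lemma D_ideal: "ideal (D i) R"
  unfolding D_def by (intro ideal_colon pow_ideal) simp

lemma mem_D: "a \<in> D i \<longleftrightarrow> a \<in> carrier R \<and> x [^] r \<otimes> a \<in> M (r + i)"
  by (auto simp: D_def colon_def)

lemma D_antimono: "D (Suc i) \<subseteq> D i"
  unfolding D_def by (intro colon_mono pow_antimono) simp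

lemma pow_le_D: "M i \<subseteq> D i"
  using xpow_mult_mem[of _ i r] pow_carrier by (auto simp: mem_D)

lemma D_eq_colon: 
  assumes "i \<le> r"
  shows "D i = colon R (M r) (x [^] (r - i))"
proof -
  have "x [^] r \<otimes> a \<in> M (r + i) \<longleftrightarrow> x [^] (r - i) \<otimes> a \<in> M r" if a: "a \<in> carrier R" for a
  proof -
    have "x [^] r \<otimes> a = x [^] i \<otimes> (x [^] (r - i) \<otimes> a)"
      using a assms by (simp add: m_assoc[symmetric] nat_pow_mult)
    moreover have "M (r + i) = (x [^] i) <# M r"
      using pow_reduction_iter[of r i] by (simp add: add.commute)
    ultimately show ?thesis
      using mem_lcoset_regular[OF xpow_regular _ ideal_carrier_subset[OF pow_ideal]] a by simp
  qed
  thus ?thesis by (auto simp: D_def colon_def)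
qed

text \<open>This justifies the convention \<open>(\<mm>\<^sup>r : x\<^sup>-\<^sup>1) = \<mm>\<^sup>r\<^sup>+\<^sup>1\<close>.\<close>

lemma D_Suc_r: "D (Suc r) = M (Suc r)"
proof -
  have eq: "M (r + Suc r) = (x [^] r) <# M (Suc r)"
    using pow_reduction_iter[of "Suc r" r] by simp
  show ?thesis
    unfolding D_def eq by (rule colon_lcoset[OF xpow_regular ideal_carrier_subset[OF pow_ideal]])
qed

lemma x_mult_mem_D: "a \<in> carrier R \<Longrightarrow> x \<otimes> a \<in> D (Suc i) \<longleftrightarrow> a \<in> D i"
proof -
  assume a: "a \<in> carrier R"
  have "x [^] r \<otimes> (x \<otimes> a) = x \<otimes> (x [^] r \<otimes> a)" using a by (simp add: m_lcomm)
  moreover have "M (r + Suc i) = x <# M (r + i)" using pow_reduction[of i] by simp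
  ultimately show ?thesis
    using mem_lcoset_regular[OF x_regular _ ideal_carrier_subset[OF pow_ideal], of "x [^] r \<otimes> a"] a
    by (simp add: mem_D)
qed

lemma pow_Int_lcoset: "M (r + i) \<inter> ((x [^] r) <# carrier R) = (x [^] r) <# D i"
  by (auto simp: l_coset_def mem_D)

text \<open>The ideal \<open>x\<^sup>r (A + \<mm>\<^sup>i A')\<close> of \<open>A\<close>, where \<open>A'\<close> is the first neighborhood ring.\<close>

definition Nbhd :: "nat \<Rightarrow> 'a set" where
  "Nbhd i = ((x [^] r) <# carrier R) <+> M (r + i)"

lemma xr_ideal: "ideal ((x [^] r) <# carrier R) R"
  by (intro ideal_lcoset oneideal) simp

lemma Nbhd_ideal: "ideal (Nbhd i) R"
  unfolding Nbhd_def by (intro add_ideals xr_ideal pow_ideal)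

lemma Nbhd_antimono: "Nbhd (Suc i) \<subseteq> Nbhd i"
  unfolding Nbhd_def
  using ideal_add_upper[OF xr_ideal pow_ideal, of "r + i"] pow_antimono[of "r + i" "r + Suc i"]
  by (intro ideal_add_subset add_ideals xr_ideal pow_ideal) auto

lemma filtration_length:
  "quot_length R (total_frac_module R) (neighborhood_filtration R \<mm> x i) (neighborhood_filtration R \<mm> x (Suc i))
    = ell (Nbhd i) (Nbhd (Suc i))"
  unfolding neighborhood_filtration_eq Nbhd_def[symmetric] ell_def
proof (rule quot_length_embedding[OF Nbhd_ideal Nbhd_ideal Nbhd_antimono])
  have sub: "Nbhd i \<subseteq> carrier R" by (rule ideal_carrier_subset[OF Nbhd_ideal])
  show "inj_on high_frac (Nbhd i)" using high_frac_inj sub by (rule inj_on_subset)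
  fix a assume a: "a \<in> Nbhd i"
  { fix b assume "b \<in> Nbhd i"
    thus "high_frac (a \<oplus> b) = high_frac a \<oplus>\<^bsub>total_frac_module R\<^esub> high_frac b"
      using a sub high_frac_add by (auto simp: total_frac_module_def) }
  fix c assume "c \<in> carrier R"
  thus "high_frac (c \<otimes> a) = c \<odot>\<^bsub>total_frac_module R\<^esub> high_frac a"
    using a sub to_frac_mult_high_frac by (auto simp: total_frac_module_def)
qed

text \<open>The quotient of \<open>\<mm>\<^sup>r\<^sup>+\<^sup>i\<close> by \<open>\<mm>\<^sup>r\<^sup>+\<^sup>i\<^sup>+\<^sup>1\<close> has the same length for all \<open>i\<close>. It splits into its image modulo
\<open>x\<^sup>r A\<close>, which is a step of the filtration of \<open>A + \<mm>\<^sup>i A'\<close>, and its trace on \<open>x\<^sup>r A\<close>. As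
\<open>\<mm>\<^sup>r\<^sup>+\<^sup>i \<inter> x\<^sup>r A = x\<^sup>r D i\<close>, the trace is a step of the filtration by the ideals \<open>D i\<close>.\<close>

lemma filtration_step_length: "ell (Nbhd i) (Nbhd (Suc i)) + ell (D i) (D (Suc i)) = ell (M r) (M (Suc r))"
proof -
  let ?X = "(x [^] r) <# carrier R"
  let ?A = "M (r + i)" and ?B = "M (r + Suc i)"
  have le: "?B \<subseteq> ?A" by (rule pow_antimono) simp
  have iA: "ideal ?A R" and iB: "ideal ?B R" by (rule pow_ideal)+
  note ups = ideal_add_upper[OF xr_ideal iA] ideal_add_upper[OF xr_ideal iB]
  let ?Y = "?A \<inter> Nbhd (Suc i)"
  have Y: "ideal ?Y R" using i_intersect[OF iA Nbhd_ideal] .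
  have Y_eq: "?Y = (?A \<inter> ?X) <+> ?B"
    unfolding Nbhd_def set_add_comm[OF ideal_carrier_subset[OF xr_ideal] ideal_carrier_subset[OF iB]]
    by (rule ideal_modular_law[OF iA iB xr_ideal le])
  have "ell ?A ?B = ell ?A ?Y + ell ?Y ?B"
    using le ups(4) open_idealI[OF iB order.refl] by (intro ell_add iA Y) (auto simp: Nbhd_def)
  moreover have "?A <+> Nbhd (Suc i) = Nbhd i"
  proof
    show "?A <+> Nbhd (Suc i) \<subseteq> Nbhd i"
      using ups(2) Nbhd_antimono by (intro ideal_add_subset iA Nbhd_ideal) (auto simp: Nbhd_def)
    show "Nbhd i \<subseteq> ?A <+> Nbhd (Suc i)"
      unfolding Nbhd_def[of i]
      using ideal_add_upper[OF iA Nbhd_ideal, of "Suc i"] ups(3)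
      by (intro ideal_add_subset xr_ideal iA add_ideals Nbhd_ideal) (auto simp: Nbhd_def)
  qed
  hence "ell ?A ?Y = ell (Nbhd i) (Nbhd (Suc i))"
    using ell_second_iso[OF iA Nbhd_ideal, of "Suc i"] by simp
  moreover have "ell ?Y ?B = ell (D i) (D (Suc i))"
  proof -
    have "ell ?Y ?B = ell (?A \<inter> ?X) (?A \<inter> ?X \<inter> ?B)"
      unfolding Y_eq by (rule ell_second_iso[OF i_intersect[OF iA xr_ideal] iB])
    also have "?A \<inter> ?X \<inter> ?B = ?B \<inter> ?X" using le by blast
    finally show ?thesis
      unfolding pow_Int_lcoset by (simp add: ell_mult xpow_regular D_ideal D_antimono)
  qed
  moreover have "ell ?A ?B = ell (M r) (M (Suc r))"
  proof -
    have "?A = (x [^] i) <# M r" "?B = (x [^] i) <# M (Suc r)"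
      using pow_reduction_iter[of r i] pow_reduction_iter[of "Suc r" i] by (simp_all add: ac_simps)
    thus ?thesis using pow_antimono[of r "Suc r"] by (simp only: ell_mult xpow_regular pow_ideal)
  qed
  ultimately show ?thesis by simp
qed

text \<open>In the difference of two consecutive steps, the constant length of \<open>\<mm>\<^sup>r/\<mm>\<^sup>r\<^sup>+\<^sup>1\<close> cancels.\<close>

lemma micro_invariant_eq:
  "micro_invariant R \<mm> x (Suc k) = int (ell (D (Suc k)) (D (Suc (Suc k)))) - int (ell (D k) (D (Suc k)))"
  using filtration_step_length[of k] filtration_step_length[of "Suc k"]
  unfolding micro_invariant_def by (simp add: filtration_length)

text \<open>For \<open>i < r\<close>, the image of \<open>E i\<close> in \<open>\<mm>\<^sup>i/\<mm>\<^sup>i\<^sup>+\<^sup>1\<close> is the kernel of multiplication by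
\<open>(x\<^sup>*)\<^sup>r\<^sup>-\<^sup>1\<^sup>-\<^sup>i\<close> in the tangent cone.\<close>

definition E :: "nat \<Rightarrow> 'a set" where
  "E i = M i \<inter> D (Suc i)"

lemma E_ideal: "ideal (E i) R"
  unfolding E_def by (rule i_intersect[OF pow_ideal D_ideal])

lemma pow_Suc_le_E: "M (Suc i) \<subseteq> E i"
  unfolding E_def using pow_le_D[of "Suc i"] pow_antimono[of i "Suc i"] by auto

lemma xM_ideal: "ideal (x <# M k) R"
  by (intro ideal_lcoset pow_ideal) simp

lemma xM_subset: "x <# M k \<subseteq> M (Suc k)"
  using pow_Suc_mult[OF x_in] by (auto simp: l_coset_def)

text \<open>With \<open>i = k + 1\<close>, this is the dimension of the part of \<open>G\<^sub>i / x\<^sup>* G\<^sub>i\<^sub>-\<^sub>1\<close> that is generated by elements of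
\<open>G\<^sub>i\<close> killed by \<open>(x\<^sup>*)\<^sup>r\<^sup>-\<^sup>1\<^sup>-\<^sup>i\<close> (if \<open>i < r\<close>), where \<open>G\<close> is the tangent cone.
It is the only term in the identity that is read off from the structure of \<open>G\<close> as a module.\<close>

definition generator_gap :: "nat \<Rightarrow> nat" where
  "generator_gap k = ell ((x <# M k) <+> E (Suc k)) ((x <# M k) <+> M (Suc (Suc k)))"

lemma D_length: "ell (D i) (D (Suc i)) = ell (D i) (M i <+> D (Suc i)) + ell (M i) (E i)"
proof -
  have "ell (D i) (D (Suc i)) = ell (D i) (M i <+> D (Suc i)) + ell (M i <+> D (Suc i)) (D (Suc i))"
    using ideal_add_upper[OF pow_ideal[of i] D_ideal[of "Suc i"]] pow_le_D D_antimono
    by (intro ell_add open_idealI[OF D_ideal pow_le_D] add_ideals pow_ideal D_ideal ideal_add_subset) auto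
  thus ?thesis unfolding E_def by (simp add: ell_second_iso pow_ideal D_ideal)
qed

lemma xM_Int_E: "(x <# M k) \<inter> E (Suc k) = x <# E k"
proof -
  have "x \<otimes> a \<in> E (Suc k) \<longleftrightarrow> a \<in> D (Suc k)" if "a \<in> M k" for a
    using x_mult_mem_D[OF pow_carrier[OF that], of "Suc k"] pow_Suc_mult[OF x_in that] by (simp add: E_def)
  thus ?thesis unfolding E_def[of k] l_coset_def by blast
qed

text \<open>Multiplication by \<open>x\<close> embeds \<open>\<mm>\<^sup>k / E k\<close> into \<open>\<mm>\<^sup>k\<^sup>+\<^sup>1 / E (k+1)\<close>, because \<open>x a \<in> D (i+1)\<close> is equivalent to
\<open>a \<in> D i\<close>.\<close>

lemma E_length:
  "ell (M (Suc k)) (E (Suc k)) = ell (M (Suc k)) ((x <# M k) <+> E (Suc k)) + ell (M k) (E k)"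
proof -
  have EM: "E i \<subseteq> M i" for i by (simp add: E_def)
  have "ell (M (Suc k)) (E (Suc k)) = ell (M (Suc k)) ((x <# M k) <+> E (Suc k))
      + ell ((x <# M k) <+> E (Suc k)) (E (Suc k))"
    using ideal_add_upper[OF xM_ideal[of k] E_ideal[of "Suc k"]] xM_subset[of k] EM[of "Suc k"]
    by (intro ell_add open_idealI[OF E_ideal pow_Suc_le_E] add_ideals xM_ideal E_ideal pow_ideal ideal_add_subset) auto
  also have "ell ((x <# M k) <+> E (Suc k)) (E (Suc k)) = ell (M k) (E k)"
    using EM by (simp add: ell_second_iso xM_ideal E_ideal xM_Int_E ell_mult x_regular pow_ideal)
  finally show ?thesis .
qed

lemma xR_ideal: "ideal xR R"
  by (intro ideal_lcoset oneideal) simp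

text \<open>Both invariants are lengths of consecutive quotients in the chain
\<open>\<mm>\<^sup>i \<supseteq> (\<mm>\<^sup>i \<inter> x A) + \<mm>\<^sup>i\<^sup>+\<^sup>1 \<supseteq> x \<mm>\<^sup>i\<^sup>-\<^sup>1 + \<mm>\<^sup>i\<^sup>+\<^sup>1\<close>, where \<open>i = k + 1\<close>. The total is the number of minimal generators of the
tangent cone in degree \<open>i\<close> as a module over the fiber cone.\<close>

lemma apery_nu_length:
  "apery_invariant R \<mm> x (Suc k) + nu_invariant R \<mm> x (Suc k)
    = ell (M (Suc k)) ((x <# M k) <+> M (Suc (Suc k)))"
proof -
  let ?A = "M (Suc k)" and ?B = "M (Suc (Suc k))"
  have le: "?B \<subseteq> ?A" by (rule pow_antimono) simp
  have iA: "ideal ?A R" and iB: "ideal ?B R" by (rule pow_ideal)+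
  have iAX: "ideal (?A \<inter> xR) R" using i_intersect[OF iA xR_ideal] .
  let ?W = "?B <+> xR" and ?Y = "(?A \<inter> xR) <+> ?B" and ?Z = "(x <# M k) <+> ?B"
  have iW: "ideal ?W R" and iY: "ideal ?Y R" and iZ: "ideal ?Z R" and iAW: "ideal (?A <+> xR) R"
    by (intro add_ideals iA iB xR_ideal iAX xM_ideal)+
  have xMX: "x <# M k \<subseteq> ?A \<inter> xR"
    using xM_subset lcoset_mono[OF ideal_carrier_subset[OF pow_ideal]] by blast
  note up = ideal_add_upper[OF iB xR_ideal] ideal_add_upper[OF iA xR_ideal] ideal_add_upper[OF iAX iB]
    ideal_add_upper[OF xM_ideal iB, of k]
  have WA: "?W \<subseteq> ?A <+> xR" using le up by (intro ideal_add_subset iAW iB xR_ideal) auto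
  have AW: "?A <+> ?W = ?A <+> xR"
  proof
    show "?A <+> ?W \<subseteq> ?A <+> xR" by (intro ideal_add_subset[OF iA iW iAW] WA up)
    show "?A <+> xR \<subseteq> ?A <+> ?W"
      using ideal_add_upper[OF iA iW] up by (intro ideal_add_subset add_ideals iA xR_ideal iW) auto
  qed
  have "apery_invariant R \<mm> x (Suc k) = ell (?A <+> xR) ?W"
    using quot_length_eq_ell[OF iW iAW WA] by (simp add: apery_invariant_def)
  also have "\<dots> = ell ?A (?A \<inter> ?W)" using ell_second_iso[OF iA iW] AW by simp
  also have "?A \<inter> ?W = ?Y" by (rule ideal_modular_law[OF iA iB xR_ideal le])
  finally have gamma: "apery_invariant R \<mm> x (Suc k) = ell ?A ?Y" .
  have ZY: "?Z \<subseteq> ?Y" using xMX up by (intro ideal_add_subset xM_ideal iB iY) auto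
  have nu: "nu_invariant R \<mm> x (Suc k) = ell ?Y ?Z"
    using quot_length_eq_ell[OF iZ iY ZY] by (simp add: nu_invariant_def)
  have "?Y \<subseteq> ?A" using le by (intro ideal_add_subset iAX iB iA) auto
  hence "ell ?A ?Z = ell ?A ?Y + ell ?Y ?Z"
    using up ZY by (intro ell_add open_idealI[OF iZ, of "Suc (Suc k)"] iY iA) auto
  thus ?thesis using gamma nu by simp
qed

lemma gap_length:
  "ell (M (Suc k)) ((x <# M k) <+> M (Suc (Suc k)))
    = ell (M (Suc k)) ((x <# M k) <+> E (Suc k)) + generator_gap k"
  unfolding generator_gap_def
proof (rule ell_add)
  note up = ideal_add_upper[OF xM_ideal[of k] pow_ideal[of "Suc (Suc k)"]]
    ideal_add_upper[OF xM_ideal[of k] E_ideal[of "Suc k"]]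
  show "open_ideal ((x <# M k) <+> M (Suc (Suc k)))"
    using up by (intro open_idealI[of _ "Suc (Suc k)"] add_ideals xM_ideal pow_ideal)
  show "(x <# M k) <+> M (Suc (Suc k)) \<subseteq> (x <# M k) <+> E (Suc k)"
    using up pow_Suc_le_E[of "Suc k"] by (intro ideal_add_subset add_ideals xM_ideal pow_ideal E_ideal) auto
  show "(x <# M k) <+> E (Suc k) \<subseteq> M (Suc k)"
    using xM_subset by (intro ideal_add_subset xM_ideal pow_ideal E_ideal) (auto simp: E_def)
qed (intro add_ideals xM_ideal E_ideal pow_ideal)+

lemma g_invariant_eq:
  assumes r: "r = reduction_number R \<mm> x" and i: "i \<le> r"
  shows "g_invariant R \<mm> x i = ell (D i) (M i <+> D (Suc i))"
proof -
  have "(if i = r then M (r + 1) else colon R (M r) (x [^] (r - i - 1))) = D (Suc i)"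
    using D_Suc_r D_eq_colon[of "Suc i"] i by auto
  moreover have "M i <+> D (Suc i) \<subseteq> D i"
    using pow_le_D D_antimono by (intro ideal_add_subset pow_ideal D_ideal)
  ultimately show ?thesis
    unfolding g_invariant_def Let_def r[symmetric] D_eq_colon[OF i, symmetric]
    by (simp add: quot_length_eq_ell add_ideals pow_ideal D_ideal del: ideal_pow.simps)
qed

text \<open>Splitting \<open>D i \<supseteq> \<mm>\<^sup>i + D (i+1) \<supseteq> D (i+1)\<close> gives \<open>\<beta>\<^sub>i = g\<^sub>i - g\<^sub>i\<^sub>-\<^sub>1\<close> plus the difference of the lengths of
\<open>\<mm>\<^sup>i/E i\<close> and \<open>\<mm>\<^sup>i\<^sup>-\<^sup>1/E (i-1)\<close>. By \<open>E_length\<close> this difference is the length of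
\<open>\<mm>\<^sup>i/(x \<mm>\<^sup>i\<^sup>-\<^sup>1 + E i)\<close>, which together with the gap makes up \<open>\<gamma>\<^sub>i + \<nu>\<^sub>i\<close>.\<close>

theorem micro_apery_balance:
  assumes r: "r = reduction_number R \<mm> x" and k: "Suc k \<le> r"
  shows "micro_invariant R \<mm> x (Suc k) + int (generator_gap k)
    = int (apery_invariant R \<mm> x (Suc k)) + int (nu_invariant R \<mm> x (Suc k))
      + int (g_invariant R \<mm> x (Suc k)) - int (g_invariant R \<mm> x k)"
  using micro_invariant_eq[of k] D_length[of k] D_length[of "Suc k"] E_length[of k] gap_length[of k]
    apery_nu_length[of k] g_invariant_eq[OF r, of k] g_invariant_eq[OF r k] k
  by linarith

end

section \<open>Associated graded modules\<close>

definition homog :: "('a, 'c) ring_scheme \<Rightarrow> (nat \<Rightarrow> 'a set) \<Rightarrow> nat \<Rightarrow> 'a \<Rightarrow> nat \<Rightarrow> 'a set" where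
  "homog R J n a = (\<lambda>k. if k = n then J n +>\<^bsub>R\<^esub> a else J k)"

lemma (in ring) finsum_coset_cong:
  assumes K: "ideal K R" and "finite A"
    and "\<And>k. k \<in> A \<Longrightarrow> u k \<in> carrier R" "\<And>k. k \<in> A \<Longrightarrow> v k \<in> carrier R"
    and "\<And>k. k \<in> A \<Longrightarrow> K +> u k = K +> v k"
  shows "K +> finsum R u A = K +> finsum R v A"
  using assms(2-)
proof (induction A)
  case (insert k A)
  have c: "u k \<in> carrier R" "v k \<in> carrier R" "finsum R u A \<in> carrier R" "finsum R v A \<in> carrier R"
    using insert.prems by (auto intro!: finsum_closed)
  have ins: "finsum R u (insert k A) = u k \<oplus> finsum R u A" "finsum R v (insert k A) = v k \<oplus> finsum R v A"
    using insert.hyps insert.prems by (auto intro!: finsum_insert)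
  have "K +> finsum R u (insert k A) = (K +> u k) <+> (K +> finsum R u A)"
    unfolding ins by (rule ideal.a_rcos_sum[OF K c(1,3), symmetric])
  also have "\<dots> = (K +> v k) <+> (K +> finsum R v A)"
    using insert.prems insert.IH by simp
  also have "\<dots> = K +> finsum R v (insert k A)"
    unfolding ins by (rule ideal.a_rcos_sum[OF K c(2,4)])
  finally show ?case .
qed simp

lemma (in ring) finsum_one_term:
  assumes "finite A" "i \<in> A" "u i \<in> carrier R" "\<And>k. k \<in> A \<Longrightarrow> k \<noteq> i \<Longrightarrow> u k = \<zero>"
  shows "finsum R u A = u i"
proof -
  have "finsum R u A = (\<Oplus>k\<in>A. if i = k then u k else \<zero>)"
    using assms by (intro finsum_cong') auto
  also have "\<dots> = u i"
  proof -
    have "(\<lambda>k. u k) \<in> A \<rightarrow> carrier R" using assms by (metis Pi_I zero_closed)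
    thus ?thesis using add.finprod_singleton[OF assms(2,1)] by simp
  qed
  finally show ?thesis .
qed

text \<open>The product is a union over all representatives; under the inclusions \<open>IJ\<close> and \<open>JI\<close> all of them give
the same coset, so that one choice of representatives suffices.\<close>

lemma (in cring) assoc_mult_eq:
  assumes J: "\<And>n. ideal (J n) R" and J': "\<And>n. ideal (J' n) R"
    and c: "\<And>k. c k \<in> I k" "\<And>k. f k = J k +> c k"
    and d: "\<And>k. d k \<in> I' k" "\<And>k. g k = J' k +> d k"
    and car: "\<And>k. I k \<subseteq> carrier R" "\<And>k. I' k \<subseteq> carrier R" "\<And>k. J' k \<subseteq> I' k"
    and IJ: "\<And>p q a b. a \<in> I p \<Longrightarrow> b \<in> J' q \<Longrightarrow> a \<otimes> b \<in> J' (p + q)"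
    and JI: "\<And>p q a b. a \<in> J p \<Longrightarrow> b \<in> I' q \<Longrightarrow> a \<otimes> b \<in> J' (p + q)"
    and I': "\<And>q. ideal (I' q) R"
  shows "assoc_mult R J' f g n = J' n +> (\<Oplus>k\<in>{..n}. c k \<otimes> d (n - k))"
proof -
  have cc: "c k \<in> carrier R" and dc: "d k \<in> carrier R" for k using c(1) d(1) car by blast+
  have step: "J' n +> (\<Oplus>k\<in>{..n}. c' k \<otimes> d' (n - k)) = J' n +> (\<Oplus>k\<in>{..n}. c k \<otimes> d (n - k))"
    if c': "\<And>k. c' k \<in> f k" and d': "\<And>k. d' k \<in> g k" for c' d'
  proof (rule finsum_coset_cong[OF J'])
    fix k assume k: "k \<in> {..n}"
    obtain j where j: "j \<in> J k" "c' k = j \<oplus> c k" using c'[of k] c(2) by (auto simp: a_r_coset_def')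
    obtain j' where j': "j' \<in> J' (n - k)" "d' (n - k) = j' \<oplus> d (n - k)"
      using d'[of "n - k"] d(2) by (auto simp: a_r_coset_def')
    have jc: "j \<in> carrier R" "j' \<in> carrier R" using j(1) j'(1) J J' ideal_carrier_subset by blast+
    show "c' k \<otimes> d' (n - k) \<in> carrier R" "c k \<otimes> d (n - k) \<in> carrier R" using j j' jc cc dc by auto
    have e1: "j \<otimes> d' (n - k) \<in> J' n"
    proof -
      have "d' (n - k) \<in> I' (n - k)" unfolding j'(2)
        using j'(1) car(3) d(1) additive_subgroup.a_closed[OF ideal.axioms(1)[OF I']] by blast
      thus ?thesis using JI[OF j(1)] k by fastforce
    qed
    have e2: "c k \<otimes> j' \<in> J' n" using IJ[OF c(1)[of k] j'(1)] k by simp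
    have "c' k \<otimes> d' (n - k) \<ominus> c k \<otimes> d (n - k) = j \<otimes> d' (n - k) \<oplus> c k \<otimes> j'"
      unfolding j(2) j'(2) using jc cc[of k] dc[of "n - k"] by algebra
    also have "\<dots> \<in> J' n" using additive_subgroup.a_closed[OF ideal.axioms(1)[OF J'] e1 e2] .
    finally show "J' n +> c' k \<otimes> d' (n - k) = J' n +> c k \<otimes> d (n - k)"
      using quotient_eq_iff_same_a_r_cos[OF J'] \<open>c' k \<otimes> d' (n - k) \<in> carrier R\<close> \<open>c k \<otimes> d (n - k) \<in> carrier R\<close>
      by blast
  qed simp
  have self: "a \<in> K +> a" if "ideal K R" "a \<in> carrier R" for a K
    using that by (rule abelian_subgroup.a_rcos_self[OF abelian_subgroupI3[OF ideal.axioms(1) is_abelian_group]])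
  \<comment> \<open>The union is over a nonempty set.\<close>
  have c0: "c \<in> {c'. \<forall>k. c' k \<in> f k}" "d \<in> {d'. \<forall>k. d' k \<in> g k}"
    using c(2) d(2) self[OF J cc] self[OF J' dc] by auto
  have "assoc_mult R J' f g n = (\<Union>c'\<in>{c'. \<forall>k. c' k \<in> f k}. \<Union>d'\<in>{d'. \<forall>k. d' k \<in> g k}.
      J' n +> (\<Oplus>k\<in>{..n}. c k \<otimes> d (n - k)))"
    unfolding assoc_mult_def using step by (intro SUP_cong refl) auto
  also have "\<dots> = J' n +> (\<Oplus>k\<in>{..n}. c k \<otimes> d (n - k))"
    using c0 by blast
  finally show ?thesis .
qed

locale graded_quotient = cring R for R (structure) +
  fixes I J :: "nat \<Rightarrow> 'a set"
  assumes I_ideal: "ideal (I n) R" and J_ideal: "ideal (J n) R" and J_le: "J n \<subseteq> I n"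
begin

lemma I_carrier: "a \<in> I n \<Longrightarrow> a \<in> carrier R"
  using ideal_carrier_subset[OF I_ideal] by blast

lemma J_coset_eq_iff:
  "a \<in> carrier R \<Longrightarrow> b \<in> carrier R \<Longrightarrow> J n +> a = J n +> b \<longleftrightarrow> a \<ominus> b \<in> J n"
  using quotient_eq_iff_same_a_r_cos[OF J_ideal] by blast

lemma J_coset_zero: "J n +> \<zero> = J n"
  using a_rcos_zero[OF J_ideal] additive_subgroup.zero_closed[OF ideal.axioms(1)[OF J_ideal]] by blast

lemma J_coset_eq_J_iff: "a \<in> carrier R \<Longrightarrow> J n +> a = J n \<longleftrightarrow> a \<in> J n"
  using J_coset_eq_iff[of a \<zero> n] by (simp add: J_coset_zero minus_eq)

lemma J_coset_add:
  "a \<in> carrier R \<Longrightarrow> b \<in> carrier R \<Longrightarrow> (J n +> a) <+> (J n +> b) = J n +> (a \<oplus> b)"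
  by (rule ideal.a_rcos_sum[OF J_ideal])

lemma mem_assoc_carrier:
  "f \<in> assoc_carrier R I J \<longleftrightarrow> (\<forall>n. \<exists>a\<in>I n. f n = J n +> a) \<and> finite {n. f n \<noteq> J n}"
  by (auto simp: assoc_carrier_def A_RCOSETS_def' a_r_coset_def')

lemma homog_zero: "homog R J n \<zero> = J"
  by (auto simp: homog_def J_coset_zero fun_eq_iff)

lemma homog_eq_iff:
  "a \<in> carrier R \<Longrightarrow> b \<in> carrier R \<Longrightarrow> homog R J n a = homog R J n b \<longleftrightarrow> a \<ominus> b \<in> J n"
  using J_coset_eq_iff[of a b n] by (auto simp: homog_def fun_eq_iff)

lemma homog_eq_zero_iff: "a \<in> carrier R \<Longrightarrow> homog R J n a = J \<longleftrightarrow> a \<in> J n"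
  using J_coset_eq_J_iff[of a n] by (auto simp: homog_def fun_eq_iff)

lemma homog_carrier: "a \<in> I n \<Longrightarrow> homog R J n a \<in> assoc_carrier R I J"
  unfolding mem_assoc_carrier
proof (intro conjI allI)
  assume a: "a \<in> I n"
  fix k show "\<exists>b\<in>I k. homog R J n a k = J k +> b"
  proof (cases "k = n")
    case True
    thus ?thesis using a by (auto simp: homog_def)
  next
    case False
    thus ?thesis using J_coset_zero[of k] additive_subgroup.zero_closed[OF ideal.axioms(1)[OF I_ideal]]
      by (intro bexI[of _ \<zero>]) (auto simp: homog_def)
  qed
  have "{k. homog R J n a k \<noteq> J k} \<subseteq> {n}" by (auto simp: homog_def)
  thus "finite {k. homog R J n a k \<noteq> J k}" by (rule finite_subset) simp
qed

lemma component_eq: "component (assoc_graded R I J) n = homog R J n ` I n"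
proof
  show "homog R J n ` I n \<subseteq> component (assoc_graded R I J) n"
    using homog_carrier by (auto simp: assoc_graded_def homog_def)
  show "component (assoc_graded R I J) n \<subseteq> homog R J n ` I n"
  proof
    fix f assume f: "f \<in> component (assoc_graded R I J) n"
    then obtain a where "a \<in> I n" "f n = J n +> a"
      unfolding assoc_graded_def mem_assoc_carrier by simp blast
    moreover from this have "f = homog R J n a" using f by (auto simp: assoc_graded_def homog_def fun_eq_iff)
    ultimately show "f \<in> homog R J n ` I n" by blast
  qed
qed

lemma homog_add:
  assumes "a \<in> carrier R" "b \<in> carrier R"
  shows "homog R J n a \<oplus>\<^bsub>assoc_graded R I J\<^esub> homog R J n b = homog R J n (a \<oplus> b)"
proof -
  have "J k <+> J k = J k" for k using J_coset_add[of \<zero> \<zero> k] by (simp add: J_coset_zero)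
  thus ?thesis using J_coset_add[OF assms] by (auto simp: assoc_graded_def homog_def fun_eq_iff)
qed

lemma assoc_repr:
  assumes "f \<in> assoc_carrier R I J"
  obtains c where "\<And>n. c n \<in> I n" "\<And>n. f n = J n +> c n"
  using assms unfolding mem_assoc_carrier by metis

lemma add_eq: "(f \<oplus>\<^bsub>assoc_graded R I J\<^esub> g) n = f n <+> g n"
  by (simp add: assoc_graded_def)

lemma carrier_eq: "carrier (assoc_graded R I J) = assoc_carrier R I J"
  by (simp add: assoc_graded_def)

lemma assoc_finite: "f \<in> assoc_carrier R I J \<Longrightarrow> finite {n. f n \<noteq> J n}"
  by (simp add: mem_assoc_carrier)

lemma I_add: "a \<in> I n \<Longrightarrow> b \<in> I n \<Longrightarrow> a \<oplus> b \<in> I n"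
  using additive_subgroup.a_closed[OF ideal.axioms(1)[OF I_ideal]] .

lemma I_minus: "a \<in> I n \<Longrightarrow> b \<in> I n \<Longrightarrow> a \<ominus> b \<in> I n"
  unfolding minus_eq using I_add additive_subgroup.a_inv_closed[OF ideal.axioms(1)[OF I_ideal]] by blast

lemma J_add_coset: "a \<in> carrier R \<Longrightarrow> J n <+> (J n +> a) = J n +> a"
  using J_coset_add[of \<zero> a n] by (simp add: J_coset_zero)

lemma zero_add_at: "f \<in> assoc_carrier R I J \<Longrightarrow> J n <+> f n = f n"
  using J_add_coset I_carrier by (metis assoc_repr)

lemma assoc_add_closed:
  assumes f: "f \<in> assoc_carrier R I J" and g: "g \<in> assoc_carrier R I J"
  shows "f \<oplus>\<^bsub>assoc_graded R I J\<^esub> g \<in> assoc_carrier R I J"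
  unfolding mem_assoc_carrier
proof (intro conjI allI)
  obtain c where c: "\<And>n. c n \<in> I n" "\<And>n. f n = J n +> c n" using assoc_repr[OF f] by metis
  obtain d where d: "\<And>n. d n \<in> I n" "\<And>n. g n = J n +> d n" using assoc_repr[OF g] by metis
  show "\<exists>a\<in>I n. (f \<oplus>\<^bsub>assoc_graded R I J\<^esub> g) n = J n +> a" for n
    using J_coset_add[OF I_carrier[OF c(1)] I_carrier[OF d(1)]] I_add[OF c(1) d(1)] c(2) d(2)
    by (auto simp: add_eq)
  have "{n. (f \<oplus>\<^bsub>assoc_graded R I J\<^esub> g) n \<noteq> J n} \<subseteq> {n. f n \<noteq> J n} \<union> {n. g n \<noteq> J n}"
    using zero_add_at[OF g] by (auto simp: add_eq)
  thus "finite {n. (f \<oplus>\<^bsub>assoc_graded R I J\<^esub> g) n \<noteq> J n}"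
    by (rule finite_subset) (use assoc_finite[OF f] assoc_finite[OF g] in simp)
qed

lemma assoc_add_assoc:
  assumes "f \<in> assoc_carrier R I J" "g \<in> assoc_carrier R I J" "h \<in> assoc_carrier R I J"
  shows "f \<oplus>\<^bsub>assoc_graded R I J\<^esub> g \<oplus>\<^bsub>assoc_graded R I J\<^esub> h
    = f \<oplus>\<^bsub>assoc_graded R I J\<^esub> (g \<oplus>\<^bsub>assoc_graded R I J\<^esub> h)"
proof
  fix n
  obtain a where a: "a \<in> carrier R" "f n = J n +> a" using assoc_repr[OF assms(1)] I_carrier by metis
  obtain b where b: "b \<in> carrier R" "g n = J n +> b" using assoc_repr[OF assms(2)] I_carrier by metis
  obtain c where c: "c \<in> carrier R" "h n = J n +> c" using assoc_repr[OF assms(3)] I_carrier by metis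
  show "(f \<oplus>\<^bsub>assoc_graded R I J\<^esub> g \<oplus>\<^bsub>assoc_graded R I J\<^esub> h) n
    = (f \<oplus>\<^bsub>assoc_graded R I J\<^esub> (g \<oplus>\<^bsub>assoc_graded R I J\<^esub> h)) n"
    unfolding add_eq a(2) b(2) c(2) using a(1) b(1) c(1) by (simp add: J_coset_add a_assoc)
qed

text \<open>The difference \<open>h = g - f\<close>, with control over the degrees in which it vanishes.\<close>

lemma assoc_difference:
  assumes f: "f \<in> assoc_carrier R I J" and g: "g \<in> assoc_carrier R I J"
  obtains h where "h \<in> assoc_carrier R I J" "h \<oplus>\<^bsub>assoc_graded R I J\<^esub> f = g" "\<And>n. g n = f n \<Longrightarrow> h n = J n"
proof -
  obtain c where c: "\<And>n. c n \<in> I n" "\<And>n. f n = J n +> c n" using assoc_repr[OF f] by metis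
  obtain d where d: "\<And>n. d n \<in> I n" "\<And>n. g n = J n +> d n" using assoc_repr[OF g] by metis
  define h where "h n = J n +> (d n \<ominus> c n)" for n
  have h0: "h n = J n" if "g n = f n" for n
    using that J_coset_eq_iff[OF I_carrier[OF d(1)] I_carrier[OF c(1)]] I_carrier[OF I_minus[OF d(1) c(1)]]
    unfolding h_def c(2) d(2) by (simp add: J_coset_eq_J_iff)
  have "{n. h n \<noteq> J n} \<subseteq> {n. f n \<noteq> J n} \<union> {n. g n \<noteq> J n}" using h0 by force
  hence "finite {n. h n \<noteq> J n}"
    by (rule finite_subset) (use assoc_finite[OF f] assoc_finite[OF g] in simp)
  hence "h \<in> assoc_carrier R I J"
    unfolding mem_assoc_carrier using I_minus[OF d(1) c(1)] by (auto simp: h_def)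
  moreover have "h \<oplus>\<^bsub>assoc_graded R I J\<^esub> f = g"
  proof
    fix n
    have cd: "c n \<in> carrier R" "d n \<in> carrier R" using c(1) d(1) I_carrier by auto
    hence "d n \<ominus> c n \<oplus> c n = d n" by algebra
    thus "(h \<oplus>\<^bsub>assoc_graded R I J\<^esub> f) n = g n"
      unfolding add_eq c(2) d(2) h_def using cd by (simp add: J_coset_add)
  qed
  ultimately show ?thesis using h0 that by blast
qed

end

text \<open>Covers both multiplication in the fiber cone and its action on the tangent cone.\<close>

locale graded_action = F: graded_quotient R I J + G: graded_quotient R I' J'
  for R (structure) and I J I' J' +
  assumes IJ: "a \<in> I p \<Longrightarrow> b \<in> J' q \<Longrightarrow> a \<otimes> b \<in> J' (p + q)"
    and JI: "a \<in> J p \<Longrightarrow> b \<in> I' q \<Longrightarrow> a \<otimes> b \<in> J' (p + q)"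
    and II: "a \<in> I p \<Longrightarrow> b \<in> I' q \<Longrightarrow> a \<otimes> b \<in> I' (p + q)"
begin

lemma mult_eq:
  assumes c: "\<And>k. c k \<in> I k" "\<And>k. f k = J k +> c k"
    and d: "\<And>k. d k \<in> I' k" "\<And>k. g k = J' k +> d k"
  shows "assoc_mult R J' f g n = J' n +> (\<Oplus>k\<in>{..n}. c k \<otimes> d (n - k))"
  using F.J_ideal G.J_ideal c d ideal_carrier_subset[OF F.I_ideal] ideal_carrier_subset[OF G.I_ideal] G.J_le IJ JI G.I_ideal
  by (rule F.assoc_mult_eq)

lemma homog_repr:
  assumes "a \<in> I p"
  shows "(if k = p then a else \<zero>) \<in> I k" "homog R J p a k = J k +> (if k = p then a else \<zero>)"
  using assms additive_subgroup.zero_closed[OF ideal.axioms(1)[OF F.I_ideal]] F.J_coset_zero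
  by (auto simp: homog_def)

lemma homog_mult:
  assumes a: "a \<in> I p" and d: "\<And>k. d k \<in> I' k" "\<And>k. g k = J' k +> d k"
  shows "assoc_mult R J' (homog R J p a) g n = (if n < p then J' n else J' n +> (a \<otimes> d (n - p)))"
proof -
  let ?u = "\<lambda>k. (if k = p then a else \<zero>) \<otimes> d (n - k)"
  have ac: "a \<in> carrier R" using F.I_carrier[OF a] .
  have dc: "d k \<in> carrier R" for k using G.I_carrier[OF d(1)] .
  have eq: "assoc_mult R J' (homog R J p a) g n = J' n +> (\<Oplus>k\<in>{..n}. ?u k)"
    using homog_repr[OF a] d by (rule mult_eq)
  show ?thesis
  proof (cases "n < p")
    case True
    have "(\<Oplus>k\<in>{..n}. ?u k) = (\<Oplus>k\<in>{..n}. \<zero>)"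
      using True dc by (intro F.finsum_cong') auto
    thus ?thesis using eq True by (simp add: G.J_coset_zero)
  next
    case False
    have "(\<Oplus>k\<in>{..n}. ?u k) = ?u p"
      using False ac dc by (intro F.finsum_one_term) auto
    thus ?thesis using eq False by simp
  qed
qed

lemma homog_mult_right:
  assumes b: "b \<in> I' p" and c: "\<And>k. c k \<in> I k" "\<And>k. f k = J k +> c k"
  shows "assoc_mult R J' f (homog R J' p b) n = (if n < p then J' n else J' n +> (c (n - p) \<otimes> b))"
proof -
  let ?d = "\<lambda>k. if k = p then b else \<zero>"
  let ?u = "\<lambda>k. c k \<otimes> ?d (n - k)"
  have bc: "b \<in> carrier R" using G.I_carrier[OF b] .
  have cc: "c k \<in> carrier R" for k using F.I_carrier[OF c(1)] .
  have d: "?d k \<in> I' k" "homog R J' p b k = J' k +> ?d k" for k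
    using b additive_subgroup.zero_closed[OF ideal.axioms(1)[OF G.I_ideal]] G.J_coset_zero
    by (auto simp: homog_def)
  have eq: "assoc_mult R J' f (homog R J' p b) n = J' n +> (\<Oplus>k\<in>{..n}. ?u k)"
    using c d by (rule mult_eq)
  show ?thesis
  proof (cases "n < p")
    case True
    have "(\<Oplus>k\<in>{..n}. ?u k) = (\<Oplus>k\<in>{..n}. \<zero>)"
      using True cc by (intro F.finsum_cong') auto
    thus ?thesis using eq True by (simp add: G.J_coset_zero)
  next
    case False
    have "(\<Oplus>k\<in>{..n}. ?u k) = ?u (n - p)"
      using False bc cc by (intro F.finsum_one_term) auto
    thus ?thesis using eq False by simp
  qed
qed

lemma homog_homog_mult:
  assumes a: "a \<in> I p" and b: "b \<in> I' q"
  shows "assoc_mult R J' (homog R J p a) (homog R J' q b) = homog R J' (p + q) (a \<otimes> b)"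
proof
  fix n
  have d: "(if k = q then b else \<zero>) \<in> I' k" "homog R J' q b k = J' k +> (if k = q then b else \<zero>)" for k
    using b additive_subgroup.zero_closed[OF ideal.axioms(1)[OF G.I_ideal]] G.J_coset_zero
    by (auto simp: homog_def)
  have ac: "a \<in> carrier R" using F.I_carrier[OF a] .
  show "assoc_mult R J' (homog R J p a) (homog R J' q b) n = homog R J' (p + q) (a \<otimes> b) n"
    unfolding homog_mult[OF a d] using ac by (auto simp: homog_def G.J_coset_zero)
qed

text \<open>Multiplication by an element of degree \<open>p\<close> shifts degrees by \<open>p\<close>. This is what makes it compatible with
discarding all degrees from some point on.\<close>

lemma homog_mult_local:
  assumes a: "a \<in> I p" and g: "g \<in> assoc_carrier R I' J'" and g': "g' \<in> assoc_carrier R I' J'"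
    and eq: "g (n - p) = g' (n - p)"
  shows "assoc_mult R J' (homog R J p a) g n = assoc_mult R J' (homog R J p a) g' n"
proof (cases "n < p")
  case True
  thus ?thesis using G.assoc_repr[OF g] G.assoc_repr[OF g'] homog_mult[OF a] by (metis (no_types, lifting))
next
  case False
  obtain d where d: "\<And>n. d n \<in> I' n" "\<And>n. g n = J' n +> d n" using G.assoc_repr[OF g] by metis
  obtain d' where d': "\<And>n. d' n \<in> I' n" "\<And>n. g' n = J' n +> d' n" using G.assoc_repr[OF g'] by metis
  have car: "a \<in> carrier R" "d (n - p) \<in> carrier R" "d' (n - p) \<in> carrier R"
    using F.I_carrier[OF a] G.I_carrier d(1) d'(1) by auto
  have "d (n - p) \<ominus> d' (n - p) \<in> J' (n - p)"
    using eq car unfolding d(2) d'(2) by (simp add: G.J_coset_eq_iff)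
  hence "a \<otimes> (d (n - p) \<ominus> d' (n - p)) \<in> J' n" using IJ[OF a] False by fastforce
  moreover have "a \<otimes> (d (n - p) \<ominus> d' (n - p)) = a \<otimes> d (n - p) \<ominus> a \<otimes> d' (n - p)" using car by algebra
  ultimately have "J' n +> (a \<otimes> d (n - p)) = J' n +> (a \<otimes> d' (n - p))"
    using car by (simp add: G.J_coset_eq_iff)
  thus ?thesis unfolding homog_mult[OF a d] homog_mult[OF a d'] by simp
qed

lemma homog_mult_closed:
  assumes a: "a \<in> I p" and g: "g \<in> assoc_carrier R I' J'"
  shows "assoc_mult R J' (homog R J p a) g \<in> assoc_carrier R I' J'"
  unfolding G.mem_assoc_carrier
proof (intro conjI allI)
  obtain d where d: "\<And>n. d n \<in> I' n" "\<And>n. g n = J' n +> d n" using G.assoc_repr[OF g] by metis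
  note m = homog_mult[OF a d]
  show "\<exists>b\<in>I' n. assoc_mult R J' (homog R J p a) g n = J' n +> b" for n
  proof (cases "n < p")
    case True
    thus ?thesis using m G.J_coset_zero additive_subgroup.zero_closed[OF ideal.axioms(1)[OF G.I_ideal]]
      by (intro bexI[of _ \<zero>]) auto
  next
    case False
    thus ?thesis using m II[OF a d(1)[of "n - p"]] by (intro bexI[of _ "a \<otimes> d (n - p)"]) auto
  qed
  have "{n. assoc_mult R J' (homog R J p a) g n \<noteq> J' n} \<subseteq> (\<lambda>k. p + k) ` {k. g k \<noteq> J' k}"
  proof
    fix n assume n: "n \<in> {n. assoc_mult R J' (homog R J p a) g n \<noteq> J' n}"
    hence np: "\<not> n < p" using m by auto
    have "g (n - p) \<noteq> J' (n - p)"
    proof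
      assume "g (n - p) = J' (n - p)"
      hence "d (n - p) \<in> J' (n - p)" using d G.J_coset_eq_J_iff[OF G.I_carrier[OF d(1)]] by simp
      hence "a \<otimes> d (n - p) \<in> J' n" using IJ[OF a] np by fastforce
      hence "J' n +> (a \<otimes> d (n - p)) = J' n"
        using F.I_carrier[OF a] G.I_carrier[OF d(1)] by (simp add: G.J_coset_eq_J_iff)
      thus False using n m np by simp
    qed
    moreover have "n = p + (n - p)" using np by simp
    ultimately show "n \<in> (\<lambda>k. p + k) ` {k. g k \<noteq> J' k}" by blast
  qed
  thus "finite {n. assoc_mult R J' (homog R J p a) g n \<noteq> J' n}"
    by (rule finite_subset) (use G.assoc_finite[OF g] in simp)
qed

end

section \<open>The fiber cone and its cyclic modules\<close>

lemma graded_quot_simps: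
  "carrier (graded_quot F L) = a_rcosets\<^bsub>F\<^esub> L"
  "zero (graded_quot F L) = L"
  "add (graded_quot F L) = set_add F"
  "smult (graded_quot F L) = (\<lambda>a C. \<Union>v\<in>C. L +>\<^bsub>F\<^esub> (a \<odot>\<^bsub>F\<^esub> v))"
  "component (graded_quot F L) n = (\<lambda>u. L +>\<^bsub>F\<^esub> u) ` component F n"
  by (simp_all add: graded_quot_def quot_module_def module.defs graded_module.defs)

lemma graded_shift_simps:
  "carrier (graded_shift P i) = carrier P"
  "zero (graded_shift P i) = zero P"
  "add (graded_shift P i) = add P"
  "smult (graded_shift P i) = smult P"
  "component (graded_shift P i) n = (if n < i then {zero P} else component P (n - i))"
  by (simp_all add: graded_shift_def)

context noetherian_reduction
begin

text \<open>The fiber cone is \<open>\<Oplus>\<^sub>n FI n / FJ n\<close>, and the tangent cone is \<open>\<Oplus>\<^sub>n \<mm>\<^sup>n / GJ n\<close>. In both modules the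
zero element is the sequence of denominators, \<open>FJ\<close> or \<open>GJ\<close>.\<close>

abbreviation "FI n \<equiv> (x [^] (n::nat)) <# carrier R"
abbreviation "FJ n \<equiv> (x [^] (n::nat)) <# \<mm>"
abbreviation "GJ n \<equiv> M (Suc n)"

lemma FI_I: "c \<in> carrier R \<Longrightarrow> x [^] (n::nat) \<otimes> c \<in> FI n"
  by (auto simp: l_coset_def)

lemma FJ_iff: "c \<in> carrier R \<Longrightarrow> x [^] (n::nat) \<otimes> c \<in> FJ n \<longleftrightarrow> c \<in> \<mm>"
  by (rule mem_lcoset_regular[OF xpow_regular _ ideal_carrier_subset[OF m_ideal]])

lemma m_carrier: "c \<in> \<mm> \<Longrightarrow> c \<in> carrier R"
  using ideal_carrier_subset[OF m_ideal] by blast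

lemma xpow_mult_xpow:
  "c \<in> carrier R \<Longrightarrow> d \<in> carrier R \<Longrightarrow>
    (x [^] (p::nat) \<otimes> c) \<otimes> (x [^] q \<otimes> d) = x [^] (p + q) \<otimes> (c \<otimes> d)"
proof -
  assume c: "c \<in> carrier R" "d \<in> carrier R"
  have "(x [^] p \<otimes> c) \<otimes> (x [^] q \<otimes> d) = (x [^] p \<otimes> x [^] q) \<otimes> (c \<otimes> d)"
    using c xpow_carrier[of p] xpow_carrier[of q] by algebra
  thus ?thesis by (simp add: nat_pow_mult)
qed

lemma fiber_product_mem:
  assumes "a \<in> (x [^] (p::nat)) <# C'" "b \<in> (x [^] (q::nat)) <# B"
    and "C' \<subseteq> carrier R" "B \<subseteq> carrier R" "\<And>c d. c \<in> C' \<Longrightarrow> d \<in> B \<Longrightarrow> c \<otimes> d \<in> P"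
  shows "a \<otimes> b \<in> (x [^] (p + q)) <# P"
proof -
  obtain c d where "c \<in> C'" "a = x [^] p \<otimes> c" "d \<in> B" "b = x [^] q \<otimes> d"
    using assms(1,2) by (auto simp: l_coset_def)
  moreover have "a \<otimes> b = x [^] (p + q) \<otimes> (c \<otimes> d)"
    using calculation xpow_mult_xpow[OF subsetD[OF assms(3)] subsetD[OF assms(4)]] by simp
  ultimately show ?thesis using assms(5) by (auto simp: l_coset_def)
qed

lemma cone_product_mem:
  assumes "a \<in> (x [^] (p::nat)) <# C" "b \<in> M q" "C \<subseteq> carrier R" "\<And>c. c \<in> C \<Longrightarrow> c \<otimes> b \<in> M k"
  shows "a \<otimes> b \<in> M (p + k)"
proof -
  obtain c where c: "c \<in> C" "a = x [^] p \<otimes> c" using assms(1) by (auto simp: l_coset_def)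
  have "a \<otimes> b = x [^] p \<otimes> (c \<otimes> b)" using c assms(2,3) pow_carrier by (auto simp: m_assoc)
  thus ?thesis using xpow_mult_mem[OF assms(4)[OF c(1)]] by simp
qed

lemma fiber_filtration: "graded_quotient R FI FJ"
proof (intro graded_quotient.intro graded_quotient_axioms.intro is_cring)
  show "ideal (FI n) R" for n by (rule ideal_lcoset[OF xpow_carrier oneideal])
  show "ideal (FJ n) R" for n by (rule ideal_lcoset[OF xpow_carrier m_ideal])
  show "FJ n \<subseteq> FI n" for n by (rule lcoset_mono[OF ideal_carrier_subset[OF m_ideal]])
qed

lemma cone_filtration: "graded_quotient R M GJ"
proof (intro graded_quotient.intro graded_quotient_axioms.intro is_cring)
  show "ideal (M n) R" for n by (rule pow_ideal)
  show "ideal (GJ n) R" for n by (rule pow_ideal)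
  show "GJ n \<subseteq> M n" for n by (rule pow_antimono) simp
qed

sublocale FF: graded_action R FI FJ FI FJ
proof (intro graded_action.intro graded_action_axioms.intro fiber_filtration)
  note mm = ideal_carrier_subset[OF m_ideal]
  show "a \<otimes> b \<in> FJ (p + q)" if "a \<in> FI p" "b \<in> FJ q" for a b p q
    using that by (rule fiber_product_mem[OF _ _ order.refl mm]) (rule ideal.I_l_closed[OF m_ideal])
  show "a \<otimes> b \<in> FJ (p + q)" if "a \<in> FJ p" "b \<in> FI q" for a b p q
    using that by (rule fiber_product_mem[OF _ _ mm order.refl]) (rule ideal.I_r_closed[OF m_ideal])
  show "a \<otimes> b \<in> FI (p + q)" if "a \<in> FI p" "b \<in> FI q" for a b p q
    using that by (rule fiber_product_mem[OF _ _ order.refl order.refl]) simp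
qed

sublocale FG: graded_action R FI FJ M GJ
proof (intro graded_action.intro graded_action_axioms.intro fiber_filtration cone_filtration)
  note mm = ideal_carrier_subset[OF m_ideal]
  show "a \<otimes> b \<in> GJ (p + q)" if "a \<in> FI p" "b \<in> GJ q" for a b p q
    using cone_product_mem[OF that order.refl, of "Suc q"] that(2) ideal.I_l_closed[OF pow_ideal] by simp
  show "a \<otimes> b \<in> GJ (p + q)" if "a \<in> FJ p" "b \<in> M q" for a b p q
    using cone_product_mem[OF that mm, of "Suc q"] that(2) pow_Suc_mult by simp
  show "a \<otimes> b \<in> M (p + q)" if "a \<in> FI p" "b \<in> M q" for a b p q
    using cone_product_mem[OF that order.refl, of q] that(2) ideal.I_l_closed[OF pow_ideal] by simp
qed

abbreviation "F \<equiv> fiber_cone R \<mm> x"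
abbreviation "G \<equiv> tangent_cone R \<mm>"

lemma F_eq: "F = assoc_graded R FI FJ" by (simp add: fiber_cone_def)
lemma G_eq: "G = assoc_graded R M GJ" by (simp add: tangent_cone_def)

text \<open>The element \<open>c (x\<^sup>*)\<^sup>n\<close> of the fiber cone.\<close>

definition monomial :: "nat \<Rightarrow> 'a \<Rightarrow> nat \<Rightarrow> 'a set" where
  "monomial n c = homog R FJ n (x [^] n \<otimes> c)"

text \<open>The class of \<open>a\<close> in the degree \<open>n\<close> part of the tangent cone; this is zero if \<open>a \<in> \<mm>\<^sup>n\<^sup>+\<^sup>1\<close>, so
it is not always the initial form of \<open>a\<close>.\<close>

definition form :: "nat \<Rightarrow> 'a \<Rightarrow> nat \<Rightarrow> 'a set" where
  "form n a = homog R GJ n a"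

lemma monomial_closed: "c \<in> carrier R \<Longrightarrow> monomial n c \<in> carrier F"
  unfolding monomial_def F_eq FF.F.carrier_eq by (intro FF.F.homog_carrier FI_I)

lemma monomial_eq_iff:
  assumes "c \<in> carrier R" "d \<in> carrier R"
  shows "monomial n c = monomial n d \<longleftrightarrow> c \<ominus> d \<in> \<mm>"
proof -
  have "x [^] n \<otimes> c \<ominus> x [^] n \<otimes> d = x [^] n \<otimes> (c \<ominus> d)"
    using assms xpow_carrier[of n] by algebra
  thus ?thesis unfolding monomial_def using assms FJ_iff[of "c \<ominus> d" n] by (simp add: FF.F.homog_eq_iff)
qed

lemma monomial_zero: "monomial n \<zero> = FJ"
  unfolding monomial_def using FF.F.homog_zero by simp

lemma monomial_eq_zero_iff: "c \<in> carrier R \<Longrightarrow> monomial n c = FJ \<longleftrightarrow> c \<in> \<mm>"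
  using monomial_eq_iff[of c \<zero> n] by (simp add: monomial_zero minus_eq)

lemma zero_F: "\<zero>\<^bsub>F\<^esub> = FJ" by (simp add: F_eq assoc_graded_def)
lemma smult_F: "smult F = assoc_mult R FJ" by (simp add: F_eq assoc_graded_def)
lemma mult_F: "mult F = assoc_mult R FJ" by (simp add: F_eq assoc_graded_def)
lemma smult_G: "smult G = assoc_mult R GJ" by (simp add: G_eq assoc_graded_def)

lemma carrier_F: "carrier F = assoc_carrier R FI FJ"
  by (simp add: F_eq FF.F.carrier_eq)

lemma add_F: "(f \<oplus>\<^bsub>F\<^esub> g) n = f n <+> g n"
  by (simp add: F_eq FF.F.add_eq)

lemma F_add_closed: "f \<in> carrier F \<Longrightarrow> g \<in> carrier F \<Longrightarrow> f \<oplus>\<^bsub>F\<^esub> g \<in> carrier F"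
  unfolding carrier_F using FF.F.assoc_add_closed by (simp add: F_eq)

lemma component_F: "component F n = monomial n ` carrier R"
  unfolding F_eq FF.F.component_eq monomial_def by (auto simp: l_coset_def)

lemma monomial_mult:
  "c \<in> carrier R \<Longrightarrow> d \<in> carrier R \<Longrightarrow> monomial p c \<odot>\<^bsub>F\<^esub> monomial n d = monomial (p + n) (c \<otimes> d)"
  unfolding smult_F monomial_def by (simp add: FF.homog_homog_mult FI_I xpow_mult_xpow)

lemma monomial_mult_zero: "c \<in> carrier R \<Longrightarrow> monomial p c \<odot>\<^bsub>F\<^esub> FJ = FJ"
  using monomial_mult[of c \<zero> p 0] by (simp add: monomial_zero)

lemma monomial_add:
  assumes "c \<in> carrier R" "d \<in> carrier R"
  shows "monomial n c \<oplus>\<^bsub>F\<^esub> monomial n d = monomial n (c \<oplus> d)"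
  unfolding monomial_def F_eq using assms by (simp add: FF.F.homog_add r_distr)

lemma form_closed: "a \<in> M n \<Longrightarrow> form n a \<in> carrier G"
  unfolding form_def G_eq FG.G.carrier_eq by (rule FG.G.homog_carrier)

lemma component_G: "component G n = form n ` M n"
  unfolding G_eq FG.G.component_eq form_def by simp

lemma form_eq_iff: "a \<in> carrier R \<Longrightarrow> b \<in> carrier R \<Longrightarrow> form n a = form n b \<longleftrightarrow> a \<ominus> b \<in> M (Suc n)"
  unfolding form_def by (rule FG.G.homog_eq_iff)

lemma form_add: "a \<in> carrier R \<Longrightarrow> b \<in> carrier R \<Longrightarrow> form n a \<oplus>\<^bsub>G\<^esub> form n b = form n (a \<oplus> b)"
  unfolding form_def G_eq by (rule FG.G.homog_add)

lemma monomial_form: 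
  assumes "c \<in> carrier R" "a \<in> M n"
  shows "monomial p c \<odot>\<^bsub>G\<^esub> form n a = form (p + n) (x [^] p \<otimes> c \<otimes> a)"
  unfolding smult_G monomial_def form_def by (rule FG.homog_homog_mult[OF FI_I[OF assms(1)] assms(2)])

abbreviation "L j \<equiv> PIdl\<^bsub>F\<^esub> (initial_form R \<mm> x [^]\<^bsub>F\<^esub> (j::nat))"

lemma initial_form_pow: "initial_form R \<mm> x [^]\<^bsub>F\<^esub> (j::nat) = monomial j \<one>"
proof (induction j)
  case 0
  show ?case by (simp add: F_eq assoc_graded_def monomial_def homog_def fun_eq_iff)
next
  case (Suc j)
  have "initial_form R \<mm> x = monomial 1 \<one>"
    by (auto simp: initial_form_def monomial_def homog_def fun_eq_iff)
  thus ?case using Suc monomial_mult[of \<one> \<one> j 1] by (simp add: mult_F smult_F)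
qed

text \<open>The multiples of \<open>(x\<^sup>*)\<^sup>j\<close> are the elements that vanish in all degrees below \<open>j\<close>, as in a polynomial ring.
So cosets of this ideal are truncations, and equations between them can be checked degree by degree.\<close>

lemma L_eq: "L j = {f \<in> carrier F. \<forall>n<j. f n = FJ n}"
proof
  have one: "x [^] j \<otimes> \<one> \<in> FI j" by (rule FI_I) simp
  show "L j \<subseteq> {f \<in> carrier F. \<forall>n<j. f n = FJ n}"
  proof
    fix f assume "f \<in> L j"
    then obtain g where g: "g \<in> carrier F" "f = assoc_mult R FJ g (monomial j \<one>)"
      unfolding cgenideal_def initial_form_pow mult_F by blast
    have gc: "g \<in> assoc_carrier R FI FJ" using g(1) by (simp add: F_eq FF.F.carrier_eq)
    obtain c where c: "\<And>n. c n \<in> FI n" "\<And>n. g n = FJ n +> c n"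
      using FF.F.assoc_repr[OF gc] by metis
    have eq: "f n = (if n < j then FJ n else FJ n +> (c (n - j) \<otimes> (x [^] j \<otimes> \<one>)))" for n
      unfolding g(2) monomial_def by (rule FF.homog_mult_right[OF one c])
    have "f = monomial j \<one> \<odot>\<^bsub>F\<^esub> g"
    proof
      fix n
      have "(monomial j \<one> \<odot>\<^bsub>F\<^esub> g) n = (if n < j then FJ n else FJ n +> ((x [^] j \<otimes> \<one>) \<otimes> c (n - j)))"
        unfolding smult_F monomial_def by (rule FF.homog_mult[OF one c])
      thus "f n = (monomial j \<one> \<odot>\<^bsub>F\<^esub> g) n"
        unfolding eq using FF.F.I_carrier[OF c(1)] by (simp add: m_comm)
    qed
    hence "f \<in> carrier F"
      using FF.homog_mult_closed[OF one gc] by (simp add: smult_F monomial_def carrier_F)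
    thus "f \<in> {f \<in> carrier F. \<forall>n<j. f n = FJ n}" using eq by simp
  qed
  show "{f \<in> carrier F. \<forall>n<j. f n = FJ n} \<subseteq> L j"
  proof
    fix f assume "f \<in> {f \<in> carrier F. \<forall>n<j. f n = FJ n}"
    hence f: "f \<in> assoc_carrier R FI FJ" and low: "\<And>n. n < j \<Longrightarrow> f n = FJ n"
      by (simp_all add: F_eq FF.F.carrier_eq)
    have "\<exists>a\<in>carrier R. f n = FJ n +> (x [^] n \<otimes> a)" for n
      using f unfolding FF.F.mem_assoc_carrier by (fastforce simp: l_coset_def)
    then obtain a where a: "\<And>n. a n \<in> carrier R" "\<And>n. f n = FJ n +> (x [^] n \<otimes> a n)" by metis
    \<comment> \<open>Divide by \<open>(x\<^sup>*)\<^sup>j\<close>: the coefficients are shifted down by \<open>j\<close>.\<close>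
    define g where "g n = FJ n +> (x [^] n \<otimes> a (n + j))" for n
    have "{n. g n \<noteq> FJ n} \<subseteq> (\<lambda>n. n + j) -` {n. f n \<noteq> FJ n}"
      using a by (auto simp: g_def FF.F.J_coset_eq_J_iff FJ_iff)
    hence "finite {n. g n \<noteq> FJ n}"
      by (rule finite_subset) (intro finite_vimageI FF.F.assoc_finite[OF f], simp add: inj_def)
    hence g: "g \<in> assoc_carrier R FI FJ"
      unfolding FF.F.mem_assoc_carrier using FI_I[OF a(1)] by (auto simp: g_def)
    have "assoc_mult R FJ g (monomial j \<one>) n = f n" for n
    proof -
      have "assoc_mult R FJ g (monomial j \<one>) n
          = (if n < j then FJ n else FJ n +> (x [^] (n - j) \<otimes> a (n - j + j) \<otimes> (x [^] j \<otimes> \<one>)))"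
        unfolding monomial_def by (rule FF.homog_mult_right[OF one FI_I[OF a(1)] g_def])
      also have "\<dots> = f n"
      proof (cases "n < j")
        case False
        thus ?thesis using a xpow_mult_xpow[OF a(1) one_closed, of "n - j" _ j] by simp
      qed (simp add: low)
      finally show ?thesis .
    qed
    hence "f = assoc_mult R FJ g (monomial j \<one>)" by auto
    thus "f \<in> L j"
      unfolding cgenideal_def initial_form_pow mult_F using g by (auto simp: F_eq FF.F.carrier_eq)
  qed
qed

lemma L_coset:
  assumes f: "f \<in> carrier F"
  shows "L j +>\<^bsub>F\<^esub> f = {g \<in> carrier F. \<forall>n<j. g n = f n}"
proof
  have fc: "f \<in> assoc_carrier R FI FJ" using f by (simp add: carrier_F)
  show "L j +>\<^bsub>F\<^esub> f \<subseteq> {g \<in> carrier F. \<forall>n<j. g n = f n}"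
  proof
    fix g assume "g \<in> L j +>\<^bsub>F\<^esub> f"
    then obtain h where h: "h \<in> L j" "g = h \<oplus>\<^bsub>F\<^esub> f" by (auto simp: a_r_coset_def')
    have "g n = f n" if "n < j" for n
      using h that FF.F.zero_add_at[OF fc, of n] by (simp add: L_eq add_F)
    thus "g \<in> {g \<in> carrier F. \<forall>n<j. g n = f n}" using h F_add_closed[OF _ f] by (simp add: L_eq)
  qed
  show "{g \<in> carrier F. \<forall>n<j. g n = f n} \<subseteq> L j +>\<^bsub>F\<^esub> f"
  proof
    fix g assume g: "g \<in> {g \<in> carrier F. \<forall>n<j. g n = f n}"
    hence gc: "g \<in> assoc_carrier R FI FJ" by (simp add: carrier_F)
    show "g \<in> L j +>\<^bsub>F\<^esub> f"
    proof (rule FF.F.assoc_difference[OF fc gc])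
      fix h assume h: "h \<in> assoc_carrier R FI FJ" "h \<oplus>\<^bsub>assoc_graded R FI FJ\<^esub> f = g"
        "\<And>n. g n = f n \<Longrightarrow> h n = FJ n"
      hence "h \<in> L j" using g by (simp add: L_eq carrier_F)
      thus "g \<in> L j +>\<^bsub>F\<^esub> f" using h(2) by (auto simp: a_r_coset_def' F_eq)
    qed
  qed
qed

lemma L_coset_eq_iff:
  assumes f: "f \<in> carrier F" and g: "g \<in> carrier F"
  shows "L j +>\<^bsub>F\<^esub> f = L j +>\<^bsub>F\<^esub> g \<longleftrightarrow> (\<forall>n<j. f n = g n)"
proof
  assume "L j +>\<^bsub>F\<^esub> f = L j +>\<^bsub>F\<^esub> g"
  hence "f \<in> L j +>\<^bsub>F\<^esub> g" using L_coset[OF f] f by auto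
  thus "\<forall>n<j. f n = g n" using L_coset[OF g] by simp
qed (simp add: L_coset f g)

text \<open>In degree \<open>n\<close>, the cyclic module \<open>F/(x\<^sup>*)\<^sup>j F\<close> is the residue field if \<open>n < j\<close>, and zero otherwise.\<close>

lemma L_coset_monomial_eq_iff:
  assumes "c \<in> carrier R" "d \<in> carrier R"
  shows "L j +>\<^bsub>F\<^esub> monomial n c = L j +>\<^bsub>F\<^esub> monomial n d \<longleftrightarrow> j \<le> n \<or> c \<ominus> d \<in> \<mm>"
proof -
  have off: "monomial n c k = monomial n d k" if "k \<noteq> n" for k using that by (simp add: monomial_def homog_def)
  have "(\<forall>k<j. monomial n c k = monomial n d k) \<longleftrightarrow> j \<le> n \<or> monomial n c = monomial n d"
    using off by (metis ext not_le)
  thus ?thesis using L_coset_eq_iff monomial_closed monomial_eq_iff[OF assms] assms by simp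
qed

lemma L_coset_zero: "L j +>\<^bsub>F\<^esub> FJ = L j"
  using L_coset[OF monomial_closed[OF zero_closed], of j 0] by (simp add: monomial_zero L_eq)

lemma L_coset_add:
  assumes f: "f \<in> carrier F" and g: "g \<in> carrier F"
  shows "(L j +>\<^bsub>F\<^esub> f) <+>\<^bsub>F\<^esub> (L j +>\<^bsub>F\<^esub> g) = L j +>\<^bsub>F\<^esub> (f \<oplus>\<^bsub>F\<^esub> g)"
proof
  have fg: "f \<oplus>\<^bsub>F\<^esub> g \<in> carrier F" by (rule F_add_closed[OF f g])
  show "(L j +>\<^bsub>F\<^esub> f) <+>\<^bsub>F\<^esub> (L j +>\<^bsub>F\<^esub> g) \<subseteq> L j +>\<^bsub>F\<^esub> (f \<oplus>\<^bsub>F\<^esub> g)"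
  proof
    fix h assume "h \<in> (L j +>\<^bsub>F\<^esub> f) <+>\<^bsub>F\<^esub> (L j +>\<^bsub>F\<^esub> g)"
    then obtain u v where uv: "u \<in> L j +>\<^bsub>F\<^esub> f" "v \<in> L j +>\<^bsub>F\<^esub> g" "h = u \<oplus>\<^bsub>F\<^esub> v"
      by (auto simp: set_add_def')
    have u: "u \<in> carrier F" "\<forall>n<j. u n = f n" and v: "v \<in> carrier F" "\<forall>n<j. v n = g n"
      using uv(1,2) by (auto simp: L_coset[OF f] L_coset[OF g])
    have "\<forall>n<j. h n = (f \<oplus>\<^bsub>F\<^esub> g) n" using u(2) v(2) by (simp add: uv(3) add_F)
    thus "h \<in> L j +>\<^bsub>F\<^esub> (f \<oplus>\<^bsub>F\<^esub> g)" using F_add_closed[OF u(1) v(1)] uv(3) by (simp add: L_coset[OF fg])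
  qed
  show "L j +>\<^bsub>F\<^esub> (f \<oplus>\<^bsub>F\<^esub> g) \<subseteq> (L j +>\<^bsub>F\<^esub> f) <+>\<^bsub>F\<^esub> (L j +>\<^bsub>F\<^esub> g)"
  proof
    fix h assume "h \<in> L j +>\<^bsub>F\<^esub> (f \<oplus>\<^bsub>F\<^esub> g)"
    then obtain l where l: "l \<in> L j" "h = l \<oplus>\<^bsub>F\<^esub> (f \<oplus>\<^bsub>F\<^esub> g)" by (auto simp: a_r_coset_def')
    have lc: "l \<in> carrier F" using l(1) by (simp add: L_eq)
    have "h = (l \<oplus>\<^bsub>F\<^esub> f) \<oplus>\<^bsub>F\<^esub> g"
      unfolding l(2) F_eq using lc f g by (intro FF.F.assoc_add_assoc[symmetric]) (simp_all add: carrier_F)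
    moreover have "l \<oplus>\<^bsub>F\<^esub> f \<in> L j +>\<^bsub>F\<^esub> f" using l(1) by (auto simp: a_r_coset_def')
    moreover have "g \<in> L j +>\<^bsub>F\<^esub> g" using L_coset[OF g] g by simp
    ultimately show "h \<in> (L j +>\<^bsub>F\<^esub> f) <+>\<^bsub>F\<^esub> (L j +>\<^bsub>F\<^esub> g)" unfolding set_add_def' by blast
  qed
qed

abbreviation "C j \<equiv> graded_quot F (L j)"

lemma cyclic_smult:
  assumes e: "e \<in> carrier R" and d: "d \<in> carrier R"
  shows "monomial p e \<odot>\<^bsub>C j\<^esub> (L j +>\<^bsub>F\<^esub> monomial n d) = L j +>\<^bsub>F\<^esub> monomial (p + n) (e \<otimes> d)"
proof -
  have xe: "x [^] p \<otimes> e \<in> FI p" by (rule FI_I[OF e])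
  have step: "L j +>\<^bsub>F\<^esub> (monomial p e \<odot>\<^bsub>F\<^esub> v) = L j +>\<^bsub>F\<^esub> monomial (p + n) (e \<otimes> d)"
    if v: "v \<in> L j +>\<^bsub>F\<^esub> monomial n d" for v
  proof -
    have vc: "v \<in> carrier F" and low: "\<And>k. k < j \<Longrightarrow> v k = monomial n d k"
      using v L_coset[OF monomial_closed[OF d]] by auto
    have car: "v \<in> assoc_carrier R FI FJ" "monomial n d \<in> assoc_carrier R FI FJ"
      using vc monomial_closed[OF d] by (auto simp: F_eq FF.F.carrier_eq)
    have ev: "monomial p e \<odot>\<^bsub>F\<^esub> v \<in> carrier F"
      using FF.homog_mult_closed[OF xe car(1)] by (simp add: smult_F monomial_def carrier_F)
    have "(monomial p e \<odot>\<^bsub>F\<^esub> v) k = (monomial p e \<odot>\<^bsub>F\<^esub> monomial n d) k" if "k < j" for k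
      unfolding smult_F monomial_def[of p e]
      using that by (intro FF.homog_mult_local[OF xe car] low) simp
    hence "\<forall>k<j. (monomial p e \<odot>\<^bsub>F\<^esub> v) k = monomial (p + n) (e \<otimes> d) k"
      unfolding monomial_mult[OF e d] by simp
    thus ?thesis by (simp add: L_coset_eq_iff[OF ev monomial_closed[OF m_closed[OF e d]]])
  qed
  have "monomial n d \<in> L j +>\<^bsub>F\<^esub> monomial n d" using L_coset monomial_closed[OF d] by auto
  thus ?thesis unfolding graded_quot_simps using step by blast
qed

lemma cyclic_smult_zero: "e \<in> carrier R \<Longrightarrow> monomial p e \<odot>\<^bsub>C j\<^esub> L j = L j"
  using cyclic_smult[of e \<zero> j p 0] by (simp add: monomial_zero L_coset_zero)

lemma cyclic_add:
  assumes "c \<in> carrier R" "d \<in> carrier R"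
  shows "(L j +>\<^bsub>F\<^esub> monomial n c) \<oplus>\<^bsub>C j\<^esub> (L j +>\<^bsub>F\<^esub> monomial n d) = L j +>\<^bsub>F\<^esub> monomial n (c \<oplus> d)"
  unfolding graded_quot_simps using L_coset_add[OF monomial_closed monomial_closed] assms by (simp add: monomial_add)

lemma cyclic_component: "component (C j) n = (\<lambda>c. L j +>\<^bsub>F\<^esub> monomial n c) ` carrier R"
  unfolding graded_quot_simps component_F by (simp add: image_image)

end

section \<open>Coordinates in the decomposed tangent cone\<close>

lemma graded_dsum_simps:
  "carrier (graded_dsum S P) = (\<Pi>\<^sub>E s\<in>S. carrier (P s))"
  "add (graded_dsum S P) = (\<lambda>u v. \<lambda>s\<in>S. u s \<oplus>\<^bsub>P s\<^esub> v s)"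
  "smult (graded_dsum S P) = (\<lambda>c u. \<lambda>s\<in>S. c \<odot>\<^bsub>P s\<^esub> u s)"
  "component (graded_dsum S P) n = (\<Pi>\<^sub>E s\<in>S. component (P s) n)"
  by (simp_all add: graded_dsum_def)

lemma graded_sum2_simps:
  "carrier (graded_sum2 P P') = carrier P \<times> carrier P'"
  "add (graded_sum2 P P') p q = (fst p \<oplus>\<^bsub>P\<^esub> fst q, snd p \<oplus>\<^bsub>P'\<^esub> snd q)"
  "smult (graded_sum2 P P') c p = (c \<odot>\<^bsub>P\<^esub> fst p, c \<odot>\<^bsub>P'\<^esub> snd p)"
  "component (graded_sum2 P P') n = component P n \<times> component P' n"
  by (simp_all add: graded_sum2_def split_beta)

locale cone_decomposition = noetherian_reduction +
  fixes \<alpha> :: "nat \<Rightarrow> nat" and \<tau> :: "nat \<Rightarrow> nat \<Rightarrow> nat" and \<phi>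
  assumes iso: "graded_iso F G
        (graded_sum2
          (graded_dsum {(i, k). i \<le> r \<and> k < \<alpha> i} (\<lambda>(i, k). graded_shift F i))
          (graded_dsum {(i, j, k). i \<in> {1..r - 1} \<and> j \<in> {1..r - i} \<and> k < \<tau> i j}
             (\<lambda>(i, j, k). graded_shift (C j) i)))
        \<phi>"
begin

abbreviation "S1 \<equiv> {(i, k). i \<le> r \<and> k < \<alpha> i}"
abbreviation "S2 \<equiv> {(i, j, k). i \<in> {1..r - 1} \<and> j \<in> {1..r - i} \<and> k < \<tau> i j}"
abbreviation "H1 \<equiv> graded_dsum S1 (\<lambda>(i, k). graded_shift F i)"
abbreviation "H2 \<equiv> graded_dsum S2 (\<lambda>(i, j, k). graded_shift (C j) i)"
abbreviation "H \<equiv> graded_sum2 H1 H2"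

text \<open>The image of the class of \<open>a\<close> in degree \<open>n\<close> under the given decomposition, split into its components in
the free summands and in the torsion summands.\<close>

definition free_coord :: "nat \<Rightarrow> 'a \<Rightarrow> nat \<times> nat \<Rightarrow> nat \<Rightarrow> 'a set" where
  "free_coord n a = fst (\<phi> (form n a))"

definition tors_coord :: "nat \<Rightarrow> 'a \<Rightarrow> nat \<times> nat \<times> nat \<Rightarrow> (nat \<Rightarrow> 'a set) set" where
  "tors_coord n a = snd (\<phi> (form n a))"

abbreviation (input) res :: "nat \<Rightarrow> nat \<Rightarrow> 'a \<Rightarrow> (nat \<Rightarrow> 'a set) set" where
  "res j n c \<equiv> L j +>\<^bsub>F\<^esub> monomial n c"

lemma phi_component: "\<phi> ` component G n = component H n"
  using iso by (simp add: graded_iso_def)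

lemma phi_inj: "inj_on \<phi> (carrier G)"
  using iso by (simp add: graded_iso_def bij_betw_def)

lemma phi_add: "p \<in> carrier G \<Longrightarrow> q \<in> carrier G \<Longrightarrow> \<phi> (p \<oplus>\<^bsub>G\<^esub> q) = \<phi> p \<oplus>\<^bsub>H\<^esub> \<phi> q"
  using iso by (simp add: graded_iso_def)

lemma phi_smult: "c \<in> carrier F \<Longrightarrow> p \<in> carrier G \<Longrightarrow> \<phi> (c \<odot>\<^bsub>G\<^esub> p) = c \<odot>\<^bsub>H\<^esub> \<phi> p"
  using iso by (simp add: graded_iso_def)

text \<open>Bounded quantifiers instead of products of sets: this makes elements of the direct sum available
coordinate by coordinate.\<close>

lemma component_H1: "u \<in> component H1 n \<longleftrightarrow> u \<in> extensional S1 \<and>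
    (\<forall>(i, k)\<in>S1. if n < i then u (i, k) = FJ else \<exists>c\<in>carrier R. u (i, k) = monomial (n - i) c)"
proof -
  have "component (graded_shift F i) n = (if n < i then {FJ} else monomial (n - i) ` carrier R)" for i
    by (simp add: graded_shift_simps zero_F component_F)
  hence "u s \<in> component (case s of (i, k) \<Rightarrow> graded_shift F i) n \<longleftrightarrow>
      (case s of (i, k) \<Rightarrow> if n < i then u (i, k) = FJ else \<exists>c\<in>carrier R. u (i, k) = monomial (n - i) c)" for s
    by (cases s) (simp add: image_iff)
  thus ?thesis unfolding graded_dsum_simps PiE_iff by (simp only: conj_commute)
qed

lemma component_H2: "v \<in> component H2 n \<longleftrightarrow> v \<in> extensional S2 \<and>
    (\<forall>(i, j, k)\<in>S2. if n < i then v (i, j, k) = L j else \<exists>c\<in>carrier R. v (i, j, k) = res j (n - i) c)"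
proof -
  have "component (graded_shift (C j) i) n = (if n < i then {L j} else (\<lambda>c. res j (n - i) c) ` carrier R)" for i j
    by (simp add: graded_shift_simps graded_quot_simps(2) cyclic_component)
  hence "v s \<in> component (case s of (i, j, k) \<Rightarrow> graded_shift (C j) i) n \<longleftrightarrow>
      (case s of (i, j, k) \<Rightarrow> if n < i then v (i, j, k) = L j else \<exists>c\<in>carrier R. v (i, j, k) = res j (n - i) c)" for s
    by (cases s) (simp add: image_iff)
  thus ?thesis unfolding graded_dsum_simps PiE_iff by (simp only: conj_commute)
qed

lemma coord_component:
  assumes "a \<in> M n"
  shows "free_coord n a \<in> component H1 n" "tors_coord n a \<in> component H2 n"
proof -
  have "\<phi> (form n a) \<in> component H n"
    using assms phi_component component_G by blast
  thus "free_coord n a \<in> component H1 n" "tors_coord n a \<in> component H2 n"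
    unfolding free_coord_def tors_coord_def by (auto simp: graded_sum2_simps)
qed

lemma coord_surj:
  assumes "u \<in> component H1 n" "v \<in> component H2 n"
  obtains a where "a \<in> M n" "free_coord n a = u" "tors_coord n a = v"
proof -
  have "(u, v) \<in> \<phi> ` component G n"
    using assms unfolding phi_component by (simp add: graded_sum2_simps)
  then obtain a where "a \<in> M n" "\<phi> (form n a) = (u, v)" unfolding component_G by force
  thus ?thesis using that[of a] by (simp add: free_coord_def tors_coord_def)
qed

lemma coord_inj:
  assumes "a \<in> M n" "b \<in> M n" "free_coord n a = free_coord n b" "tors_coord n a = tors_coord n b"
  shows "a \<ominus> b \<in> M (Suc n)"
proof -
  have "\<phi> (form n a) = \<phi> (form n b)"
    using assms(3,4) unfolding free_coord_def tors_coord_def by (rule prod_eqI)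
  hence "form n a = form n b"
    using inj_onD[OF phi_inj] form_closed assms(1,2) by blast
  thus ?thesis using form_eq_iff assms(1,2) pow_carrier by blast
qed

lemma coord_add:
  assumes "a \<in> M n" "b \<in> M n" "(i, j, k) \<in> S2"
  shows "tors_coord n (a \<oplus> b) (i, j, k) = tors_coord n a (i, j, k) \<oplus>\<^bsub>C j\<^esub> tors_coord n b (i, j, k)"
proof -
  have "\<phi> (form n (a \<oplus> b)) = \<phi> (form n a) \<oplus>\<^bsub>H\<^esub> \<phi> (form n b)"
    using phi_add[OF form_closed[OF assms(1)] form_closed[OF assms(2)]] form_add pow_carrier assms(1,2) by simp
  thus ?thesis
    unfolding tors_coord_def using assms(3) by (simp add: graded_sum2_simps graded_dsum_simps graded_shift_simps)
qed

lemma coord_smult: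
  assumes "a \<in> M n" "c \<in> carrier R"
  shows "free_coord (p + n) (x [^] p \<otimes> c \<otimes> a) = (\<lambda>(i, k)\<in>S1. monomial p c \<odot>\<^bsub>F\<^esub> free_coord n a (i, k))"
    and "tors_coord (p + n) (x [^] p \<otimes> c \<otimes> a) = (\<lambda>(i, j, k)\<in>S2. monomial p c \<odot>\<^bsub>C j\<^esub> tors_coord n a (i, j, k))"
proof -
  have "\<phi> (form (p + n) (x [^] p \<otimes> c \<otimes> a)) = monomial p c \<odot>\<^bsub>H\<^esub> \<phi> (form n a)"
    using phi_smult[OF monomial_closed[OF assms(2)] form_closed[OF assms(1)]] monomial_form[OF assms(2,1)] by simp
  thus "free_coord (p + n) (x [^] p \<otimes> c \<otimes> a) = (\<lambda>(i, k)\<in>S1. monomial p c \<odot>\<^bsub>F\<^esub> free_coord n a (i, k))"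
    "tors_coord (p + n) (x [^] p \<otimes> c \<otimes> a) = (\<lambda>(i, j, k)\<in>S2. monomial p c \<odot>\<^bsub>C j\<^esub> tors_coord n a (i, j, k))"
    unfolding free_coord_def tors_coord_def
    by (auto simp: graded_sum2_simps graded_dsum_simps graded_shift_simps fun_eq_iff restrict_def)
qed

lemma coord_xpow:
  assumes "a \<in> M n"
  shows "free_coord (p + n) (x [^] p \<otimes> a) = (\<lambda>(i, k)\<in>S1. monomial p \<one> \<odot>\<^bsub>F\<^esub> free_coord n a (i, k))"
    and "tors_coord (p + n) (x [^] p \<otimes> a) = (\<lambda>(i, j, k)\<in>S2. monomial p \<one> \<odot>\<^bsub>C j\<^esub> tors_coord n a (i, j, k))"
  using coord_smult[OF assms one_closed, of p] by simp_all

lemma coord_scalar: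
  assumes "a \<in> M n" "c \<in> carrier R" "(i, j, k) \<in> S2"
  shows "tors_coord n (c \<otimes> a) (i, j, k) = monomial 0 c \<odot>\<^bsub>C j\<^esub> tors_coord n a (i, j, k)"
  using coord_smult(2)[OF assms(1,2), of 0] assms by simp

definition zero1 :: "nat \<times> nat \<Rightarrow> nat \<Rightarrow> 'a set" where "zero1 = (\<lambda>s\<in>S1. FJ)"
definition zero2 :: "nat \<times> nat \<times> nat \<Rightarrow> (nat \<Rightarrow> 'a set) set" where "zero2 = (\<lambda>(i, j, k)\<in>S2. L j)"

text \<open>The isomorphism is only known to be additive and linear. That it maps zero to zero follows by
multiplying with the scalar zero, which annihilates every coordinate.\<close>

lemma zero_coord: "free_coord n \<zero> = zero1" "tors_coord n \<zero> = zero2"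
proof -
  have z: "\<zero> \<in> M n" using additive_subgroup.zero_closed[OF ideal.axioms(1)[OF pow_ideal]] .
  have fz: "free_coord n \<zero> = (\<lambda>(i, k)\<in>S1. monomial 0 \<zero> \<odot>\<^bsub>F\<^esub> free_coord n \<zero> (i, k))"
    and tz: "tors_coord n \<zero> = (\<lambda>(i, j, k)\<in>S2. monomial 0 \<zero> \<odot>\<^bsub>C j\<^esub> tors_coord n \<zero> (i, j, k))"
    using coord_smult[OF z zero_closed, of 0] by simp_all
  have "monomial 0 \<zero> \<odot>\<^bsub>F\<^esub> free_coord n \<zero> (i, k) = FJ" if s: "(i, k) \<in> S1" for i k
  proof -
    have "(if n < i then free_coord n \<zero> (i, k) = FJ else \<exists>c\<in>carrier R. free_coord n \<zero> (i, k) = monomial (n - i) c)"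
      using coord_component(1)[OF z] s unfolding component_H1 by fast
    then obtain m c where "c \<in> carrier R" "free_coord n \<zero> (i, k) = monomial m c"
      using monomial_zero by (metis zero_closed)
    thus ?thesis using monomial_mult[of \<zero> c 0 m] by (simp add: monomial_zero)
  qed
  thus "free_coord n \<zero> = zero1" by (subst fz) (auto simp: zero1_def fun_eq_iff restrict_def)
  have "monomial 0 \<zero> \<odot>\<^bsub>C j\<^esub> tors_coord n \<zero> (i, j, k) = L j" if s: "(i, j, k) \<in> S2" for i j k
  proof -
    have "(if n < i then tors_coord n \<zero> (i, j, k) = L j else \<exists>c\<in>carrier R. tors_coord n \<zero> (i, j, k) = res j (n - i) c)"
      using coord_component(2)[OF z] s unfolding component_H2 by fast
    then obtain m c where "c \<in> carrier R" "tors_coord n \<zero> (i, j, k) = res j m c"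
      using monomial_zero L_coset_zero by (metis zero_closed)
    thus ?thesis
      using cyclic_smult[where e = \<zero> and d = c and p = 0 and n = m and j = j]
      by (simp add: monomial_zero L_coset_zero)
  qed
  thus "tors_coord n \<zero> = zero2" by (subst tz) (auto simp: zero2_def fun_eq_iff restrict_def)
qed

lemma coord_zero_iff:
  assumes a: "a \<in> M n"
  shows "a \<in> M (Suc n) \<longleftrightarrow> free_coord n a = zero1 \<and> tors_coord n a = zero2"
proof -
  have z: "\<zero> \<in> M n" using additive_subgroup.zero_closed[OF ideal.axioms(1)[OF pow_ideal]] .
  have az: "a \<ominus> \<zero> = a" using pow_carrier[OF a] by (simp add: minus_eq)
  have "form n a = form n \<zero>" if "a \<in> M (Suc n)"
    using that form_eq_iff[OF pow_carrier[OF a] zero_closed] az by simp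
  hence "free_coord n a = zero1 \<and> tors_coord n a = zero2" if "a \<in> M (Suc n)"
    using that zero_coord[of n] unfolding free_coord_def tors_coord_def by simp
  moreover have "a \<in> M (Suc n)" if "free_coord n a = zero1 \<and> tors_coord n a = zero2"
    using coord_inj[OF a z] that zero_coord[of n] az by simp
  ultimately show ?thesis by blast
qed

end

section \<open>Torsion summands and the gap\<close>

lemma (in cring) idealI_closed:
  assumes sub: "N \<subseteq> carrier R" and zero: "\<zero> \<in> N"
    and add: "\<And>a b. a \<in> N \<Longrightarrow> b \<in> N \<Longrightarrow> a \<oplus> b \<in> N"
    and mult: "\<And>c a. c \<in> carrier R \<Longrightarrow> a \<in> N \<Longrightarrow> c \<otimes> a \<in> N"
  shows "ideal N R"
proof (rule idealI)
  show "ring R" by (rule ring_axioms)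
  show "subgroup N (add_monoid R)"
  proof (rule add.subgroupI)
    show "N \<subseteq> carrier R" "N \<noteq> {}" using sub zero by auto
    fix a b assume a: "a \<in> N"
    have "\<ominus> a = \<ominus> \<one> \<otimes> a" using sub a by (simp add: l_minus subset_iff)
    thus "\<ominus> a \<in> N" using mult[OF _ a, of "\<ominus> \<one>"] by simp
    assume "b \<in> N" thus "a \<oplus> b \<in> N" by (rule add[OF a])
  qed
  fix a c assume a: "a \<in> N" "c \<in> carrier R"
  show "c \<otimes> a \<in> N" by (rule mult[OF a(2,1)])
  thus "a \<otimes> c \<in> N" using m_comm[of a c] a sub by auto
qed

context cone_decomposition
begin

abbreviation "U n \<equiv> (x <# M n) <+> E (Suc n)"
abbreviation "V n \<equiv> (x <# M n) <+> M (Suc (Suc n))"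

lemma U_ideal: "ideal (U n) R"
  by (intro add_ideals xM_ideal E_ideal)

lemma U_le: "U n \<subseteq> M (Suc n)"
  using xM_subset by (intro ideal_add_subset xM_ideal E_ideal pow_ideal) (auto simp: E_def)

lemma V_ideal: "ideal (V n) R"
  by (intro add_ideals xM_ideal pow_ideal)

lemma V_le_U: "V n \<subseteq> U n"
  using ideal_add_upper[OF xM_ideal[of n] E_ideal[of "Suc n"]] pow_Suc_le_E[of "Suc n"]
  by (intro ideal_add_subset xM_ideal pow_ideal U_ideal) auto

text \<open>The kernel of the coordinate function at the torsion summand \<open>s\<close>, on the upper ideal of the gap in
degree \<open>n + 1\<close>. It is used for summands \<open>s\<close> generated in this degree, where the coordinate takes values
in the residue field.\<close>

definition vanishing :: "nat \<Rightarrow> nat \<times> nat \<times> nat \<Rightarrow> 'a set" where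
  "vanishing n s = {a \<in> U n. tors_coord (Suc n) a s = L (fst (snd s))}"

lemma residue_exists:
  assumes "a \<in> M i" "(i, j, k) \<in> S2"
  shows "\<exists>c\<in>carrier R. tors_coord i a (i, j, k) = res j 0 c"
proof -
  have "\<forall>(i', j, k)\<in>S2. if i < i' then tors_coord i a (i', j, k) = L j
      else \<exists>c\<in>carrier R. tors_coord i a (i', j, k) = res j (i - i') c"
    using coord_component(2)[OF assms(1)] unfolding component_H2 by blast
  from bspec[OF this assms(2)] show ?thesis by simp
qed

lemma residue_zero_iff:
  assumes "(i, j, k) \<in> S2" "c \<in> carrier R"
  shows "res j 0 c = L j \<longleftrightarrow> c \<in> \<mm>"
  using L_coset_monomial_eq_iff[of c \<zero> j 0] assms by (simp add: monomial_zero L_coset_zero minus_eq)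

lemma vanishing_ideal:
  assumes s: "(Suc n, j, k) \<in> S2"
  shows "ideal (vanishing n (Suc n, j, k)) R"
proof (rule idealI_closed)
  interpret U: ideal "U n" R by (rule U_ideal)
  show "vanishing n (Suc n, j, k) \<subseteq> carrier R"
    using ideal_carrier_subset[OF U_ideal] by (auto simp: vanishing_def)
  show "\<zero> \<in> vanishing n (Suc n, j, k)"
    using U.zero_closed zero_coord(2)[of "Suc n"] s by (simp add: vanishing_def zero2_def)
  fix a assume a: "a \<in> vanishing n (Suc n, j, k)"
  hence aM: "a \<in> M (Suc n)" using U_le by (auto simp: vanishing_def)
  { fix b assume b: "b \<in> vanishing n (Suc n, j, k)"
    hence bM: "b \<in> M (Suc n)" using U_le by (auto simp: vanishing_def)
    have "L j \<oplus>\<^bsub>C j\<^esub> L j = L j"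
      using cyclic_add[of \<zero> \<zero> j 0] by (simp add: monomial_zero L_coset_zero)
    thus "a \<oplus> b \<in> vanishing n (Suc n, j, k)"
      using a b coord_add[OF aM bM s] by (simp add: vanishing_def) }
  fix c assume c: "c \<in> carrier R"
  thus "c \<otimes> a \<in> vanishing n (Suc n, j, k)"
    using a coord_scalar[OF aM c s] U.I_l_closed[OF _ c] by (simp add: vanishing_def cyclic_smult_zero)
qed

text \<open>If \<open>y\<close> has an invertible coordinate \<open>c\<close>, then the coordinate \<open>d\<close> of \<open>z\<close> is cancelled by
\<open>d c\<^sup>-\<^sup>1\<close> times \<open>y\<close>.\<close>

lemma vanishing_coatom:
  assumes s: "(Suc n, j, k) \<in> S2"
    and y: "y \<in> U n" "y \<notin> vanishing n (Suc n, j, k)" and z: "z \<in> U n"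
  shows "\<exists>a\<in>carrier R. z \<ominus> a \<otimes> y \<in> vanishing n (Suc n, j, k)"
proof -
  interpret U: ideal "U n" R by (rule U_ideal)
  have yM: "y \<in> M (Suc n)" and zM: "z \<in> M (Suc n)" using y(1) z U_le by auto
  obtain c where c: "c \<in> carrier R" "tors_coord (Suc n) y (Suc n, j, k) = res j 0 c"
    using residue_exists[OF yM s] by blast
  obtain d where d: "d \<in> carrier R" "tors_coord (Suc n) z (Suc n, j, k) = res j 0 d"
    using residue_exists[OF zM s] by blast
  have "c \<notin> \<mm>" using y c residue_zero_iff[OF s c(1)] by (auto simp: vanishing_def)
  then obtain a where a: "a \<in> carrier R" "\<one> \<ominus> a \<otimes> c \<in> \<mm>" using maximalideal_coprime[OF max c(1)] by blast
  \<comment> \<open>Here \<open>a\<close> inverts \<open>c\<close> modulo the maximal ideal.\<close>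
  define b where "b = \<ominus> (d \<otimes> a)"
  have b: "b \<in> carrier R" using a d by (simp add: b_def)
  have byM: "b \<otimes> y \<in> M (Suc n)" using ideal.I_l_closed[OF pow_ideal yM b] .
  have eq: "z \<ominus> (d \<otimes> a) \<otimes> y = z \<oplus> b \<otimes> y"
    unfolding b_def using a d pow_carrier[OF yM] by (simp add: minus_eq l_minus)
  have "d \<oplus> b \<otimes> c = d \<otimes> (\<one> \<ominus> a \<otimes> c)" unfolding b_def using a(1) c(1) d(1) by algebra
  hence dbc: "d \<oplus> b \<otimes> c \<in> \<mm>" using ideal.I_l_closed[OF m_ideal a(2) d(1)] by simp
  have "tors_coord (Suc n) (z \<oplus> b \<otimes> y) (Suc n, j, k) = res j 0 d \<oplus>\<^bsub>C j\<^esub> (monomial 0 b \<odot>\<^bsub>C j\<^esub> res j 0 c)"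
    using coord_add[OF zM byM s] coord_scalar[OF yM b s] c(2) d(2) by simp
  also have "\<dots> = res j 0 (d \<oplus> b \<otimes> c)"
    using cyclic_smult[OF b c(1), where p = 0 and n = 0 and j = j] cyclic_add[OF d(1) m_closed[OF b c(1)], where j = j and n = 0]
    by simp
  also have "\<dots> = L j"
    using residue_zero_iff[OF s m_carrier[OF dbc]] dbc by simp
  finally have "z \<ominus> (d \<otimes> a) \<otimes> y \<in> vanishing n (Suc n, j, k)"
    unfolding eq vanishing_def using U.a_closed[OF z U.I_l_closed[OF y(1) b]] by simp
  thus ?thesis using a d by blast
qed

text \<open>The torsion summands generated in degree \<open>i = n + 1\<close> that are killed by \<open>(x\<^sup>*)\<^sup>r\<^sup>-\<^sup>1\<^sup>-\<^sup>i\<close>.\<close>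

definition short_torsion :: "nat \<Rightarrow> (nat \<times> nat \<times> nat) set" where
  "short_torsion n = {(i, j, k) \<in> S2. i = Suc n \<and> j \<le> r - Suc (Suc n)}"

lemma card_short_torsion:
  assumes "Suc n < r"
  shows "finite (short_torsion n)" "card (short_torsion n) = (\<Sum>j=1..r - Suc (Suc n). \<tau> (Suc n) j)"
proof -
  have eq: "short_torsion n = (\<lambda>(j, k). (Suc n, j, k)) ` (SIGMA j:{1..r - Suc (Suc n)}. {..<\<tau> (Suc n) j})"
    using assms by (auto simp: short_torsion_def)
  show "finite (short_torsion n)" unfolding eq by auto
  have "inj_on (\<lambda>(j, k). (Suc n, j, k)) (SIGMA j:{1..r - Suc (Suc n)}. {..<\<tau> (Suc n) j})"
    by (auto simp: inj_on_def)
  thus "card (short_torsion n) = (\<Sum>j=1..r - Suc (Suc n). \<tau> (Suc n) j)"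
    unfolding eq by (simp add: card_image)
qed

lemma mem_E_iff:
  assumes "Suc n < r" "a \<in> M (Suc n)"
  shows "a \<in> E (Suc n) \<longleftrightarrow> x [^] (r - Suc (Suc n)) \<otimes> a \<in> M (Suc ((r - Suc (Suc n)) + Suc n))"
proof -
  have "Suc ((r - Suc (Suc n)) + Suc n) = r" using assms(1) by simp
  thus ?thesis using assms pow_carrier[OF assms(2)] D_eq_colon[of "Suc (Suc n)"]
    by (simp add: E_def colon_def)
qed

text \<open>The generator of the summand \<open>s\<close> lifts to an element of the ring. Since \<open>s\<close> is short, this generator is
killed by the power of \<open>x\<^sup>*\<close> that defines \<open>E (n+1)\<close>, so the lift lies in \<open>E (n+1)\<close>.\<close>

lemma vanishing_dual:
  assumes n: "Suc n < r" and s: "s \<in> short_torsion n"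
  shows "\<exists>e\<in>U n. e \<notin> vanishing n s \<and> (\<forall>t\<in>short_torsion n - {s}. e \<in> vanishing n t)"
proof -
  let ?p = "r - Suc (Suc n)"
  obtain j k where jk: "s = (Suc n, j, k)" "(Suc n, j, k) \<in> S2" "j \<le> ?p"
    using s by (auto simp: short_torsion_def)
  define v where "v = (\<lambda>t\<in>S2. if t = s then res j 0 \<one> else zero2 t)"
  have "zero1 \<in> component H1 (Suc n)"
    unfolding component_H1 zero1_def using monomial_zero by (auto intro!: bexI[of _ \<zero>])
  moreover have "v \<in> component H2 (Suc n)"
    unfolding component_H2
  proof (intro conjI ballI)
    show "v \<in> extensional S2" by (simp add: v_def)
    fix t assume t: "t \<in> S2"
    obtain i' j' k' where t': "t = (i', j', k')" by (cases t) auto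
    have "L j' = res j' m \<zero>" for m by (simp add: monomial_zero L_coset_zero)
    hence "if Suc n < i' then v t = L j' else \<exists>c\<in>carrier R. v t = res j' (Suc n - i') c"
    proof (cases "t = s")
      case True
      hence "i' = Suc n" "v t = res j' 0 \<one>" using t jk(1) unfolding t' v_def by auto
      thus ?thesis by auto
    next
      case False
      hence "v t = L j'" using t unfolding t' v_def zero2_def by simp
      thus ?thesis using \<open>\<And>m. L j' = res j' m \<zero>\<close> by auto
    qed
    thus "case t of (i, j, k) \<Rightarrow> if Suc n < i then v (i, j, k) = L j
        else \<exists>c\<in>carrier R. v (i, j, k) = res j (Suc n - i) c" unfolding t' by simp
  qed
  ultimately obtain a where a: "a \<in> M (Suc n)" "free_coord (Suc n) a = zero1" "tors_coord (Suc n) a = v"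
    by (rule coord_surj)
  have "free_coord (?p + Suc n) (x [^] ?p \<otimes> a) = zero1"
    unfolding coord_xpow(1)[OF a(1)] a(2) zero1_def
    by (auto simp: fun_eq_iff restrict_def monomial_mult_zero)
  moreover have "tors_coord (?p + Suc n) (x [^] ?p \<otimes> a) = zero2"
  proof -
    have "monomial ?p \<one> \<odot>\<^bsub>C j\<^esub> res j 0 \<one> = L j"
      using cyclic_smult[of \<one> \<one>, where p = ?p and n = 0 and j = j] L_coset_monomial_eq_iff[of \<one> \<zero> j ?p] jk(3)
      by (simp add: monomial_zero L_coset_zero)
    hence "monomial ?p \<one> \<odot>\<^bsub>C j'\<^esub> v (i', j', k') = L j'" if "(i', j', k') \<in> S2" for i' j' k'
      using that jk(1) by (simp add: v_def zero2_def cyclic_smult_zero)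
    thus ?thesis
      unfolding coord_xpow(2)[OF a(1)] a(3) zero2_def by (auto simp: fun_eq_iff restrict_def)
  qed
  ultimately have "x [^] ?p \<otimes> a \<in> M (Suc (?p + Suc n))"
    using coord_zero_iff[OF xpow_mult_mem[OF a(1), of ?p]] by simp
  hence "a \<in> E (Suc n)" using mem_E_iff[OF n a(1)] by simp
  hence aU: "a \<in> U n" using ideal_add_upper(2)[OF xM_ideal E_ideal] by blast
  have "\<one> \<notin> \<mm>" using maximalideal.I_notcarr[OF max] ideal.one_imp_carrier[OF m_ideal] by auto
  hence "a \<notin> vanishing n s"
    using residue_zero_iff[OF jk(2) one_closed] jk(1,2) by (simp add: vanishing_def a(3) v_def)
  moreover have "a \<in> vanishing n t" if "t \<in> short_torsion n - {s}" for t
    using that aU by (auto simp: vanishing_def a(3) v_def zero2_def short_torsion_def)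
  ultimately show ?thesis using aU by blast
qed

lemma tors_coord_x_mult:
  assumes b: "b \<in> M n" and s: "(Suc n, j, k) \<in> S2"
  shows "tors_coord (Suc n) (x \<otimes> b) (Suc n, j, k) = L j"
proof -
  have "\<forall>(i', j, k)\<in>S2. if n < i' then tors_coord n b (i', j, k) = L j
      else \<exists>c\<in>carrier R. tors_coord n b (i', j, k) = res j (n - i') c"
    using coord_component(2)[OF b] unfolding component_H2 by blast
  from bspec[OF this s] have "tors_coord n b (Suc n, j, k) = L j" by simp
  thus ?thesis using coord_xpow(2)[OF b, of 1] s by (simp add: cyclic_smult_zero)
qed

lemma V_le_vanishing:
  assumes s: "(Suc n, j, k) \<in> S2"
  shows "V n \<subseteq> vanishing n (Suc n, j, k)"
proof (rule ideal_add_subset[OF xM_ideal pow_ideal vanishing_ideal[OF s]])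
  note up = ideal_add_upper[OF xM_ideal[of n] pow_ideal[of "Suc (Suc n)"]] V_le_U[of n]
  show "x <# M n \<subseteq> vanishing n (Suc n, j, k)"
    using up tors_coord_x_mult[OF _ s] by (auto simp: vanishing_def l_coset_def)
  have "tors_coord (Suc n) a (Suc n, j, k) = L j" if a: "a \<in> M (Suc (Suc n))" for a
  proof -
    have "a \<in> M (Suc n)" using a pow_antimono[of "Suc n" "Suc (Suc n)"] by auto
    thus ?thesis using coord_zero_iff[of a "Suc n"] a s by (simp add: zero2_def)
  qed
  thus "M (Suc (Suc n)) \<subseteq> vanishing n (Suc n, j, k)"
    using up by (auto simp: vanishing_def)
qed

text \<open>It has to be shown that the class of \<open>e\<close> is a multiple of \<open>x\<^sup>*\<close>, and this can be done in each coordinate.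
In summands generated in lower degree, every element of degree \<open>n + 1\<close> is a multiple of \<open>x\<^sup>*\<close>,
and summands generated in higher degree have no such elements except zero.
In summands generated in degree \<open>n + 1\<close>, the coordinate is zero: for short torsion by hypothesis,
and otherwise because \<open>e \<in> E (n+1)\<close> is killed by a power of \<open>x\<^sup>*\<close> that is injective on the
part of degree \<open>n + 1\<close> of such a summand. The coordinates of the quotient by \<open>x\<^sup>*\<close> are then assembled to an element \<open>b\<close> of \<open>\<mm>\<^sup>n\<close>.\<close>

lemma E_vanishing_le_V:
  assumes n: "Suc n < r" and e: "e \<in> E (Suc n)"
    and van: "\<And>j k. (Suc n, j, k) \<in> short_torsion n \<Longrightarrow> tors_coord (Suc n) e (Suc n, j, k) = L j"
  shows "e \<in> V n"
proof -
  let ?p = "r - Suc (Suc n)"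
  have eM: "e \<in> M (Suc n)" using e by (simp add: E_def)
  have "x [^] ?p \<otimes> e \<in> M (Suc (?p + Suc n))" using mem_E_iff[OF n eM] e by simp
  hence kill: "free_coord (?p + Suc n) (x [^] ?p \<otimes> e) = zero1" "tors_coord (?p + Suc n) (x [^] ?p \<otimes> e) = zero2"
    using coord_zero_iff[OF xpow_mult_mem[OF eM, of ?p]] by auto
  have c1: "if Suc n < i then free_coord (Suc n) e (i, k) = FJ
      else \<exists>c\<in>carrier R. free_coord (Suc n) e (i, k) = monomial (Suc n - i) c" if "(i, k) \<in> S1" for i k
    using coord_component(1)[OF eM] that unfolding component_H1 by fast
  have c2: "if Suc n < i then tors_coord (Suc n) e (i, j, k) = L j
      else \<exists>c\<in>carrier R. tors_coord (Suc n) e (i, j, k) = res j (Suc n - i) c" if "(i, j, k) \<in> S2" for i j k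
    using coord_component(2)[OF eM] that unfolding component_H2 by fast
  have "\<exists>w. \<forall>s\<in>S1. (case s of (i, k) \<Rightarrow> (if n < i then w s = FJ else \<exists>c\<in>carrier R. w s = monomial (n - i) c)
      \<and> monomial 1 \<one> \<odot>\<^bsub>F\<^esub> w s = free_coord (Suc n) e (i, k))"
  proof (rule bchoice, rule ballI)
    fix s assume s: "s \<in> S1"
    obtain i k where ik: "s = (i, k)" by (cases s)
    hence ikS: "(i, k) \<in> S1" using s by simp
    consider "Suc n < i" | "i = Suc n" | "i \<le> n" by linarith
    hence "\<exists>w. (if n < i then w = FJ else \<exists>c\<in>carrier R. w = monomial (n - i) c)
      \<and> monomial 1 \<one> \<odot>\<^bsub>F\<^esub> w = free_coord (Suc n) e (i, k)"
    proof cases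
      case 1
      thus ?thesis using c1[OF ikS] by (intro exI[of _ FJ]) (simp add: monomial_mult_zero)
    next
      case 2
      then obtain c where c: "c \<in> carrier R" "free_coord (Suc n) e (i, k) = monomial 0 c" using c1[OF ikS] by auto
      have "monomial ?p \<one> \<odot>\<^bsub>F\<^esub> monomial 0 c = FJ"
        using fun_cong[OF kill(1)[unfolded coord_xpow(1)[OF eM] zero1_def], of "(i, k)"] ikS c(2) by simp
      hence "c \<in> \<mm>" using monomial_mult[OF one_closed c(1), of ?p 0] monomial_eq_zero_iff[OF c(1)] c(1) by simp
      hence "free_coord (Suc n) e (i, k) = FJ" using c monomial_eq_zero_iff by simp
      thus ?thesis using 2 by (intro exI[of _ FJ]) (simp add: monomial_mult_zero)
    next
      case 3
      then obtain c where c: "c \<in> carrier R" "free_coord (Suc n) e (i, k) = monomial (Suc n - i) c" using c1[OF ikS] by auto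
      thus ?thesis using 3 monomial_mult[OF one_closed c(1), of 1 "n - i"]
        by (intro exI[of _ "monomial (n - i) c"]) (auto simp: Suc_diff_le)
    qed
    thus "\<exists>w. case s of (i, k) \<Rightarrow> (if n < i then w = FJ else \<exists>c\<in>carrier R. w = monomial (n - i) c)
      \<and> monomial 1 \<one> \<odot>\<^bsub>F\<^esub> w = free_coord (Suc n) e (i, k)" unfolding ik by simp
  qed
  \<comment> \<open>Coordinates of the quotient by \<open>x\<^sup>*\<close> in the free summands; those in the torsion summands follow.\<close>
  then obtain w1 where w1: "\<And>i k. (i, k) \<in> S1 \<Longrightarrow> (if n < i then w1 (i, k) = FJ else \<exists>c\<in>carrier R. w1 (i, k) = monomial (n - i) c)"
    "\<And>i k. (i, k) \<in> S1 \<Longrightarrow> monomial 1 \<one> \<odot>\<^bsub>F\<^esub> w1 (i, k) = free_coord (Suc n) e (i, k)"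
    by fast
  have "\<exists>w. \<forall>s\<in>S2. (case s of (i, j, k) \<Rightarrow> (if n < i then w s = L j else \<exists>c\<in>carrier R. w s = res j (n - i) c)
      \<and> monomial 1 \<one> \<odot>\<^bsub>C j\<^esub> w s = tors_coord (Suc n) e (i, j, k))"
  proof (rule bchoice, rule ballI)
    fix s assume s: "s \<in> S2"
    obtain i j k where ik: "s = (i, j, k)" by (cases s)
    hence ikS: "(i, j, k) \<in> S2" using s by simp
    consider "Suc n < i" | "i = Suc n" | "i \<le> n" by linarith
    hence "\<exists>w. (if n < i then w = L j else \<exists>c\<in>carrier R. w = res j (n - i) c)
      \<and> monomial 1 \<one> \<odot>\<^bsub>C j\<^esub> w = tors_coord (Suc n) e (i, j, k)"
    proof cases
      case 1
      thus ?thesis using c2[OF ikS] by (intro exI[of _ "L j"]) (simp add: cyclic_smult_zero)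
    next
      case 2
      have "tors_coord (Suc n) e (i, j, k) = L j"
      proof (cases "j \<le> ?p")
        case True
        thus ?thesis using van[of j k] ikS 2 by (simp add: short_torsion_def)
      next
        case False
        obtain c where c: "c \<in> carrier R" "tors_coord (Suc n) e (i, j, k) = res j 0 c" using c2[OF ikS] 2 by auto
        have "monomial ?p \<one> \<odot>\<^bsub>C j\<^esub> res j 0 c = L j"
          using fun_cong[OF kill(2)[unfolded coord_xpow(2)[OF eM] zero2_def], of "(i, j, k)"] ikS c(2) by simp
        hence "res j ?p c = res j ?p \<zero>"
          using cyclic_smult[OF one_closed c(1), where p = ?p and n = 0 and j = j] c(1)
          by (simp add: monomial_zero L_coset_zero)
        hence "c \<in> \<mm>" using L_coset_monomial_eq_iff[OF c(1) zero_closed, of j ?p] False c(1) by (simp add: minus_eq)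
        thus ?thesis using residue_zero_iff[OF ikS c(1)] c(2) by simp
      qed
      thus ?thesis using 2 by (intro exI[of _ "L j"]) (simp add: cyclic_smult_zero)
    next
      case 3
      then obtain c where c: "c \<in> carrier R" "tors_coord (Suc n) e (i, j, k) = res j (Suc n - i) c" using c2[OF ikS] by auto
      thus ?thesis using 3 cyclic_smult[OF one_closed c(1), where p = 1 and n = "n - i" and j = j]
        by (intro exI[of _ "res j (n - i) c"]) (auto simp: Suc_diff_le)
    qed
    thus "\<exists>w. case s of (i, j, k) \<Rightarrow> (if n < i then w = L j else \<exists>c\<in>carrier R. w = res j (n - i) c)
      \<and> monomial 1 \<one> \<odot>\<^bsub>C j\<^esub> w = tors_coord (Suc n) e (i, j, k)" unfolding ik by simp
  qed
  then obtain w2 where w2: "\<And>i j k. (i, j, k) \<in> S2 \<Longrightarrow> (if n < i then w2 (i, j, k) = L j else \<exists>c\<in>carrier R. w2 (i, j, k) = res j (n - i) c)"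
    "\<And>i j k. (i, j, k) \<in> S2 \<Longrightarrow> monomial 1 \<one> \<odot>\<^bsub>C j\<^esub> w2 (i, j, k) = tors_coord (Suc n) e (i, j, k)"
    by fast
  have "restrict w1 S1 \<in> component H1 n" unfolding component_H1
  proof (intro conjI restrict_extensional ballI)
    fix s assume "s \<in> S1"
    thus "case s of (i, k) \<Rightarrow> if n < i then restrict w1 S1 (i, k) = FJ
        else \<exists>c\<in>carrier R. restrict w1 S1 (i, k) = monomial (n - i) c"
      using w1(1) by (cases s) simp
  qed
  moreover have "restrict w2 S2 \<in> component H2 n" unfolding component_H2
  proof (intro conjI restrict_extensional ballI)
    fix s assume "s \<in> S2"
    thus "case s of (i, j, k) \<Rightarrow> if n < i then restrict w2 S2 (i, j, k) = L j
        else \<exists>c\<in>carrier R. restrict w2 S2 (i, j, k) = res j (n - i) c"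
      using w2(1) by (cases s) simp
  qed
  ultimately obtain b where b: "b \<in> M n" "free_coord n b = restrict w1 S1" "tors_coord n b = restrict w2 S2"
    by (rule coord_surj)
  have xb: "x \<otimes> b \<in> M (Suc n)" by (rule pow_Suc_mult[OF x_in b(1)])
  have ext: "free_coord (Suc n) e \<in> extensional S1" "tors_coord (Suc n) e \<in> extensional S2"
    using coord_component[OF eM] unfolding component_H1 component_H2 by blast+
  have "free_coord (Suc n) (x \<otimes> b) = free_coord (Suc n) e"
  proof (rule extensionalityI[OF _ ext(1)])
    have eq: "free_coord (Suc n) (x \<otimes> b) = (\<lambda>(i, k)\<in>S1. monomial 1 \<one> \<odot>\<^bsub>F\<^esub> restrict w1 S1 (i, k))"
      using coord_xpow(1)[OF b(1), of 1] b(2) by simp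
    show "free_coord (Suc n) (x \<otimes> b) \<in> extensional S1" unfolding eq by simp
    fix s assume "s \<in> S1"
    thus "free_coord (Suc n) (x \<otimes> b) s = free_coord (Suc n) e s" unfolding eq using w1(2) by (cases s) simp
  qed
  moreover have "tors_coord (Suc n) (x \<otimes> b) = tors_coord (Suc n) e"
  proof (rule extensionalityI[OF _ ext(2)])
    have eq: "tors_coord (Suc n) (x \<otimes> b) = (\<lambda>(i, j, k)\<in>S2. monomial 1 \<one> \<odot>\<^bsub>C j\<^esub> restrict w2 S2 (i, j, k))"
      using coord_xpow(2)[OF b(1), of 1] b(3) by simp
    show "tors_coord (Suc n) (x \<otimes> b) \<in> extensional S2" unfolding eq by simp
    fix s assume "s \<in> S2"
    thus "tors_coord (Suc n) (x \<otimes> b) s = tors_coord (Suc n) e s" unfolding eq using w2(2) by (cases s) simp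
  qed
  ultimately have diff: "e \<ominus> x \<otimes> b \<in> M (Suc (Suc n))"
    using coord_inj[OF eM xb] by simp
  have "e = x \<otimes> b \<oplus> (e \<ominus> x \<otimes> b)"
    using pow_carrier[OF eM] pow_carrier[OF b(1)] x_carrier by algebra
  moreover have "x \<otimes> b \<in> x <# M n" using b(1) by (auto simp: l_coset_def)
  ultimately show ?thesis using diff unfolding set_add_def' by blast
qed

lemma V_eq_vanishing:
  assumes n: "Suc n < r"
  shows "V n = {a \<in> U n. \<forall>s\<in>short_torsion n. a \<in> vanishing n s}"
proof
  show "V n \<subseteq> {a \<in> U n. \<forall>s\<in>short_torsion n. a \<in> vanishing n s}"
    using V_le_U V_le_vanishing by (fastforce simp: short_torsion_def)
  show "{a \<in> U n. \<forall>s\<in>short_torsion n. a \<in> vanishing n s} \<subseteq> V n"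
  proof
    fix a assume "a \<in> {a \<in> U n. \<forall>s\<in>short_torsion n. a \<in> vanishing n s}"
    hence aU: "a \<in> U n" and van: "\<And>s. s \<in> short_torsion n \<Longrightarrow> a \<in> vanishing n s" by auto
    obtain y e where ye: "y \<in> x <# M n" "e \<in> E (Suc n)" "a = y \<oplus> e" using aU by (auto simp: set_add_def')
    have yV: "y \<in> V n" using ye(1) ideal_add_upper(1)[OF xM_ideal pow_ideal] by blast
    have c: "y \<in> carrier R" "e \<in> carrier R"
      using yV ye(2) ideal_carrier_subset[OF V_ideal] ideal_carrier_subset[OF E_ideal] by blast+
    have "tors_coord (Suc n) e (Suc n, j, k) = L j" if s: "(Suc n, j, k) \<in> short_torsion n" for j k
    proof -
      have sS: "(Suc n, j, k) \<in> S2" using s by (simp add: short_torsion_def)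
      interpret W: ideal "vanishing n (Suc n, j, k)" R by (rule vanishing_ideal[OF sS])
      have "\<ominus> y \<oplus> a \<in> vanishing n (Suc n, j, k)"
        using van[OF s] V_le_vanishing[OF sS] yV by (intro W.a_closed W.a_inv_closed) auto
      moreover have "\<ominus> y \<oplus> a = e" unfolding ye(3) using c by algebra
      ultimately show ?thesis by (simp add: vanishing_def)
    qed
    hence "e \<in> V n" by (rule E_vanishing_le_V[OF n ye(2)])
    thus "a \<in> V n" unfolding ye(3) using yV additive_subgroup.a_closed[OF ideal.axioms(1)[OF V_ideal]] by blast
  qed
qed

text \<open>For \<open>n + 1 < r\<close> the coordinates at the short torsion summands form a dual system for the gap, by
\<open>V_eq_vanishing\<close> and \<open>vanishing_dual\<close>. For \<open>n + 1 = r\<close> both sides are zero since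
\<open>E r = \<mm>\<^sup>r\<^sup>+\<^sup>1\<close>.\<close>

theorem generator_gap_eq:
  assumes "Suc n \<le> r"
  shows "generator_gap n = (\<Sum>j=1..r - Suc n - 1. \<tau> (Suc n) j)"
proof (cases "Suc n = r")
  case True
  have "E (Suc n) = M (Suc (Suc n))"
    using D_Suc_r pow_antimono[of r "Suc r"] True by (auto simp: E_def)
  hence "generator_gap n = ell (V n) (V n)" unfolding generator_gap_def by simp
  also have "\<dots> = 0" by (simp add: ell_def ideal_length_self[OF V_ideal] zero_enat_def)
  finally show ?thesis using True by simp
next
  case False
  hence n: "Suc n < r" using assms by simp
  have "ideal_length R (U n) {a \<in> U n. \<forall>s\<in>short_torsion n. a \<in> vanishing n s} = enat (card (short_torsion n))"
  proof (rule conjunct2[OF ideal_length_Inter_dual[OF card_short_torsion(1)[OF n] U_ideal]])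
    show "ideal (vanishing n s) R" if "s \<in> short_torsion n" for s
      using that vanishing_ideal by (auto simp: short_torsion_def)
    show "\<exists>a\<in>carrier R. z \<ominus> a \<otimes> y \<in> vanishing n s"
      if st: "s \<in> short_torsion n" and yz: "y \<in> U n" "y \<notin> vanishing n s" "z \<in> U n" for s y z
    proof -
      obtain j k where "s = (Suc n, j, k)" "(Suc n, j, k) \<in> S2"
        using st by (cases s) (auto simp: short_torsion_def)
      thus ?thesis using vanishing_coatom yz by simp
    qed
  qed (rule vanishing_dual[OF n])
  thus ?thesis
    unfolding generator_gap_def ell_def V_eq_vanishing[OF n] by (simp add: card_short_torsion(2)[OF n])
qed

end

section \<open>The identity for the decomposed tangent cone\<close>

theorem corollary3p5:
  fixes A :: "('a, 'c) ring_scheme" and \<mm> :: "'a set" and x :: 'a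
    and r i :: nat and \<alpha> :: "nat \<Rightarrow> nat" and \<tau> :: "nat \<Rightarrow> nat \<Rightarrow> nat"
  assumes "cohen_macaulay_local_ring A \<mm>"
    and "krull_dim A = 1"
    and "infinite (carrier (A Quot \<mm>))"
    and "minimal_reduction A \<mm> x"
    and "r = reduction_number A \<mm> x"
    and "tangent_cone_invariants A \<mm> x \<alpha> \<tau>"
    and "1 \<le> i" and "i \<le> r"
  shows "micro_invariant A \<mm> x i + (\<Sum>j=1..r - i - 1. int (\<tau> i j))
       = int (apery_invariant A \<mm> x i) + int (nu_invariant A \<mm> x i)
         + int (g_invariant A \<mm> x i) - int (g_invariant A \<mm> x (i - 1))"
proof -
  have A: "cring A" "noetherian_ring A" "maximalideal \<mm> A" and depth: "local_depth A \<mm> = 1"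
    using assms(1,2) by (auto simp: cohen_macaulay_local_ring_def noetherian_local_ring_def)
  interpret A: cring A by fact
  have id: "ideal \<mm> A" using A(3) maximalideal.axioms(1) by blast
  have x: "x \<in> \<mm>" and red: "ideal_pow A \<mm> (Suc r) = x <#\<^bsub>A\<^esub> ideal_pow A \<mm> r"
  proof -
    show "x \<in> \<mm>" using assms(4) by (simp add: minimal_reduction_def)
    have "\<exists>n. ideal_pow A \<mm> (n + 1) = x <#\<^bsub>A\<^esub> ideal_pow A \<mm> n"
      using assms(4) unfolding minimal_reduction_def by blast
    from LeastI_ex[OF this] show "ideal_pow A \<mm> (Suc r) = x <#\<^bsub>A\<^esub> ideal_pow A \<mm> r"
      unfolding assms(5) reduction_number_def by simp
  qed
  have "local_depth A \<mm> \<noteq> 0" using depth by simp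
  then obtain y where y: "y \<in> \<mm>" "y \<in> regular_elements A"
    using A.exists_regular_of_depth[OF _ ideal_carrier_subset[OF id]] by metis
  have reg: "x \<in> regular_elements A"
    by (rule A.reduction_regular[OF id x red y])
  have loc: "noetherian_reduction A \<mm> x r"
    using A reg x red
    by (intro noetherian_reduction.intro principal_reduction.intro principal_reduction_axioms.intro)
  obtain \<phi> where "cone_decomposition A \<mm> x r \<alpha> \<tau> \<phi>"
    using assms(6) unfolding tangent_cone_invariants_def Let_def assms(5)[symmetric]
    by (elim exE, intro that cone_decomposition.intro[OF loc] cone_decomposition_axioms.intro) assumption
  then interpret cone_decomposition A \<mm> x r \<alpha> \<tau> \<phi> .
  obtain k where k: "i = Suc k" using assms(7) by (cases i) auto
  show ?thesis
    using micro_apery_balance[OF assms(5), of k] generator_gap_eq[of k] assms(8) unfolding k by simp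
qed

end
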